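(* The automorphism group $\mathrm{Aut}(\mathbb{S})$ of the semigeneric tournament $\mathbb{S}$ is simple.
   Context: An oriented graph is a set with an irreflexive antisymmetric relation $\to$. Write $u\perp v$ if there is no edge between $u$ and $v$ in either direction (so $u\perp u$). An oriented graph is an $\omega$-partite tournament if $\perp$ is an equivalence relation on it; the equivalence classes are called parts. Let $\mathcal{S}$ be the class of finite $\omega$-partite tournaments satisfying the parity condition: for any two pairs $\{u,u'\}$ and $\{v,v'\}$ of vertices with $u\perp u'$, $v\perp v'$ (two distinct vertices in each pair) lying in two different parts, the number of edges directed from a vertex of $\{u,u'\}$ to a vertex of $\{v,v'\}$ is even. $\mathcal{S}$ is a Fraïssé class, and the semigeneric tournament $\mathbb{S}$ is its Fraïssé limit: the unique up to isomorphism countable ultrahomogeneous oriented graph (every isomorphism between finite substructures extends to an automorphism) whose finite substructures are, up to isomorphism, exactly the members of $\mathcal{S}$. *)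

theory Defs
  imports "HOL-Algebra.Bij" "HOL-Algebra.Coset" "HOL-Library.Countable_Set"
begin

text \<open>
  A graph is a vertex set \<open>V\<close> with an edge predicate \<open>E\<close>, where \<open>E u v\<close> means \<open>u \<rightarrow> v\<close>.
  Only the values of \<open>E\<close> on \<open>V\<close> matter, so the substructure induced on \<open>U \<subseteq> V\<close> is simply
  the pair \<open>U\<close>, \<open>E\<close>.
\<close>

definition oriented_graph :: "'a set \<Rightarrow> ('a \<Rightarrow> 'a \<Rightarrow> bool) \<Rightarrow> bool" where
  "oriented_graph V E \<longleftrightarrow> irreflp_on V E \<and> antisymp_on V E"

definition perp :: "('a \<Rightarrow> 'a \<Rightarrow> bool) \<Rightarrow> 'a \<Rightarrow> 'a \<Rightarrow> bool" where
  "perp E u v \<longleftrightarrow> \<not> E u v \<and> \<not> E v u"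

definition omega_partite_tournament :: "'a set \<Rightarrow> ('a \<Rightarrow> 'a \<Rightarrow> bool) \<Rightarrow> bool" where
  "omega_partite_tournament V E \<longleftrightarrow>
     oriented_graph V E \<and> equiv V {(u, v) \<in> V \<times> V. perp E u v}"

text \<open>
  When \<open>perp E\<close> is an equivalence relation on \<open>V\<close>, the hypothesis \<open>\<not> perp E u v\<close> below says
  that the two pairs lie in different parts.
\<close>

definition parity_condition :: "'a set \<Rightarrow> ('a \<Rightarrow> 'a \<Rightarrow> bool) \<Rightarrow> bool" where
  "parity_condition V E \<longleftrightarrow>
     (\<forall>u\<in>V. \<forall>u'\<in>V. \<forall>v\<in>V. \<forall>v'\<in>V.
        u \<noteq> u' \<and> v \<noteq> v' \<and> perp E u u' \<and> perp E v v' \<and> \<not> perp E u v \<longrightarrow>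
        even (card {(x, y) \<in> {u, u'} \<times> {v, v'}. E x y}))"

definition class_S :: "'a set \<Rightarrow> ('a \<Rightarrow> 'a \<Rightarrow> bool) \<Rightarrow> bool" where
  "class_S V E \<longleftrightarrow> finite V \<and> omega_partite_tournament V E \<and> parity_condition V E"

definition graph_iso ::
    "'a set \<Rightarrow> ('a \<Rightarrow> 'a \<Rightarrow> bool) \<Rightarrow> 'b set \<Rightarrow> ('b \<Rightarrow> 'b \<Rightarrow> bool) \<Rightarrow> ('a \<Rightarrow> 'b) \<Rightarrow> bool" where
  "graph_iso V E W F f \<longleftrightarrow>
     bij_betw f V W \<and> (\<forall>x\<in>V. \<forall>y\<in>V. E x y \<longleftrightarrow> F (f x) (f y))"

definition ultrahomogeneous :: "'a set \<Rightarrow> ('a \<Rightarrow> 'a \<Rightarrow> bool) \<Rightarrow> bool" where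
  "ultrahomogeneous V E \<longleftrightarrow>
     (\<forall>A B f. finite A \<and> A \<subseteq> V \<and> finite B \<and> B \<subseteq> V \<and> graph_iso A E B E f \<longrightarrow>
        (\<exists>g. graph_iso V E V E g \<and> (\<forall>x\<in>A. g x = f x)))"

text \<open>
  The semigeneric tournament is characterised up to isomorphism. Finite graphs on \<open>nat\<close>
  represent all isomorphism types of finite graphs, so the last clause says that every member
  of the class, on any type of vertices, is isomorphic to a finite substructure of \<open>(V, E)\<close>.
\<close>

definition semigeneric_tournament :: "'a set \<Rightarrow> ('a \<Rightarrow> 'a \<Rightarrow> bool) \<Rightarrow> bool" where
  "semigeneric_tournament V E \<longleftrightarrow>
     oriented_graph V E \<and> countable V \<and> ultrahomogeneous V E \<and>
     (\<forall>U. finite U \<and> U \<subseteq> V \<longrightarrow> class_S U E) \<and>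
     (\<forall>(W :: nat set) F. class_S W F \<longrightarrow> (\<exists>U f. finite U \<and> U \<subseteq> V \<and> graph_iso W F U E f))"

definition graph_Aut :: "'a set \<Rightarrow> ('a \<Rightarrow> 'a \<Rightarrow> bool) \<Rightarrow> ('a \<Rightarrow> 'a) monoid" where
  "graph_Aut V E = BijGroup V \<lparr>carrier := {f \<in> Bij V. graph_iso V E V E f}\<rparr>"

lemma group_graph_Aut: "group (graph_Aut V E)"
  unfolding graph_Aut_def
proof (rule subgroup.subgroup_is_group[OF _ group_BijGroup], rule subgroup.intro)
  show "{f \<in> Bij V. graph_iso V E V E f} \<subseteq> carrier (BijGroup V)"
    by (auto simp: BijGroup_def)
next
  fix f g
  assume "f \<in> {f \<in> Bij V. graph_iso V E V E f}" "g \<in> {f \<in> Bij V. graph_iso V E V E f}"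
  then show "f \<otimes>\<^bsub>BijGroup V\<^esub> g \<in> {f \<in> Bij V. graph_iso V E V E f}"
    by (auto simp: BijGroup_def compose_Bij graph_iso_def bij_betw_compose compose_eq
        dest: bij_betwE)
next
  show "\<one>\<^bsub>BijGroup V\<^esub> \<in> {f \<in> Bij V. graph_iso V E V E f}"
    using id_Bij[of V] by (auto simp: BijGroup_def graph_iso_def Bij_def)
next
  fix f
  assume "f \<in> {f \<in> Bij V. graph_iso V E V E f}"
  then have f: "f \<in> Bij V" "bij_betw f V V"
      "\<And>x y. x \<in> V \<Longrightarrow> y \<in> V \<Longrightarrow> E x y \<longleftrightarrow> E (f x) (f y)"
    by (auto simp: graph_iso_def)
  have "restrict (inv_into V f) V \<in> Bij V"
    by (rule restrict_inv_into_Bij[OF f(1)])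
  moreover have "E x y \<longleftrightarrow> E (inv_into V f x) (inv_into V f y)" if "x \<in> V" "y \<in> V" for x y
    using that f(3)[of "inv_into V f x" "inv_into V f y"] Bij_inv_into_mem[OF f(1)]
      bij_betw_inv_into_right[OF f(2)] by simp
  ultimately show "inv\<^bsub>BijGroup V\<^esub> f \<in> {f \<in> Bij V. graph_iso V E V E f}"
    by (auto simp: inv_BijGroup[OF f(1)] graph_iso_def Bij_def)
qed

text \<open>
  The library locale \<open>simple_group\<close> demands \<open>order G > 1\<close>, which fails for every infinite group
  because \<open>order\<close> is \<open>0\<close> there. Nontriviality is therefore stated directly.
\<close>

definition is_simple_group :: "('a, 'b) monoid_scheme \<Rightarrow> bool" where
  "is_simple_group G \<longleftrightarrow>
     group G \<and> carrier G \<noteq> {\<one>\<^bsub>G\<^esub>} \<and>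
     (\<forall>N. N \<lhd> G \<longrightarrow> N = {\<one>\<^bsub>G\<^esub>} \<or> N = carrier G)"

end

theory Submission
  imports Defs
begin

text \<open>
  Let \<open>N\<close> be a normal subgroup of \<open>Aut(S)\<close> and \<open>1 \<noteq> g \<in> N\<close>. Building \<open>k\<close> by finite approximations
  makes the commutator \<open>t = g\<^sup>-\<^sup>1 k\<^sup>-\<^sup>1 g k \<in> N\<close> tame: \<open>t\<close> has no finite orbit on the set of
  parts, and every one-point type in a new part is realised in infinitely many such orbits. Then every
  automorphism \<open>h\<close> is a product of three conjugates of \<open>t\<close>, so \<open>h \<in> N\<close>. The three conjugators are
  built simultaneously by a back-and-forth argument: a point \<open>x\<close> travels
  \<open>x \<rightarrow> d\<^sub>1 \<rightarrow> d\<^sub>2 \<rightarrow> h x\<close>, where the outer two steps prescribe the type of \<open>d\<^sub>1\<close> and of \<open>d\<^sub>2\<close>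
  over one side only. The middle conjugator must then send \<open>d\<^sub>1\<close> to some \<open>e\<close> with prescribed types of
  both \<open>e\<close> and \<open>t e\<close>; such an \<open>e\<close> exists because these are types of \<open>e\<close> over two sets that
  overlap only where the construction has already made them agree.
\<close>

text \<open>A path of two steps has one intermediate point, and that point would need two types at
  once, prescribed over the overlapping domains of two approximations; unlinked points may make them
  conflict. A path of three steps leaves one prescription each for \<open>d1\<close> and
  \<open>d2\<close> and moves the conflict to the image \<open>e\<close>, where it can be
  controlled: the prescriptions for \<open>e\<close> and \<open>t e\<close> interact only along
  orbits of \<open>t\<close>. Parity is the second obstacle. In a part that is already in use, a
  vertex is determined towards every other part up to reversal, so prescriptions must be compatible
  part by part and not only vertex by vertex. This is why convexity is demanded on parts as well,
  and why every extension step splits into the case of a new part and that of an old one. Tameness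
  is certified by a height that grows by one under \<open>t\<close>. It excludes periodic parts, and
  it fixes the exponent with which a point of a given part can reach a given vertex, so that finite
  data block only finitely many points of a part. The height cannot be read off from the finished
  commutator; it is built together with the approximations of \<open>k\<close>.\<close>

text \<open>A Rasiowa-Sikorski argument for countably many requirements: requirement
  \<open>i\<close> is met at stage \<open>Suc (to_nat i)\<close>. It is used for the commutator and
  for the three conjugators.\<close>

lemma generic_chain:
  fixes D :: "'i::countable \<Rightarrow> 's \<Rightarrow> bool"
  assumes s0: "P s0" and refl: "\<And>s. ext s s" and trans: "\<And>s t u. ext s t \<Longrightarrow> ext t u \<Longrightarrow> ext s u"
    and dense: "\<And>i s. P s \<Longrightarrow> \<exists>s'. P s' \<and> ext s s' \<and> D i s'"
  obtains f :: "nat \<Rightarrow> 's" where "f 0 = s0" "\<And>n. P (f n)"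
    "\<And>m n. m \<le> n \<Longrightarrow> ext (f m) (f n)" "\<And>i. \<exists>n. D i (f n)"
proof -
  define f where "f = rec_nat s0 (\<lambda>n s. SOME s'. P s' \<and> ext s s' \<and> D (from_nat n) s')"
  have f0: "f 0 = s0"
    and fS: "f (Suc n) = (SOME s'. P s' \<and> ext (f n) s' \<and> D (from_nat n) s')" for n
    by (simp_all add: f_def)
  have fstep: "P (f (Suc n)) \<and> ext (f n) (f (Suc n)) \<and> D (from_nat n) (f (Suc n))" if "P (f n)" for n
    unfolding fS using dense[OF that, of "from_nat n"] by (rule someI_ex)
  have P: "P (f n)" for n
    by (induction n) (use s0 f0 fstep in auto)
  have "ext (f m) (f n)" if "m \<le> n" for m n
    using that
  proof (induction n rule: dec_induct)
    case base
    show ?case by (rule refl)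
  next
    case (step n)
    show ?case using trans[OF step.IH] fstep[OF P] by blast
  qed
  moreover have "\<exists>n. D i (f n)" for i
    using fstep[OF P, of "to_nat i"] by auto
  ultimately show ?thesis
    using that[of f] f0 P by blast
qed

section \<open>Automorphisms and finite partial isomorphisms\<close>

text \<open>
  \<open>extend_new_part\<close> and \<open>extend_part\<close> are the one-point extension property. A vertex in the part of
  \<open>w\<close> must, by parity, have the same edges as \<open>w\<close> to every other part, up to reversing all of them.
\<close>
locale semigeneric =
  fixes E :: "nat \<Rightarrow> nat \<Rightarrow> bool"
  assumes asym: "E x y \<Longrightarrow> \<not> E y x"
    and perp_trans: "perp E x y \<Longrightarrow> perp E y z \<Longrightarrow> perp E x z"
    and parity: "perp E x x' \<Longrightarrow> perp E y y' \<Longrightarrow> \<not> perp E x y \<Longrightarrow>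
      (E x y \<longleftrightarrow> E x y') = (E x' y \<longleftrightarrow> E x' y')"
    and extend_new_part: "finite X \<Longrightarrow> \<exists>u. \<forall>x\<in>X. \<not> perp E u x \<and> (E u x \<longleftrightarrow> x \<in> S)"
    and extend_part: "finite X \<Longrightarrow>
      (\<And>x x'. \<lbrakk>x \<in> X; x' \<in> X; \<not> perp E x w; perp E x x'\<rbrakk> \<Longrightarrow>
        (x \<in> S \<longleftrightarrow> x' \<in> S) = (E w x \<longleftrightarrow> E w x')) \<Longrightarrow>
      \<exists>u. perp E u w \<and> u \<notin> X \<and> (\<forall>x\<in>X. \<not> perp E x w \<longrightarrow> (E u x \<longleftrightarrow> x \<in> S))"
begin

abbreviation same_part (infix "\<asymp>" 50) where "x \<asymp> y \<equiv> perp E x y"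

lemma irrefl [simp]: "\<not> E x x"
  using asym by blast

lemma perp_refl [simp]: "x \<asymp> x"
  by (simp add: perp_def)

lemma perp_sym: "x \<asymp> y \<Longrightarrow> y \<asymp> x"
  by (auto simp: perp_def)

text \<open>Turns chains of \<open>perp\<close> into equations between sets, which
  \<open>simp\<close> can then decide through \<open>perp_part\<close>.\<close>

definition part :: "nat \<Rightarrow> nat set" where
  "part x = {z. x \<asymp> z}"

lemma perp_part: "x \<asymp> y \<longleftrightarrow> part x = part y"
proof
  assume "x \<asymp> y"
  then show "part x = part y"
    unfolding part_def using perp_trans perp_sym by blast
next
  assume "part x = part y"
  then show "x \<asymp> y"
    unfolding part_def using perp_refl by blast
qed

lemma not_perp_rev: "\<not> x \<asymp> y \<Longrightarrow> E y x \<longleftrightarrow> \<not> E x y"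
  using asym by (auto simp: perp_def)

definition Aut :: "(nat \<Rightarrow> nat) set" where
  "Aut = {f. bij f \<and> (\<forall>x y. E (f x) (f y) \<longleftrightarrow> E x y)}"

lemma Aut_E: "f \<in> Aut \<Longrightarrow> E (f x) (f y) \<longleftrightarrow> E x y"
  by (simp add: Aut_def)

lemma Aut_perp: "f \<in> Aut \<Longrightarrow> f x \<asymp> f y \<longleftrightarrow> x \<asymp> y"
  by (simp add: perp_def Aut_E)

lemma Aut_bij: "f \<in> Aut \<Longrightarrow> bij f"
  by (simp add: Aut_def)

lemma Aut_eq: "f \<in> Aut \<Longrightarrow> f x = f y \<longleftrightarrow> x = y"
  by (meson Aut_bij bij_is_inj inj_eq)

abbreviation finv :: "(nat \<Rightarrow> nat) \<Rightarrow> nat \<Rightarrow> nat" where "finv \<equiv> inv_into UNIV"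

lemma Aut_f_inv: "f \<in> Aut \<Longrightarrow> f (finv f x) = x"
  by (meson Aut_bij bij_is_surj surj_f_inv_f)

lemma Aut_inv_f: "f \<in> Aut \<Longrightarrow> finv f (f x) = x"
  by (meson Aut_bij bij_is_inj inv_f_f)

lemma Aut_id [simp]: "id \<in> Aut"
  by (simp add: Aut_def)

lemma Aut_comp: "f \<in> Aut \<Longrightarrow> g \<in> Aut \<Longrightarrow> f \<circ> g \<in> Aut"
  by (auto simp: Aut_def intro: bij_comp)

lemma Aut_inv: "f \<in> Aut \<Longrightarrow> finv f \<in> Aut"
proof -
  assume f: "f \<in> Aut"
  have "E (finv f x) (finv f y) \<longleftrightarrow> E x y" for x y
    using Aut_E[OF f, of "finv f x" "finv f y"] by (simp add: Aut_f_inv[OF f])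
  then show ?thesis
    using f by (auto simp: Aut_def intro: bij_imp_bij_inv)
qed

lemma Aut_funpow: "f \<in> Aut \<Longrightarrow> f ^^ k \<in> Aut"
  by (induction k) (auto intro: Aut_comp)

lemma Aut_inv_perp: "f \<in> Aut \<Longrightarrow> finv f x \<asymp> y \<longleftrightarrow> x \<asymp> f y"
  using Aut_perp[of f "finv f x" y] by (simp add: Aut_f_inv)

lemma ex_same_part: "finite F \<Longrightarrow> \<exists>u. u \<asymp> w \<and> u \<notin> F"
  \<comment> \<open>Only points of the part of \<open>w\<close> are passed as \<open>X\<close>, so
    the parity hypothesis is vacuous; the rest of \<open>F\<close> is avoided because
    \<open>u\<close> stays in that part.\<close>
  using extend_part[of "{x \<in> F. x \<asymp> w}" w "{}"] by auto

text \<open>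
  The new vertex \<open>u\<close> does not separate \<open>v1\<close> from \<open>v2\<close> but separates \<open>g v1\<close> from \<open>g v2\<close>, so \<open>g\<close> cannot
  fix its part.
\<close>
lemma Aut_moves_part_aux:
  assumes g: "g \<in> Aut" and "finite X" and v: "v1 \<asymp> v2" "v1 \<noteq> v2" "{v1, v2} \<noteq> {g v1, g v2}"
    and X: "{v1, v2, g v1, g v2} \<inter> X = {}"
  shows "\<exists>u. \<not> g u \<asymp> u \<and> (\<forall>x\<in>X. \<not> u \<asymp> x \<and> (E u x \<longleftrightarrow> x \<in> S))"
proof -
  have ne: "g v1 \<noteq> g v2" using v(2) Aut_eq[OF g] by simp
  \<comment> \<open>The two pairs differ, so one of \<open>g v1\<close>, \<open>g v2\<close> lies
    outside \<open>{v1, v2}\<close> and its membership in \<open>T\<close> is still free. Nothing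
    changes on \<open>X\<close>, which misses all four points.\<close>
  obtain T where T: "v1 \<in> T \<longleftrightarrow> v2 \<in> T" "g v1 \<in> T \<longleftrightarrow> g v2 \<notin> T" "T \<inter> X = S \<inter> X"
  proof (cases "g v1 \<in> {v1, v2}")
    case True
    then have "g v2 \<notin> {v1, v2}" using ne v by auto
    then show ?thesis
      using that[of "(S \<inter> X) \<union> {v1, v2}"] X True by auto
  next
    case False
    then show ?thesis
      using that[of "(S \<inter> X) \<union> {v1, v2, g v2}"] X ne by auto
  qed
  obtain u where u: "\<forall>x\<in>X \<union> {v1, v2, g v1, g v2}. \<not> u \<asymp> x \<and> (E u x \<longleftrightarrow> x \<in> T)"
    using extend_new_part[of "X \<union> {v1, v2, g v1, g v2}" T] \<open>finite X\<close> by auto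
  have "\<not> g u \<asymp> u"
  proof
    assume "g u \<asymp> u"
    then have "u \<asymp> g u" using perp_sym by blast
    moreover have "g v1 \<asymp> g v2" "\<not> u \<asymp> g v1"
      using v(1) u by (simp_all add: Aut_perp[OF g])
    ultimately have "(E u (g v1) \<longleftrightarrow> E u (g v2)) = (E (g u) (g v1) \<longleftrightarrow> E (g u) (g v2))"
      by (rule parity)
    moreover have "E u x \<longleftrightarrow> x \<in> T" if "x \<in> {v1, v2, g v1, g v2}" for x
      using u that by blast
    ultimately show False
      using T(1,2) by (simp add: Aut_E[OF g])
  qed
  moreover have "\<forall>x\<in>X. \<not> u \<asymp> x \<and> (E u x \<longleftrightarrow> x \<in> S)"
    using u T(3) by blast
  ultimately show ?thesis by blast
qed

text \<open>The auxiliary lemma is applied twice. With empty \<open>X\<close> it turns a moved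
  vertex into a moved part, that of \<open>w\<close>. Two vertices of this part, chosen with their
  images off \<open>X\<close>, then form a pair distinct from its image, and the lemma applies over
  \<open>X\<close>.\<close>

lemma Aut_moves_part:
  assumes g: "g \<in> Aut" "g \<noteq> id" and X: "finite X"
  shows "\<exists>u. \<not> g u \<asymp> u \<and> (\<forall>x\<in>X. \<not> u \<asymp> x \<and> (E u x \<longleftrightarrow> x \<in> S))"
proof -
  obtain w where w: "\<not> g w \<asymp> w"
  proof -
    obtain v where v: "g v \<noteq> v" using g(2) by (auto simp: fun_eq_iff)
    obtain v' where v': "v' \<asymp> v" "v' \<notin> {v, g v}"
      using ex_same_part[of "{v, g v}" v] by auto
    have "{v', v} \<noteq> {g v', g v}" using v v' by auto
    then obtain u where "\<not> g u \<asymp> u"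
      using Aut_moves_part_aux[OF g(1), of "{}" v' v] v' by auto
    then show ?thesis using that by blast
  qed
  have fin: "finite (X \<union> finv g ` X)" using X by simp
  obtain v1 where v1: "v1 \<asymp> w" "v1 \<notin> X \<union> finv g ` X"
    using ex_same_part[OF fin, of w] by auto
  obtain v2 where v2: "v2 \<asymp> w" "v2 \<notin> insert v1 (X \<union> finv g ` X)"
    using ex_same_part[of "insert v1 (X \<union> finv g ` X)" w] fin by auto
  have "g v1 \<notin> X" "g v2 \<notin> X"
    using v1(2) v2(2) g(1) by (metis Aut_inv_f UnI2 image_eqI insertI2)+
  moreover have "g v1 \<asymp> g w" using v1(1) by (simp add: Aut_perp[OF g(1)])
  then have "\<not> g v1 \<asymp> v1" "\<not> g v1 \<asymp> v2"
    using w v1(1) v2(1) by (simp_all add: perp_part)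
  then have "{v1, v2} \<noteq> {g v1, g v2}" by (metis insertI1 insertE perp_refl singletonD)
  moreover have "v1 \<asymp> v2" using v1(1) v2(1) by (simp add: perp_part)
  ultimately show ?thesis
    using Aut_moves_part_aux[OF g(1) X, of v1 v2 S] v1(2) v2(2) by auto
qed

section \<open>Finite partial isomorphisms and their one-point extensions\<close>

definition piso :: "(nat \<times> nat) set \<Rightarrow> bool" where
  "piso y \<longleftrightarrow> finite y \<and>
     (\<forall>a b a' b'. (a, b) \<in> y \<longrightarrow> (a', b') \<in> y \<longrightarrow> (a = a' \<longleftrightarrow> b = b') \<and> (E a a' \<longleftrightarrow> E b b'))"

lemma piso_empty [simp]: "piso {}"
  by (simp add: piso_def)

lemma piso_finite: "piso y \<Longrightarrow> finite y" "piso y \<Longrightarrow> finite (Domain y)" "piso y \<Longrightarrow> finite (Range y)"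
  by (auto simp: piso_def finite_Domain finite_Range)

lemma piso_eq: "piso y \<Longrightarrow> (a, b) \<in> y \<Longrightarrow> (a', b') \<in> y \<Longrightarrow> a = a' \<longleftrightarrow> b = b'"
  unfolding piso_def by blast

lemma piso_E: "piso y \<Longrightarrow> (a, b) \<in> y \<Longrightarrow> (a', b') \<in> y \<Longrightarrow> E a a' \<longleftrightarrow> E b b'"
  unfolding piso_def by blast

lemma piso_perp: "piso y \<Longrightarrow> (a, b) \<in> y \<Longrightarrow> (a', b') \<in> y \<Longrightarrow> a \<asymp> a' \<longleftrightarrow> b \<asymp> b'"
  unfolding perp_def using piso_E by blast

lemma piso_converse [simp]: "piso (y\<inverse>) \<longleftrightarrow> piso y"
  unfolding piso_def by (simp, blast)

lemma piso_insert_converse: "piso (insert (b, a) (y\<inverse>)) \<longleftrightarrow> piso (insert (a, b) y)"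
proof -
  have "insert (b, a) (y\<inverse>) = (insert (a, b) y)\<inverse>" by auto
  then show ?thesis by simp
qed

text \<open>Edges into \<open>a\<close> need no check: they are determined by \<open>perp\<close>
  and by the edges out of \<open>a\<close>.\<close>

lemma piso_insert:
  assumes "piso y"
    and "\<And>v x. (v, x) \<in> y \<Longrightarrow> a \<noteq> v \<and> b \<noteq> x \<and> (a \<asymp> v \<longleftrightarrow> b \<asymp> x) \<and> (E a v \<longleftrightarrow> E b x)"
  shows "piso (insert (a, b) y)"
proof -
  have "E v a \<longleftrightarrow> E x b" if "(v, x) \<in> y" for v x
    using assms(2)[OF that] not_perp_rev by (metis perp_def)
  then show ?thesis
    using assms unfolding piso_def by auto
qed

lemma piso_insert_new:
  assumes "piso y"
    and "\<And>v x. (v, x) \<in> y \<Longrightarrow> \<not> a \<asymp> v \<and> \<not> b \<asymp> x \<and> (E a v \<longleftrightarrow> E b x)"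
  shows "piso (insert (a, b) y)"
  using assms(1) by (rule piso_insert) (use assms(2) perp_refl in blast)

text \<open>The edges demanded of \<open>b\<close> satisfy the hypothesis of
  \<open>extend_part\<close>, because the parity law for \<open>a\<close> and \<open>w\<close> on
  the domain side is carried over to \<open>c\<close> by \<open>y\<close>.\<close>

lemma piso_extend_part:
  assumes y: "piso y" and w: "(w, c) \<in> y" and a: "a \<asymp> w" "a \<notin> Domain y" and F: "finite F"
  shows "\<exists>b. b \<asymp> c \<and> b \<notin> F \<and> piso (insert (a, b) y)"
proof -
  \<comment> \<open>Only the points of \<open>F\<close> in the part of \<open>c\<close> are added:
    they impose no parity condition, and \<open>b\<close> avoids the others because it lies in that
    part.\<close>
  let ?X = "Range y \<union> {x \<in> F. x \<asymp> c}" and ?S = "{x. \<exists>v. (v, x) \<in> y \<and> E a v}"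
  have S: "x \<in> ?S \<longleftrightarrow> E a v" if "(v, x) \<in> y" for v x
    using that piso_eq[OF y] by auto
  have "(x \<in> ?S \<longleftrightarrow> x' \<in> ?S) = (E c x \<longleftrightarrow> E c x')"
    if x: "x \<in> ?X" "x' \<in> ?X" "\<not> x \<asymp> c" "x \<asymp> x'" for x x'
  proof -
    have "\<not> x' \<asymp> c" using x(3,4) by (simp add: perp_part)
    then obtain v v' where v: "(v, x) \<in> y" "(v', x') \<in> y" using x by auto
    have "\<not> v \<asymp> w" "v \<asymp> v'"
      using x piso_perp[OF y v(1) w] piso_perp[OF y v] by auto
    then have "(E a v \<longleftrightarrow> E a v') = (E w v \<longleftrightarrow> E w v')"
      using parity[of a w v v'] a(1) by (simp add: perp_part)
    then show ?thesis
      using S[OF v(1)] S[OF v(2)] piso_E[OF y w v(1)] piso_E[OF y w v(2)] by simp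
  qed
  moreover have "finite ?X" using F piso_finite[OF y] by simp
  ultimately obtain b where b: "b \<asymp> c" "b \<notin> ?X" "\<And>x. x \<in> ?X \<Longrightarrow> \<not> x \<asymp> c \<Longrightarrow> E b x \<longleftrightarrow> x \<in> ?S"
    using extend_part[of ?X c ?S] by blast
  have "piso (insert (a, b) y)"
  proof (rule piso_insert[OF y])
    fix v x assume v: "(v, x) \<in> y"
    have p: "a \<asymp> v \<longleftrightarrow> b \<asymp> x"
      using a(1) b(1) piso_perp[OF y w v] by (simp add: perp_part)
    have "E a v \<longleftrightarrow> E b x"
    proof (cases "b \<asymp> x")
      case True
      then show ?thesis using p by (simp add: perp_def)
    next
      case False
      then have "\<not> x \<asymp> c" using b(1) by (simp add: perp_part)
      then show ?thesis using b(3)[of x] S[OF v] v by auto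
    qed
    then show "a \<noteq> v \<and> b \<noteq> x \<and> (a \<asymp> v \<longleftrightarrow> b \<asymp> x) \<and> (E a v \<longleftrightarrow> E b x)"
      using p a(2) b(2) v by auto
  qed
  moreover have "b \<notin> F" using b by auto
  ultimately show ?thesis using b(1) by blast
qed

text \<open>\<open>P\<close> is a parameter so that one argument serves for plain extension, for
  \<open>Aut_moves_part_far\<close> and for \<open>tame_new_part\<close>.\<close>

lemma piso_extend_new_part_if:
  assumes y: "piso y" and a: "\<And>v. v \<in> Domain y \<Longrightarrow> \<not> a \<asymp> v" and F: "finite F"
    and ext: "\<And>X S. finite X \<Longrightarrow> \<exists>u. P X u \<and> (\<forall>x\<in>X. \<not> u \<asymp> x \<and> (E u x \<longleftrightarrow> x \<in> S))"
  shows "\<exists>b. P (Range y \<union> F) b \<and> (\<forall>x\<in>Range y \<union> F. \<not> b \<asymp> x) \<and> piso (insert (a, b) y)"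
proof -
  have "finite (Range y \<union> F)" using F piso_finite[OF y] by simp
  from ext[OF this, of "{x. \<exists>v. (v, x) \<in> y \<and> E a v}"] obtain b where
    b: "P (Range y \<union> F) b" "\<forall>x\<in>Range y \<union> F. \<not> b \<asymp> x \<and> (E b x \<longleftrightarrow> (\<exists>v. (v, x) \<in> y \<and> E a v))"
    by auto
  have "piso (insert (a, b) y)"
  proof (rule piso_insert_new[OF y])
    fix v x assume v: "(v, x) \<in> y"
    then have "(\<exists>v. (v, x) \<in> y \<and> E a v) \<longleftrightarrow> E a v" using piso_eq[OF y] by blast
    then show "\<not> a \<asymp> v \<and> \<not> b \<asymp> x \<and> (E a v \<longleftrightarrow> E b x)"
      using a b(2) v by blast
  qed
  then show ?thesis using b by blast
qed

lemma piso_extend_new_part: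
  assumes "piso y" "\<And>v. v \<in> Domain y \<Longrightarrow> \<not> a \<asymp> v" "finite F"
  shows "\<exists>b. (\<forall>x\<in>Range y \<union> F. \<not> b \<asymp> x) \<and> piso (insert (a, b) y)"
  using piso_extend_new_part_if[OF assms, of "\<lambda>_ _. True"] extend_new_part by auto

lemma piso_extend_Range_part:
  assumes "piso y" "(w, c) \<in> y" "b \<asymp> c" "b \<notin> Range y" "finite F"
  shows "\<exists>a. a \<asymp> w \<and> a \<notin> F \<and> piso (insert (a, b) y)"
  using piso_extend_part[of "y\<inverse>" c w b F] assms by (simp add: piso_insert_converse)

lemma piso_extend_Range_new_part:
  assumes "piso y" "\<forall>x\<in>Range y. \<not> b \<asymp> x" "finite F"
  shows "\<exists>a. (\<forall>x\<in>Domain y \<union> F. \<not> a \<asymp> x) \<and> piso (insert (a, b) y)"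
  using piso_extend_new_part[of "y\<inverse>" b F] assms by (simp add: piso_insert_converse)

lemma piso_chain_limit:
  fixes y :: "nat \<Rightarrow> (nat \<times> nat) set"
  assumes mono: "\<And>m n. m \<le> n \<Longrightarrow> y m \<subseteq> y n" and piso: "\<And>n. piso (y n)"
    and tot: "\<And>a. \<exists>n b. (a, b) \<in> y n" and sur: "\<And>b. \<exists>n a. (a, b) \<in> y n"
  obtains f where "f \<in> Aut" "\<And>n a b. (a, b) \<in> y n \<Longrightarrow> b = f a"
proof -
  have common: "(a = a' \<longleftrightarrow> b = b') \<and> (E a a' \<longleftrightarrow> E b b')"
    if "(a, b) \<in> y m" "(a', b') \<in> y n" for a b a' b' m n
  proof -
    have "(a, b) \<in> y (max m n)" "(a', b') \<in> y (max m n)"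
      using that mono[OF max.cobounded1[of m n]] mono[OF max.cobounded2[of n m]] by blast+
    then show ?thesis using piso_eq[OF piso] piso_E[OF piso] by simp
  qed
  define f where "f a = (SOME b. \<exists>n. (a, b) \<in> y n)" for a
  have f: "\<exists>n. (a, f a) \<in> y n" for a
    unfolding f_def using tot[of a] by (metis (mono_tags, lifting) someI_ex)
  have f_eq: "b = f a" if "(a, b) \<in> y n" for n a b
    using f[of a] common[OF that] by blast
  have "inj f"
  proof (rule injI)
    fix a b assume "f a = f b"
    then show "a = b" using f[of a] f[of b] common by metis
  qed
  moreover have "surj f" using sur f_eq unfolding surj_def by blast
  moreover have "E (f a) (f b) \<longleftrightarrow> E a b" for a b
    using f[of a] f[of b] common by blast
  ultimately have "f \<in> Aut" by (simp add: Aut_def bij_def)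
  then show ?thesis using that f_eq by blast
qed



section \<open>Tame commutators\<close>

text \<open>
  \<open>l\<close> is constant on the orbits of \<open>t\<close> on parts, and \<open>h\<close> counts the steps along such an orbit.
\<close>
definition tame :: "(nat \<Rightarrow> nat) \<Rightarrow> bool" where
  "tame t \<longleftrightarrow> t \<in> Aut \<and> (\<exists>(l :: nat \<Rightarrow> nat) (h :: nat \<Rightarrow> int).
     (\<forall>u v. u \<asymp> v \<longrightarrow> l u = l v \<and> h u = h v) \<and>
     (\<forall>u. l (t u) = l u \<and> h (t u) = h u + 1) \<and>
     (\<forall>X S. finite X \<longrightarrow> (\<exists>u. \<forall>x\<in>X. \<not> u \<asymp> x \<and> (E u x \<longleftrightarrow> x \<in> S) \<and> l u \<noteq> l x)))"

text \<open>
  The graph, on parts, of what a finite approximation \<open>k\<close> determines of the commutator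
  \<open>g\<^sup>-\<^sup>1 k\<^sup>-\<^sup>1 g k\<close>.
\<close>
definition edge :: "(nat \<Rightarrow> nat) \<Rightarrow> (nat \<times> nat) set \<Rightarrow> nat \<Rightarrow> nat \<Rightarrow> bool" where
  "edge g k u v \<longleftrightarrow> (\<exists>x q w q'. (x, q) \<in> k \<and> (w, q') \<in> k \<and> g q \<asymp> q' \<and> x \<asymp> u \<and> w \<asymp> g v)"

lemma edgeE:
  assumes "edge g k u v"
  obtains x q w q' where "(x, q) \<in> k" "(w, q') \<in> k" "g q \<asymp> q'" "x \<asymp> u" "w \<asymp> g v"
  using assms unfolding edge_def by blast

section \<open>Labelled approximations of the conjugator \<open>k\<close>\<close>

definition known :: "nat set \<Rightarrow> nat \<Rightarrow> bool" where
  "known D a \<longleftrightarrow> (\<exists>d\<in>D. a \<asymp> d)"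

text \<open>
  In a state \<open>(k, D, l, h)\<close> the labels \<open>l\<close> and \<open>h\<close> are final on the parts that meet \<open>D\<close>.
\<close>
type_synonym labelling = "(nat \<times> nat) set \<times> nat set \<times> (nat \<Rightarrow> nat) \<times> (nat \<Rightarrow> int)"

text \<open>An edge runs from the part of some \<open>x\<close> to the part of some
  \<open>finv g w\<close> with \<open>x\<close> and \<open>w\<close> in \<open>Domain k\<close>.
  Demanding that these parts be known makes both ends of every edge labelled for good, so labels
  elsewhere can be changed freely.\<close>

definition labelled :: "(nat \<Rightarrow> nat) \<Rightarrow> labelling \<Rightarrow> bool" where
  "labelled g = (\<lambda>(k, D, l, h). piso k \<and> finite D \<and>
     (\<forall>u v. u \<asymp> v \<longrightarrow> l u = l v \<and> h u = h v) \<and>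
     (\<forall>x\<in>Domain k. known D x \<and> known D (finv g x)) \<and>
     (\<forall>u v. edge g k u v \<longrightarrow> l v = l u \<and> h v = h u + 1))"

definition lab_ext :: "labelling \<Rightarrow> labelling \<Rightarrow> bool" where
  "lab_ext = (\<lambda>(k, D, l, h) (k', D', l', h').
     k \<subseteq> k' \<and> D \<subseteq> D' \<and> (\<forall>d\<in>D. l' d = l d \<and> h' d = h d))"

lemma known_cong: "a \<asymp> b \<Longrightarrow> known D a \<longleftrightarrow> known D b"
  by (simp add: known_def perp_part)

lemma known_mono: "known D a \<Longrightarrow> D \<subseteq> D' \<Longrightarrow> known D' a"
  by (auto simp: known_def)

lemma lab_ext_known:
  assumes "labelled g (k, D, l, h)" "labelled g (k', D', l', h')"
    "lab_ext (k, D, l, h) (k', D', l', h')" "known D a"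
  shows "l' a = l a \<and> h' a = h a"
proof -
  obtain d where d: "d \<in> D" "a \<asymp> d" using assms(4) by (auto simp: known_def)
  have "l a = l d \<and> h a = h d" "l' a = l' d \<and> h' a = h' d"
    using assms(1,2) d(2) unfolding labelled_def by blast+
  moreover have "l' d = l d \<and> h' d = h d"
    using assms(3) d(1) unfolding lab_ext_def by blast
  ultimately show ?thesis by simp
qed

text \<open>\<open>edge\<close> sees pairs only up to parts, and \<open>(w, c)\<close> already
  represents the parts of \<open>(a, q)\<close>.\<close>

lemma edge_insert_part:
  assumes "(w, c) \<in> k" "a \<asymp> w" "q \<asymp> c" "g \<in> Aut" "edge g (insert (a, q) k) u v"
  shows "edge g k u v"
proof -
  have *: "\<exists>x' z'. (x', z') \<in> k \<and> x' \<asymp> x \<and> z' \<asymp> z" if "(x, z) \<in> insert (a, q) k" for x z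
    using that assms(1-3) perp_sym perp_refl by blast
  from assms(5) obtain x z x1 z1 where
    e: "(x, z) \<in> insert (a, q) k" "(x1, z1) \<in> insert (a, q) k" "g z \<asymp> z1" "x \<asymp> u" "x1 \<asymp> g v"
    by (rule edgeE)
  obtain x' z' where 1: "(x', z') \<in> k" "x' \<asymp> x" "z' \<asymp> z" using *[OF e(1)] by blast
  obtain x1' z1' where 2: "(x1', z1') \<in> k" "x1' \<asymp> x1" "z1' \<asymp> z1" using *[OF e(2)] by blast
  have "g z' \<asymp> g z" using 1(3) assms(4) by (simp add: Aut_perp)
  then have "g z' \<asymp> z1'" "x' \<asymp> u" "x1' \<asymp> g v"
    using 1 2 e by (simp_all add: perp_part)
  then show ?thesis
    using 1(1) 2(1) unfolding edge_def by blast
qed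

lemma labelled_insert_part:
  assumes "labelled g (k, D, l, h)" "g \<in> Aut"
    and "(w, c) \<in> k" "a \<asymp> w" "q \<asymp> c" "piso (insert (a, q) k)"
  shows "labelled g (insert (a, q) k, D, l, h)"
proof -
  have "finv g a \<asymp> finv g w" using assms(2,4) Aut_inv Aut_perp by blast
  moreover have "known D w" "known D (finv g w)"
    using assms(1,3) unfolding labelled_def by blast+
  ultimately have "known D a" "known D (finv g a)"
    using known_cong assms(4) by blast+
  then show ?thesis
    using assms(1,6) edge_insert_part[OF assms(3,4,5,2)] unfolding labelled_def by auto
qed

text \<open>The type is prescribed over \<open>X\<close> together with its image and preimage under
  \<open>g\<close>. The conclusion is grouped to match \<open>P\<close> in
  \<open>piso_extend_new_part_if\<close>.\<close>

lemma Aut_moves_part_far: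
  assumes g: "g \<in> Aut" "g \<noteq> id" and X: "finite X"
  shows "\<exists>u. (\<not> g u \<asymp> u \<and> (\<forall>x\<in>X. \<not> g u \<asymp> x \<and> \<not> u \<asymp> g x)) \<and>
    (\<forall>x\<in>X. \<not> u \<asymp> x \<and> (E u x \<longleftrightarrow> x \<in> S))"
proof -
  have "finite (X \<union> g ` X \<union> finv g ` X)" using X by simp
  from Aut_moves_part[OF g this, of S] obtain u where
    u: "\<not> g u \<asymp> u" "\<forall>x\<in>X \<union> g ` X \<union> finv g ` X. \<not> u \<asymp> x \<and> (E u x \<longleftrightarrow> x \<in> S)" by blast
  have "\<not> g u \<asymp> x" if "x \<in> X" for x
  proof -
    have "\<not> u \<asymp> finv g x" using u(2) that by blast
    then have "\<not> g u \<asymp> g (finv g x)" by (simp add: Aut_perp[OF g(1)])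
    then show ?thesis by (simp add: Aut_f_inv[OF g(1)])
  qed
  then show ?thesis using u by blast
qed

text \<open>For a new part, \<open>q\<close> is chosen so that \<open>g\<close> connects its part
  neither with itself nor with a part of \<open>Range k\<close>, in either direction. Hence no edge
  arises and the labels can stay.\<close>

lemma labelled_add_Domain:
  assumes L: "labelled g (k, D, l, h)" and g: "g \<in> Aut" "g \<noteq> id"
  shows "\<exists>k' D' l' h'. labelled g (k', D', l', h') \<and> lab_ext (k, D, l, h) (k', D', l', h') \<and>
    a \<in> Domain k'"
proof -
  have k: "piso k" and D: "finite D" using L by (auto simp: labelled_def)
  consider "a \<in> Domain k" | w c where "(w, c) \<in> k" "a \<asymp> w" "a \<notin> Domain k"
    | "\<And>v. v \<in> Domain k \<Longrightarrow> \<not> a \<asymp> v" by blast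
  then show ?thesis
  proof cases
    case 1
    then show ?thesis using L by (intro exI[of _ k] exI[of _ D] exI[of _ l] exI[of _ h]) (simp add: lab_ext_def)
  next
    case 2
    then obtain q where "q \<asymp> c" "piso (insert (a, q) k)"
      using piso_extend_part[OF k, of w c a "{}"] by auto
    then have "labelled g (insert (a, q) k, D, l, h)"
      using labelled_insert_part[OF L g(1)] 2 by blast
    then show ?thesis
      by (intro exI[of _ "insert (a, q) k"] exI[of _ D] exI[of _ l] exI[of _ h]) (auto simp: lab_ext_def)
  next
    case 3
    obtain q where q: "\<not> g q \<asymp> q" "\<forall>x\<in>Range k. \<not> g q \<asymp> x \<and> \<not> q \<asymp> g x"
      and k': "piso (insert (a, q) k)"
      using piso_extend_new_part_if[OF k 3 finite.emptyI Aut_moves_part_far[OF g]] by auto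
    have "edge g k u v" if e0: "edge g (insert (a, q) k) u v" for u v
    proof -
      obtain x z x1 z1 where
        e: "(x, z) \<in> insert (a, q) k" "(x1, z1) \<in> insert (a, q) k" "g z \<asymp> z1" "x \<asymp> u" "x1 \<asymp> g v"
        using e0 by (rule edgeE)
      have xz: "(x, z) \<in> k"
      proof (rule ccontr)
        assume "(x, z) \<notin> k"
        then have "z = q" using e(1) by blast
        then show False using e(2,3) q by auto
      qed
      moreover have "(x1, z1) \<in> k"
      proof (rule ccontr)
        assume "(x1, z1) \<notin> k"
        then have "g z \<asymp> q" using e(2,3) by blast
        then show False using xz q perp_sym by blast
      qed
      ultimately show ?thesis using e unfolding edge_def by blast
    qed
    moreover have "known (insert a (insert (finv g a) D)) a" "known (insert a (insert (finv g a) D)) (finv g a)"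
      unfolding known_def using perp_refl by blast+
    ultimately have "labelled g (insert (a, q) k, insert a (insert (finv g a) D), l, h)"
      using L k' unfolding labelled_def
      by (auto intro: known_mono[of D])
    then show ?thesis
      by (intro exI[of _ "insert (a, q) k"] exI[of _ "insert a (insert (finv g a) D)"] exI[of _ l] exI[of _ h])
        (auto simp: lab_ext_def)
  qed
qed

text \<open>
  Choosing the preimage \<open>a\<close> of \<open>b\<close> generically, every new edge starts in the part of \<open>a\<close> or ends in the part
  of \<open>g\<^sup>-\<^sup>1 a\<close>. Neither part is labelled yet, so the labelling extends.
\<close>
lemma labelled_add_Range:
  assumes L: "labelled g (k, D, l, h)" and g: "g \<in> Aut" "g \<noteq> id"
  shows "\<exists>k' D' l' h'. labelled g (k', D', l', h') \<and> lab_ext (k, D, l, h) (k', D', l', h') \<and>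
    b \<in> Range k'"
proof -
  have k: "piso k" and D: "finite D" using L by (auto simp: labelled_def)
  have lh: "l u = l v" "h u = h v" if "u \<asymp> v" for u v
    using L that unfolding labelled_def by blast+
  consider "b \<in> Range k" | w c where "(w, c) \<in> k" "b \<asymp> c" "b \<notin> Range k"
    | "\<And>v. v \<in> Range k \<Longrightarrow> \<not> b \<asymp> v" by blast
  then show ?thesis
  proof cases
    case 1
    then show ?thesis using L by (intro exI[of _ k] exI[of _ D] exI[of _ l] exI[of _ h]) (simp add: lab_ext_def)
  next
    case 2
    obtain a where a: "a \<asymp> w" "piso (insert (b, a) (k\<inverse>))"
      using piso_extend_part[of "k\<inverse>" c w b "{}"] 2 k by auto
    have "piso (insert (a, b) k)"
      using a(2) by (simp add: piso_insert_converse)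
    then have "labelled g (insert (a, b) k, D, l, h)"
      using labelled_insert_part[OF L g(1) 2(1) a(1) 2(2)] by blast
    then show ?thesis
      by (intro exI[of _ "insert (a, b) k"] exI[of _ D] exI[of _ l] exI[of _ h]) (auto simp: lab_ext_def)
  next
    case 3
    have "piso (k\<inverse>)" "\<And>v. v \<in> Domain (k\<inverse>) \<Longrightarrow> \<not> b \<asymp> v" "finite (D \<union> g ` D)"
      using k 3 D by auto
    from piso_extend_new_part_if[OF this Aut_moves_part_far[OF g]] obtain a where
      a: "\<not> g a \<asymp> a" "\<forall>x\<in>D \<union> g ` D. \<not> a \<asymp> x" "piso (insert (b, a) (k\<inverse>))" by auto
    have k': "piso (insert (a, b) k)"
      using a(3) by (simp add: piso_insert_converse)
    let ?a = "finv g a"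
    have a': "\<not> ?a \<asymp> a" using a(1) perp_sym[of "?a" a] Aut_perp[OF g(1), of "?a" a] Aut_f_inv[OF g(1)] perp_sym by metis
    have unknown: "\<not> known D a" "\<not> known D ?a"
      using a(2) unfolding known_def Aut_inv_perp[OF g(1)] by auto
    \<comment> \<open>\<open>la\<close> and \<open>ha\<close> are the labels forced on the part of
      \<open>a\<close> by an old end of an edge leaving it. There is at most one such end:
      \<open>g b\<close> determines the part of \<open>q\<close>, hence that of \<open>w\<close> and
      that of \<open>v\<close>.\<close>
    have "\<exists>la ha. \<forall>w q v. (w, q) \<in> k \<longrightarrow> g b \<asymp> q \<longrightarrow> w \<asymp> g v \<longrightarrow> l v = la \<and> h v = ha + 1"
    proof (cases "\<exists>w q. (w, q) \<in> k \<and> g b \<asymp> q")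
      case True
      then obtain w q where w: "(w, q) \<in> k" "g b \<asymp> q" by blast
      have "v \<asymp> finv g w" if v: "(w', q') \<in> k" "g b \<asymp> q'" "w' \<asymp> g v" for w' q' v
      proof -
        have "w' \<asymp> w" using piso_perp[OF k v(1) w(1)] v(2) w(2) by (simp add: perp_part)
        then have "g v \<asymp> g (finv g w)" using v(3) by (simp add: perp_part Aut_f_inv[OF g(1)])
        then show ?thesis by (simp add: Aut_perp[OF g(1)])
      qed
      then show ?thesis
        using lh by (intro exI[of _ "l (finv g w)"] exI[of _ "h (finv g w) - 1"]) fastforce
    qed auto
    then obtain la ha where
      1: "\<And>w q v. (w, q) \<in> k \<Longrightarrow> g b \<asymp> q \<Longrightarrow> w \<asymp> g v \<Longrightarrow> l v = la \<and> h v = ha + 1" by blast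
    \<comment> \<open>Likewise for the part of \<open>finv g a\<close> and the edges entering it.
      The source is an old \<open>x\<close> or \<open>a\<close> itself, never both:
      \<open>g q\<close> and \<open>g b\<close> both in the part of \<open>b\<close> would put
      \<open>b\<close> into the part of \<open>q\<close>.\<close>
    have "\<exists>la' ha'. (\<forall>x q. (x, q) \<in> k \<longrightarrow> g q \<asymp> b \<longrightarrow> la' = l x \<and> ha' = h x + 1) \<and>
        (g b \<asymp> b \<longrightarrow> la' = la \<and> ha' = ha + 1)"
    proof (cases "\<exists>x q. (x, q) \<in> k \<and> g q \<asymp> b")
      case True
      then obtain x q where x: "(x, q) \<in> k" "g q \<asymp> b" by blast
      have "\<not> g b \<asymp> b"
      proof
        assume "g b \<asymp> b"
        then have "g b \<asymp> g q" using x(2) by (simp add: perp_part)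
        then have "b \<asymp> q" by (simp add: Aut_perp[OF g(1)])
        then show False using 3 x(1) by blast
      qed
      moreover have "x' \<asymp> x" if x': "(x', q') \<in> k" "g q' \<asymp> b" for x' q'
      proof -
        have "g q' \<asymp> g q" using x(2) x'(2) by (simp add: perp_part)
        then show ?thesis using piso_perp[OF k x'(1) x(1)] by (simp add: Aut_perp[OF g(1)])
      qed
      ultimately show ?thesis
        using lh by (intro exI[of _ "l x"] exI[of _ "h x + 1"]) fastforce
    qed auto
    then obtain la' ha' where
      2: "\<And>x q. (x, q) \<in> k \<Longrightarrow> g q \<asymp> b \<Longrightarrow> la' = l x \<and> ha' = h x + 1"
        "g b \<asymp> b \<Longrightarrow> la' = la \<and> ha' = ha + 1" by blast
    define l' where "l' u = (if u \<asymp> a then la else if u \<asymp> ?a then la' else l u)" for u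
    define h' where "h' u = (if u \<asymp> a then ha else if u \<asymp> ?a then ha' else h u)" for u
    let ?D = "insert a (insert ?a D)"
    have old: "l' u = l u \<and> h' u = h u" if "known D u" for u
      using that unknown known_cong unfolding l'_def h'_def by metis
    have at_a: "l' u = la \<and> h' u = ha" if "u \<asymp> a" for u
      using that by (simp add: l'_def h'_def)
    have at_a': "l' u = la' \<and> h' u = ha'" if "u \<asymp> ?a" for u
      using that a' by (simp add: l'_def h'_def perp_part)
    have dom: "known D x \<and> known D (finv g x)" if "(x, q) \<in> k" for x q
      using L that unfolding labelled_def by blast
    have "l' v = l' u \<and> h' v = h' u + 1" if e0: "edge g (insert (a, b) k) u v" for u v
    proof -
      obtain x q w q' where
        e: "(x, q) \<in> insert (a, b) k" "(w, q') \<in> insert (a, b) k" "g q \<asymp> q'" "x \<asymp> u" "w \<asymp> g v"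
        using e0 by (rule edgeE)
      have v: "v \<asymp> finv g w"
        using e(5) perp_sym[of v "finv g w"] perp_sym[of "finv g w" v] Aut_inv_perp[OF g(1)] by blast
      have xk: "(l' u = l x \<and> h' u = h x) \<and> known D u" if "(x, q) \<in> k"
        using dom[OF that] old[of u] lh[OF e(4)] known_cong[OF e(4)] by auto
      have wk: "(l' v = l v \<and> h' v = h v) \<and> known D v" if "(w, q') \<in> k"
        using dom[OF that] old[of v] known_cong[OF v] by auto
      show ?thesis
      proof (cases "(x, q) \<in> k")
        case x: True
        show ?thesis
        proof (cases "(w, q') \<in> k")
          case True
          then have "edge g k u v" using x e unfolding edge_def by blast
          then have "l v = l u \<and> h v = h u + 1" using L unfolding labelled_def by blast
          then show ?thesis using xk[OF x] wk[OF True] lh[OF e(4)] by simp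
        next
          case False
          then have "w = a" "q' = b" using e(2) by auto
          then show ?thesis using xk[OF x] at_a'[of v] v 2(1)[OF x] e(3) by simp
        qed
      next
        case False
        then have x: "x = a" "q = b" using e(1) by auto
        have u: "l' u = la \<and> h' u = ha" using at_a perp_sym e(4) x by blast
        show ?thesis
        proof (cases "(w, q') \<in> k")
          case True
          then show ?thesis using wk[OF True] u 1[OF True] e(3,5) x by simp
        next
          case False
          then have "w = a" "q' = b" using e(2) by auto
          then show ?thesis using u at_a'[of v] v 2(2) e(3) x by simp
        qed
      qed
    qed
    moreover have "l' u = l' v \<and> h' u = h' v" if "u \<asymp> v" for u v
      using that lh[OF that] by (simp add: l'_def h'_def perp_part)
    moreover have "known ?D x \<and> known ?D (finv g x)" if "x \<in> Domain (insert (a, b) k)" for x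
    proof (cases "x = a")
      case True
      then show ?thesis unfolding known_def using perp_refl by blast
    next
      case False
      then have "known D x \<and> known D (finv g x)" using dom that by auto
      then show ?thesis by (auto intro: known_mono[of D])
    qed
    ultimately have "labelled g (insert (a, b) k, ?D, l', h')"
      using k' D unfolding labelled_def by blast
    moreover have "lab_ext (k, D, l, h) (insert (a, b) k, ?D, l', h')"
      using old perp_refl unfolding lab_ext_def known_def by blast
    ultimately show ?thesis by blast
  qed
qed

lemma labelled_fresh:
  assumes L: "labelled g (k, D, l, h)" and g: "g \<in> Aut" and X: "finite X"
  shows "\<exists>k' D' l' h'. labelled g (k', D', l', h') \<and> lab_ext (k, D, l, h) (k', D', l', h') \<and>
    (\<exists>u\<in>D'. X \<subseteq> D' \<and> (\<forall>x\<in>X. \<not> u \<asymp> x \<and> (E u x \<longleftrightarrow> x \<in> S) \<and> l' u \<noteq> l' x))"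
proof -
  have k: "piso k" and D: "finite D" using L by (auto simp: labelled_def)
  have lh: "l u = l v" "h u = h v" if "u \<asymp> v" for u v
    using L that unfolding labelled_def by blast+
  obtain u where u: "\<forall>x\<in>X \<union> D. \<not> u \<asymp> x \<and> (E u x \<longleftrightarrow> x \<in> S)"
    using extend_new_part[of "X \<union> D" S] X D by auto
  obtain N where N: "N \<notin> l ` X"
    using X ex_new_if_finite[of "l ` X"] by auto
  define l' where "l' v = (if v \<asymp> u then N else l v)" for v
  have old: "l' v = l v" if "known D v" for v
    using that u unfolding known_def l'_def by (auto simp: perp_part)
  let ?D = "insert u (X \<union> D)"
  have "l' w = l' v \<and> h w = h v + 1" if e: "edge g k v w" for v w
  proof -
    obtain x q x' q' where x: "(x, q) \<in> k" "(x', q') \<in> k" "x \<asymp> v" "x' \<asymp> g w"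
      using e by (rule edgeE)
    have "w \<asymp> finv g x'"
      using Aut_inv_perp[OF g, of x' w] x(4) perp_sym by blast
    moreover have "known D x" "known D (finv g x')" using L x unfolding labelled_def by blast+
    ultimately have "known D v" "known D w" using known_cong x(3) by blast+
    moreover have "l w = l v \<and> h w = h v + 1" using L e unfolding labelled_def by blast
    ultimately show ?thesis using old by simp
  qed
  moreover have "l' v = l' w \<and> h v = h w" if "v \<asymp> w" for v w
    using that lh[OF that] by (simp add: l'_def perp_part)
  moreover have "known ?D x \<and> known ?D (finv g x)" if "x \<in> Domain k" for x
  proof -
    have "known D x \<and> known D (finv g x)" using L that unfolding labelled_def by blast
    then show ?thesis by (auto intro: known_mono[of D])
  qed
  ultimately have "labelled g (k, ?D, l', h)"
    using k D X unfolding labelled_def by blast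
  moreover have "lab_ext (k, D, l, h) (k, ?D, l', h)"
    using old perp_refl unfolding lab_ext_def known_def by blast
  moreover have "\<forall>x\<in>X. \<not> u \<asymp> x \<and> (E u x \<longleftrightarrow> x \<in> S) \<and> l' u \<noteq> l' x"
  proof
    fix x assume x: "x \<in> X"
    then have "\<not> x \<asymp> u" using u perp_sym by blast
    then have "l' x = l x" "l' u = N" by (simp_all add: l'_def)
    then show "\<not> u \<asymp> x \<and> (E u x \<longleftrightarrow> x \<in> S) \<and> l' u \<noteq> l' x"
      using u x N by auto
  qed
  ultimately show ?thesis by blast
qed

lemma ex_tame_commutator:
  assumes g: "g \<in> Aut" "g \<noteq> id"
  shows "\<exists>k\<in>Aut. tame (finv g \<circ> finv k \<circ> g \<circ> k)"
proof -
  \<comment> \<open>Pairs of lists encode the pairs of a finite set and a prescription on it, since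
    the requirements must form a countable type.\<close>
  define D :: "nat + nat + nat list \<times> nat list \<Rightarrow> labelling \<Rightarrow> bool" where
    "D i = (\<lambda>(k, D, l, h). case i of Inl a \<Rightarrow> a \<in> Domain k
      | Inr (Inl b) \<Rightarrow> b \<in> Range k
      | Inr (Inr (xs, ss)) \<Rightarrow> \<exists>u\<in>D. set xs \<subseteq> D \<and>
          (\<forall>x\<in>set xs. \<not> u \<asymp> x \<and> (E u x \<longleftrightarrow> x \<in> set ss) \<and> l u \<noteq> l x))" for i
  have base: "labelled g ({}, {}, \<lambda>_. 0, \<lambda>_. 0)"
    by (simp add: labelled_def edge_def)
  have refl: "lab_ext s s" for s
    by (auto simp: lab_ext_def split: prod.split)
  have trans: "lab_ext s u" if "lab_ext s t" "lab_ext t u" for s t u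
    using that unfolding lab_ext_def by (cases s; cases t; cases u) auto
  have dense: "\<exists>s'. labelled g s' \<and> lab_ext s s' \<and> D i s'" if s: "labelled g s" for i s
  proof -
    obtain k D0 l h where s_eq: "s = (k, D0, l, h)" by (cases s)
    show ?thesis
    proof (cases i)
      case (Inl a)
      then show ?thesis using labelled_add_Domain[of g k D0 l h a] s g unfolding s_eq D_def by auto
    next
      case i: (Inr j)
      show ?thesis
      proof (cases j)
        case (Inl b)
        then show ?thesis using labelled_add_Range[of g k D0 l h b] i s g unfolding s_eq D_def by auto
      next
        case (Inr p)
        obtain xs ss where "p = (xs, ss)" by (cases p)
        then show ?thesis
          using labelled_fresh[of g k D0 l h "set xs" "set ss"] i Inr s g unfolding s_eq D_def by auto
      qed
    qed
  qed
  obtain f :: "nat \<Rightarrow> labelling" where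
    f: "\<And>n. labelled g (f n)" "\<And>m n. m \<le> n \<Longrightarrow> lab_ext (f m) (f n)" "\<And>i. \<exists>n. D i (f n)"
    by (rule generic_chain[where P = "labelled g" and ext = lab_ext and D = D, OF base refl trans dense]) blast+
  define K where "K n = fst (f n)" for n
  define DD where "DD n = fst (snd (f n))" for n
  define L where "L n = fst (snd (snd (f n)))" for n
  define H where "H n = snd (snd (snd (f n)))" for n
  have f_eq: "f n = (K n, DD n, L n, H n)" for n
    by (simp add: K_def DD_def L_def H_def)
  have lab: "labelled g (K n, DD n, L n, H n)" for n
    using f(1)[of n] by (simp add: f_eq)
  have ext: "lab_ext (K m, DD m, L m, H m) (K n, DD n, L n, H n)" if "m \<le> n" for m n
    using f(2)[OF that] by (simp add: f_eq)
  have mono: "K m \<subseteq> K n" "DD m \<subseteq> DD n" if "m \<le> n" for m n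
    using ext[OF that] by (auto simp: lab_ext_def)
  have dom: "\<exists>n. a \<in> Domain (K n)" for a
    using f(3)[of "Inl a"] by (simp add: D_def f_eq)
  have ran: "\<exists>n. b \<in> Range (K n)" for b
    using f(3)[of "Inr (Inl b)"] by (simp add: D_def f_eq)
  obtain k where k: "k \<in> Aut" "\<And>n a b. (a, b) \<in> K n \<Longrightarrow> b = k a"
  proof (rule piso_chain_limit[of K])
    show "piso (K n)" for n using lab by (simp add: labelled_def)
  qed (use mono dom ran in blast)+
  have ex_known: "\<exists>n. known (DD n) a" for a
  proof -
    obtain n where "a \<in> Domain (K n)" using dom by blast
    then have "known (DD n) a" using lab[of n] unfolding labelled_def by blast
    then show ?thesis by blast
  qed
  \<comment> \<open>Labels are read at the first stage where the part is known;
    \<open>lab_ext_known\<close> makes any later stage give the same value.\<close>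
  define l where "l a = L (LEAST n. known (DD n) a) a" for a
  define h where "h a = H (LEAST n. known (DD n) a) a" for a
  have lh: "l a = L n a \<and> h a = H n a" if a: "known (DD n) a" for n a
  proof -
    have "(LEAST n. known (DD n) a) \<le> n" "known (DD (LEAST n. known (DD n) a)) a"
      using a by (auto intro: Least_le LeastI)
    then show ?thesis
      using lab_ext_known[OF lab lab ext] unfolding l_def h_def by metis
  qed
  let ?t = "finv g \<circ> finv k \<circ> g \<circ> k"
  have t: "?t \<in> Aut" using g(1) k(1) by (intro Aut_comp Aut_inv)
  have cong: "l u = l v \<and> h u = h v" if "u \<asymp> v" for u v
  proof -
    obtain n where n: "known (DD n) u" using ex_known by blast
    then have "known (DD n) v" using known_cong[OF that] by simp
    moreover have "L n u = L n v \<and> H n u = H n v" using lab[of n] that unfolding labelled_def by blast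
    ultimately show ?thesis using lh n by simp
  qed
  have step: "l (?t u) = l u \<and> h (?t u) = h u + 1" for u
  proof -
    define w where "w = finv k (g (k u))"
    have kw: "k w = g (k u)" unfolding w_def using k(1) by (simp add: Aut_f_inv)
    obtain m where m: "(u, k u) \<in> K m" using dom[of u] k(2) by blast
    obtain n where n: "(w, g (k u)) \<in> K n" using dom[of w] k(2) kw by force
    let ?N = "max m n"
    have mn: "(u, k u) \<in> K ?N" "(w, g (k u)) \<in> K ?N"
      using m n mono(1)[OF max.cobounded1[of m n]] mono(1)[OF max.cobounded2[of n m]] by blast+
    have tu: "?t u = finv g w" by (simp add: w_def)
    \<comment> \<open>\<open>u\<close>, \<open>k u\<close>, \<open>w\<close> and
      \<open>g (k u)\<close> witness the edge, as \<open>k w = g (k u)\<close> and \<open>g\<close>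
      takes the value of the commutator at \<open>u\<close> to \<open>w\<close>.\<close>
    have "edge g (K ?N) u (?t u)"
      unfolding edge_def tu using mn perp_refl Aut_f_inv[OF g(1)] by metis
    then have "L ?N (?t u) = L ?N u \<and> H ?N (?t u) = H ?N u + 1"
      using lab[of ?N] unfolding labelled_def by blast
    moreover have "known (DD ?N) u" "known (DD ?N) (?t u)"
      using mn lab[of ?N] unfolding tu labelled_def by blast+
    ultimately show ?thesis using lh by simp
  qed
  have "\<exists>u. \<forall>x\<in>X. \<not> u \<asymp> x \<and> (E u x \<longleftrightarrow> x \<in> S) \<and> l u \<noteq> l x" if X: "finite X" for X S
  proof -
    obtain xs where xs: "set xs = X" using X finite_list by blast
    obtain ss where ss: "set ss = S \<inter> X" using X finite_list by (metis finite_Int)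
    obtain n where "D (Inr (Inr (xs, ss))) (f n)" using f(3) by blast
    then obtain u where u: "u \<in> DD n" "X \<subseteq> DD n"
      "\<And>x. x \<in> X \<Longrightarrow> \<not> u \<asymp> x \<and> (E u x \<longleftrightarrow> x \<in> S) \<and> L n u \<noteq> L n x"
      by (auto simp: D_def f_eq xs ss)
    have "l x = L n x" if "x \<in> DD n" for x
      using that lh[of n x] perp_refl unfolding known_def by blast
    then have "l u \<noteq> l x" if "x \<in> X" for x
      using u that by (metis subsetD)
    then show ?thesis using u(3) by blast
  qed
  then have "tame ?t"
    unfolding tame_def using t cong step by blast
  then show ?thesis using k(1) by blast
qed

section \<open>Factorisation into three conjugates\<close>

lemma tame_Aut: "tame t \<Longrightarrow> t \<in> Aut"
  by (simp add: tame_def)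

lemma tame_height:
  assumes "tame t"
  shows "\<exists>(l :: nat \<Rightarrow> nat) (h :: nat \<Rightarrow> int).
    (\<forall>u v. u \<asymp> v \<longrightarrow> l u = l v \<and> h u = h v) \<and>
    (\<forall>u k. l ((t ^^ k) u) = l u \<and> h ((t ^^ k) u) = h u + int k) \<and>
    (\<forall>X S. finite X \<longrightarrow> (\<exists>u. \<forall>x\<in>X. \<not> u \<asymp> x \<and> (E u x \<longleftrightarrow> x \<in> S) \<and> l u \<noteq> l x))"
proof -
  obtain l :: "nat \<Rightarrow> nat" and h :: "nat \<Rightarrow> int" where
    lh: "\<forall>u v. u \<asymp> v \<longrightarrow> l u = l v \<and> h u = h v" "\<forall>u. l (t u) = l u \<and> h (t u) = h u + 1"
    "\<forall>X S. finite X \<longrightarrow> (\<exists>u. \<forall>x\<in>X. \<not> u \<asymp> x \<and> (E u x \<longleftrightarrow> x \<in> S) \<and> l u \<noteq> l x)"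
    using assms unfolding tame_def by blast
  have "l ((t ^^ k) u) = l u \<and> h ((t ^^ k) u) = h u + int k" for u k
    by (induction k) (use lh(2) in auto)
  then show ?thesis using lh(1,3) by blast
qed

lemma tame_acyclic:
  assumes "tame t"
  shows "\<not> (t ^^ Suc k) u \<asymp> u"
proof
  assume u: "(t ^^ Suc k) u \<asymp> u"
  obtain l :: "nat \<Rightarrow> nat" and h :: "nat \<Rightarrow> int"
    where lh: "\<forall>u v. u \<asymp> v \<longrightarrow> l u = l v \<and> h u = h v"
      "\<forall>u k. l ((t ^^ k) u) = l u \<and> h ((t ^^ k) u) = h u + int k"
    using tame_height[OF assms] by (elim exE conjE) (rule that)
  have "h ((t ^^ Suc k) u) = h u" using lh(1) u by blast
  moreover have "h ((t ^^ Suc k) u) = h u + int (Suc k)" using lh(2) by blast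
  ultimately show False by simp
qed

lemma tame_not_perp: "tame t \<Longrightarrow> \<not> t u \<asymp> u"
  using tame_acyclic[of t 0 u] by simp

text \<open>\<open>l\<close> is constant on orbits of \<open>t\<close> and on parts, so a label
  different from those on \<open>X\<close> separates whole orbits of parts. The form is that of
  \<open>P\<close> in \<open>piso_extend_new_part_if\<close>.\<close>

lemma tame_new_part:
  assumes "tame t" "finite X"
  shows "\<exists>u. (\<forall>x\<in>X. \<forall>k. \<not> (t ^^ k) u \<asymp> x \<and> \<not> (t ^^ k) x \<asymp> u) \<and>
    (\<forall>x\<in>X. \<not> u \<asymp> x \<and> (E u x \<longleftrightarrow> x \<in> S))"
proof -
  obtain l :: "nat \<Rightarrow> nat" and h :: "nat \<Rightarrow> int" where
    lh: "\<forall>u v. u \<asymp> v \<longrightarrow> l u = l v \<and> h u = h v"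
      "\<forall>u k. l ((t ^^ k) u) = l u \<and> h ((t ^^ k) u) = h u + int k"
      "\<forall>X S. finite X \<longrightarrow> (\<exists>u. \<forall>x\<in>X. \<not> u \<asymp> x \<and> (E u x \<longleftrightarrow> x \<in> S) \<and> l u \<noteq> l x)"
    using tame_height[OF assms(1)] by (elim exE conjE) (rule that)
  obtain u where u: "\<And>x. x \<in> X \<Longrightarrow> \<not> u \<asymp> x \<and> (E u x \<longleftrightarrow> x \<in> S) \<and> l u \<noteq> l x"
    using lh(3)[rule_format, OF assms(2), of S] by auto
  have "\<not> (t ^^ k) u \<asymp> x \<and> \<not> (t ^^ k) x \<asymp> u" if "x \<in> X" for x k
  proof -
    have "l ((t ^^ k) u) = l u" "l ((t ^^ k) x) = l x" using lh(2) by blast+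
    then show ?thesis using u[OF that] lh(1) by metis
  qed
  then show ?thesis using u by blast
qed

section \<open>Orbits of a tame automorphism on vertices and on parts\<close>

text \<open>The two disjuncts stand in for an integer power of \<open>t\<close>.\<close>

definition orbit_hit :: "(nat \<Rightarrow> nat) \<Rightarrow> nat \<Rightarrow> nat \<Rightarrow> bool" where
  "orbit_hit t x y \<longleftrightarrow> (\<exists>k. (t ^^ k) x = y \<or> (t ^^ k) y = x)"

definition part_hit :: "(nat \<Rightarrow> nat) \<Rightarrow> nat \<Rightarrow> nat \<Rightarrow> bool" where
  "part_hit t x y \<longleftrightarrow> (\<exists>k. (t ^^ k) x \<asymp> y \<or> (t ^^ k) y \<asymp> x)"

lemma part_hit_perp: "x \<asymp> y \<Longrightarrow> part_hit t x y"
  unfolding part_hit_def by (rule exI[of _ 0]) simp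

lemma orbit_hit_part_hit: "orbit_hit t x y \<Longrightarrow> part_hit t x y"
  unfolding orbit_hit_def part_hit_def using perp_refl by metis

text \<open>The height of \<open>e\<close> is that of \<open>w\<close>, so the exponent linking
  \<open>e\<close> with \<open>x\<close> must be the difference of heights. This leaves two
  candidates for each \<open>x\<close>, one per direction.\<close>

lemma tame_finite_orbit_hit:
  assumes "tame t" "finite X"
  shows "finite {e. e \<asymp> w \<and> (\<exists>x\<in>X. orbit_hit t e x)}"
proof -
  obtain l :: "nat \<Rightarrow> nat" and h :: "nat \<Rightarrow> int" where
    lh: "\<forall>u v. u \<asymp> v \<longrightarrow> l u = l v \<and> h u = h v"
      "\<forall>u k. l ((t ^^ k) u) = l u \<and> h ((t ^^ k) u) = h u + int k"
    using tame_height[OF assms(1)] by (elim exE conjE) (rule that)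
  have "e \<in> {finv (t ^^ nat (h x - h w)) x, (t ^^ nat (h w - h x)) x}"
    if e: "e \<asymp> w" "orbit_hit t e x" for e x
  proof -
    obtain k where "(t ^^ k) e = x \<or> (t ^^ k) x = e" using e(2) unfolding orbit_hit_def by blast
    then show ?thesis
    proof
      assume x: "(t ^^ k) e = x"
      moreover have "h e = h w" "h ((t ^^ k) e) = h e + int k" using lh e(1) by blast+
      ultimately have "k = nat (h x - h w)" by simp
      then show ?thesis
        using x Aut_inv_f[OF Aut_funpow[OF tame_Aut[OF assms(1)]], of k e] by auto
    next
      assume x: "(t ^^ k) x = e"
      moreover have "h e = h w" "h ((t ^^ k) x) = h x + int k" using lh e(1) by blast+
      ultimately have "k = nat (h w - h x)" by simp
      then show ?thesis using x by auto
    qed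
  qed
  then have "{e. e \<asymp> w \<and> (\<exists>x\<in>X. orbit_hit t e x)} \<subseteq>
      (\<Union>x\<in>X. {finv (t ^^ nat (h x - h w)) x, (t ^^ nat (h w - h x)) x})" by blast
  then show ?thesis by (rule finite_subset) (use assms(2) in simp)
qed

text \<open>
  \<open>y\<close> approximates an automorphism \<open>f\<close>, and \<open>Q\<close> collects pairs \<open>(a, b)\<close> with \<open>t (f a) = f (s b)\<close>.
  The last two conditions make the range of \<open>y\<close> convex along the orbits of \<open>t\<close> on vertices and on parts:
  if such an orbit meets it again later, then the next step has already been entered into \<open>Q\<close>.
\<close>
definition partial_conj :: "(nat \<Rightarrow> nat) \<Rightarrow> (nat \<Rightarrow> nat) \<Rightarrow> (nat \<times> nat) set \<Rightarrow> (nat \<times> nat) set \<Rightarrow> bool" where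
  "partial_conj t s y Q \<longleftrightarrow> piso y \<and>
     (\<forall>a b. (a, b) \<in> Q \<longrightarrow> (\<exists>c. (a, c) \<in> y \<and> (s b, t c) \<in> y)) \<and>
     (\<forall>u b v k. (u, b) \<in> y \<longrightarrow> (v, (t ^^ Suc k) b) \<in> y \<longrightarrow> u \<in> Domain Q) \<and>
     (\<forall>u b v c k. (u, b) \<in> y \<longrightarrow> (v, c) \<in> y \<longrightarrow> (t ^^ Suc k) b \<asymp> c \<longrightarrow> (\<exists>a\<in>Domain Q. a \<asymp> u))"

lemma partial_conj_piso: "partial_conj t s y Q \<Longrightarrow> piso y"
  by (simp add: partial_conj_def)

lemma partial_conj_linkE:
  assumes "partial_conj t s y Q" "(a, b) \<in> Q"
  obtains c where "(a, c) \<in> y" "(s b, t c) \<in> y"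
  using assms unfolding partial_conj_def by blast

lemma partial_conj_link:
  assumes "partial_conj t s y Q" "(a, b) \<in> Q" "(a, c) \<in> y"
  shows "(s b, t c) \<in> y"
  using assms partial_conj_linkE piso_eq partial_conj_piso by metis

lemma partial_conj_orbit:
  assumes "partial_conj t s y Q" "(u, b) \<in> y" "(v, (t ^^ Suc k) b) \<in> y"
  shows "u \<in> Domain Q"
  using assms unfolding partial_conj_def by blast

lemma partial_conj_part_orbit:
  assumes "partial_conj t s y Q" "(u, b) \<in> y" "(v, c) \<in> y" "(t ^^ Suc k) b \<asymp> c"
  shows "\<exists>a\<in>Domain Q. a \<asymp> u"
  using assms unfolding partial_conj_def by blast

lemma funpow_Suc_comm: "(t ^^ k) (t b) = (t ^^ Suc k) b"
  by (simp add: funpow_swap1)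

text \<open>Inserts an unlinked pair, so \<open>b\<close> must not create a gap in an orbit. On
  vertices its orbit has to miss the range. On parts it is enough that the part of \<open>b\<close>
  is already present, since \<open>c\<close> then has the same part orbit as
  \<open>b\<close>.\<close>

lemma partial_conj_insert:
  assumes ok: "partial_conj t s y Q" and t: "tame t" and y': "piso (insert (u, b) y)"
    and free: "\<And>v x. (v, x) \<in> y \<Longrightarrow> \<not> orbit_hit t b x"
    and part: "(\<forall>v x. (v, x) \<in> y \<longrightarrow> \<not> part_hit t b x) \<or> (\<exists>w c. (w, c) \<in> y \<and> b \<asymp> c)"
  shows "partial_conj t s (insert (u, b) y) Q"
proof -
  have tk: "t ^^ k \<in> Aut" for k using t by (simp add: tame_Aut Aut_funpow)
  have "p \<in> Domain Q"
    if p: "(p, x) \<in> insert (u, b) y" "(v, (t ^^ Suc k) x) \<in> insert (u, b) y" for p x v k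
  proof (cases "(p, x) \<in> y")
    case x: True
    have "(t ^^ Suc k) x \<noteq> b" using free[OF x] unfolding orbit_hit_def by blast
    then show ?thesis using partial_conj_orbit[OF ok x] p(2) by blast
  next
    case False
    then have x: "x = b" using p(1) by blast
    have "(t ^^ Suc k) b \<noteq> b" using tame_acyclic[OF t, of k b] perp_refl by metis
    then have "(v, (t ^^ Suc k) b) \<in> y" using p(2) x by auto
    then show ?thesis using free unfolding orbit_hit_def by blast
  qed
  moreover have "\<exists>a\<in>Domain Q. a \<asymp> p"
    if p: "(p, x) \<in> insert (u, b) y" "(v, c) \<in> insert (u, b) y" "(t ^^ Suc k) x \<asymp> c" for p x v c k
  proof (cases "(p, x) \<in> y")
    case x: True
    show ?thesis
    proof (cases "(v, c) \<in> y")
      case True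
      then show ?thesis using partial_conj_part_orbit[OF ok x _ p(3)] by blast
    next
      case False
      then have c: "c = b" using p(2) by blast
      then have "part_hit t b x" using p(3) unfolding part_hit_def by blast
      then obtain w c' where w: "(w, c') \<in> y" "b \<asymp> c'" using part x by blast
      then have "(t ^^ Suc k) x \<asymp> c'" using p(3) c by (simp add: perp_part)
      then show ?thesis using partial_conj_part_orbit[OF ok x w(1)] by blast
    qed
  next
    case False
    then have x: "x = b" "p = u" using p(1) by blast+
    have "c \<noteq> b" using p(3) x tame_acyclic[OF t] by blast
    then have v: "(v, c) \<in> y" using p(2) by blast
    have "part_hit t b c" using p(3) x unfolding part_hit_def by blast
    then obtain w c' where w: "(w, c') \<in> y" "b \<asymp> c'" using part v by blast
    have "(t ^^ Suc k) b \<asymp> (t ^^ Suc k) c'" using w(2) Aut_perp[OF tk] by blast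
    then have "(t ^^ Suc k) c' \<asymp> c" using p(3) x by (simp add: perp_part)
    then obtain a where a: "a \<in> Domain Q" "a \<asymp> w" using partial_conj_part_orbit[OF ok w(1) v] by blast
    have "u \<asymp> w" using piso_perp[OF y', of u b w c'] w by blast
    then show ?thesis using a x by (metis perp_part)
  qed
  ultimately show ?thesis
    using ok y' unfolding partial_conj_def by blast
qed

text \<open>Convexity survives because \<open>t b\<close> directly follows \<open>b\<close>. What
  comes before \<open>t b\<close> is \<open>b\<close> or comes before \<open>b\<close>; a vertex of
  the range later than \<open>t b\<close> would already have put \<open>u\<close> into
  \<open>Domain Q\<close>. If a part comes later, a linked point in the part of \<open>u\<close>
  exists, and convexity at its successor, which lies in the part of \<open>s d\<close>, gives the
  required point.\<close>

lemma partial_conj_forward: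
  assumes ok: "partial_conj t s y Q" and t: "tame t" and u: "(u, b) \<in> y" "u \<notin> Domain Q"
    and y': "piso (insert (s d, t b) y)"
  shows "partial_conj t s (insert (s d, t b) y) (insert (u, d) Q)"
proof -
  let ?y = "insert (s d, t b) y" and ?Q = "insert (u, d) Q"
  have tA: "t \<in> Aut" using t by (rule tame_Aut)
  have tk: "t ^^ k \<in> Aut" for k using tA by (rule Aut_funpow)
  have "\<exists>c. (a, c) \<in> ?y \<and> (s b', t c) \<in> ?y" if "(a, b') \<in> ?Q" for a b'
    using that u(1) partial_conj_linkE[OF ok] by blast
  moreover have "p \<in> Domain ?Q"
    if p: "(p, x) \<in> ?y" "(v, (t ^^ Suc k) x) \<in> ?y" for p x v k
  proof (cases "(p, x) \<in> y")
    case x: True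
    show ?thesis
    proof (cases "(v, (t ^^ Suc k) x) \<in> y")
      case True
      then show ?thesis using partial_conj_orbit[OF ok x] by blast
    next
      case False
      then have "t ((t ^^ k) x) = t b" using p(2) by auto
      then have b: "(t ^^ k) x = b" using Aut_eq[OF tA] by blast
      show ?thesis
      proof (cases k)
        case 0
        then show ?thesis using b x u piso_eq[OF partial_conj_piso[OF ok] x u(1)] by simp
      next
        case (Suc j)
        then have "p \<in> Domain Q" using partial_conj_orbit[OF ok x, of u j] b u(1) by blast
        then show ?thesis by blast
      qed
    qed
  next
    case False
    then have x: "x = t b" using p(1) by blast
    have "(t ^^ Suc k) (t b) \<noteq> t b" using tame_acyclic[OF t, of k "t b"] perp_refl by metis
    then have "(v, (t ^^ Suc k) (t b)) \<in> y" using p(2) x by auto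
    then have "(v, (t ^^ Suc (Suc k)) b) \<in> y" by (simp only: funpow_Suc_comm)
    then show ?thesis using partial_conj_orbit[OF ok u(1)] u(2) by blast
  qed
  moreover have "\<exists>a\<in>Domain ?Q. a \<asymp> p"
    if p: "(p, x) \<in> ?y" "(v, c) \<in> ?y" "(t ^^ Suc k) x \<asymp> c" for p x v c k
  proof (cases "(p, x) \<in> y")
    case x: True
    show ?thesis
    proof (cases "(v, c) \<in> y")
      case True
      then show ?thesis using partial_conj_part_orbit[OF ok x _ p(3)] by blast
    next
      case False
      then have "t ((t ^^ k) x) \<asymp> t b" using p(2,3) by auto
      then have b: "(t ^^ k) x \<asymp> b" using Aut_perp[OF tA] by blast
      show ?thesis
      proof (cases k)
        case 0
        then have "u \<asymp> p" using b piso_perp[OF partial_conj_piso[OF ok] x u(1)] perp_sym by simp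
        then show ?thesis by blast
      next
        case (Suc j)
        then show ?thesis using partial_conj_part_orbit[OF ok x u(1), of j] b by blast
      qed
    qed
  next
    case False
    then have x: "x = t b" "p = s d" using p(1) by blast+
    have "c \<noteq> t b" using p(3) x tame_acyclic[OF t] by blast
    then have v: "(v, c) \<in> y" using p(2) by blast
    have "(t ^^ Suc (Suc k)) b \<asymp> c" using p(3) x by (simp only: funpow_Suc_comm)
    then obtain a a' where a: "(a, a') \<in> Q" "a \<asymp> u" using partial_conj_part_orbit[OF ok u(1) v] by blast
    obtain c' where c': "(a, c') \<in> y" "(s a', t c') \<in> y" using partial_conj_linkE[OF ok a(1)] .
    have "c' \<asymp> b" using piso_perp[OF partial_conj_piso[OF ok] c'(1) u(1)] a(2) by blast
    then have tc: "t c' \<asymp> t b" by (simp add: Aut_perp[OF tA])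
    then have "(t ^^ Suc k) (t c') \<asymp> (t ^^ Suc k) (t b)" using Aut_perp[OF tk] by blast
    then have "(t ^^ Suc k) (t c') \<asymp> c" using p(3) x by (simp add: perp_part)
    then obtain a'' where a'': "a'' \<in> Domain Q" "a'' \<asymp> s a'" using partial_conj_part_orbit[OF ok c'(2) v] by blast
    have "s a' \<asymp> s d" using piso_perp[OF y', of "s a'" "t c'" "s d" "t b"] c'(2) tc by blast
    then have "a'' \<asymp> s d" using a''(2) by (simp add: perp_part)
    then show ?thesis using a''(1) x by blast
  qed
  ultimately show ?thesis
    using y' unfolding partial_conj_def by blast
qed

text \<open>The new point is linked at once, and whatever comes before \<open>f\<close> also comes
  before \<open>t f\<close>, so it was linked already.\<close>

lemma partial_conj_backward:
  assumes ok: "partial_conj t s y Q" and tA: "t \<in> Aut" and u: "(s u, t f) \<in> y" and y': "piso (insert (d, f) y)"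
  shows "partial_conj t s (insert (d, f) y) (insert (d, u) Q)"
proof -
  let ?y = "insert (d, f) y" and ?Q = "insert (d, u) Q"
  have "\<exists>c. (a, c) \<in> ?y \<and> (s b', t c) \<in> ?y" if "(a, b') \<in> ?Q" for a b'
    using that u(1) partial_conj_linkE[OF ok] by blast
  moreover have "p \<in> Domain ?Q"
    if p: "(p, x) \<in> ?y" "(v, (t ^^ Suc k) x) \<in> ?y" for p x v k
  proof (cases "(p, x) \<in> y")
    case x: True
    show ?thesis
    proof (cases "(v, (t ^^ Suc k) x) \<in> y")
      case True
      then show ?thesis using partial_conj_orbit[OF ok x] by blast
    next
      case False
      then have "(t ^^ Suc (Suc k)) x = t f" using p(2) by auto
      then have "p \<in> Domain Q" using partial_conj_orbit[OF ok x, of "s u" "Suc k"] u by simp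
      then show ?thesis by blast
    qed
  qed (use p(1) in blast)
  moreover have "\<exists>a\<in>Domain ?Q. a \<asymp> p"
    if p: "(p, x) \<in> ?y" "(v, c) \<in> ?y" "(t ^^ Suc k) x \<asymp> c" for p x v c k
  proof (cases "(p, x) \<in> y")
    case x: True
    show ?thesis
    proof (cases "(v, c) \<in> y")
      case True
      then show ?thesis using partial_conj_part_orbit[OF ok x _ p(3)] by blast
    next
      case False
      then have "t ((t ^^ Suc k) x) \<asymp> t f" using p(2,3) Aut_perp[OF tA] by blast
      then have "(t ^^ Suc (Suc k)) x \<asymp> t f" by simp
      then show ?thesis using partial_conj_part_orbit[OF ok x u] by blast
    qed
  next
    case False
    then show ?thesis using p(1) perp_refl by blast
  qed
  ultimately show ?thesis
    using y' unfolding partial_conj_def by blast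
qed

text \<open>In an old part all but finitely many points avoid the orbits through the range; in a new
  part tameness offers an image whose whole orbit of parts is fresh.\<close>

lemma partial_conj_add_Domain:
  assumes ok: "partial_conj t s y Q" and t: "tame t"
  shows "\<exists>y'. partial_conj t s y' Q \<and> y \<subseteq> y' \<and> u \<in> Domain y'"
proof -
  have y: "piso y" using ok by (rule partial_conj_piso)
  consider "u \<in> Domain y" | w c where "(w, c) \<in> y" "u \<asymp> w" "u \<notin> Domain y"
    | "\<And>v. v \<in> Domain y \<Longrightarrow> \<not> u \<asymp> v" by blast
  then show ?thesis
  proof cases
    case 1
    then show ?thesis using ok by blast
  next
    case 2
    obtain b where b: "b \<asymp> c" "b \<notin> {e. e \<asymp> c \<and> (\<exists>x\<in>Range y. orbit_hit t e x)}"
      "piso (insert (u, b) y)"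
      using piso_extend_part[OF y 2 tame_finite_orbit_hit[OF t piso_finite(3)[OF y]]] by blast
    have "partial_conj t s (insert (u, b) y) Q"
    proof (rule partial_conj_insert[OF ok t b(3)])
      show "\<not> orbit_hit t b x" if "(v, x) \<in> y" for v x
        using b(1,2) that by blast
    qed (use b(1) 2(1) in blast)
    then show ?thesis by blast
  next
    case 3
    obtain b where b: "\<forall>x\<in>Range y \<union> {}. \<forall>k. \<not> (t ^^ k) b \<asymp> x \<and> \<not> (t ^^ k) x \<asymp> b"
      "piso (insert (u, b) y)"
      using piso_extend_new_part_if[OF y 3 finite.emptyI tame_new_part[OF t]] by blast
    have free: "\<not> part_hit t b x" if "(v, x) \<in> y" for v x
      using b(1) that unfolding part_hit_def by blast
    have "partial_conj t s (insert (u, b) y) Q"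
      by (rule partial_conj_insert[OF ok t b(2)]) (use free orbit_hit_part_hit in blast)+
    then show ?thesis by blast
  qed
qed

text \<open>Convexity restricts only \<open>b\<close>, so any preimage that preserves
  \<open>piso\<close> will do.\<close>

lemma partial_conj_add_Range_free:
  assumes ok: "partial_conj t s y Q" and t: "tame t"
    and free: "\<And>v x. (v, x) \<in> y \<Longrightarrow> \<not> orbit_hit t b x"
    and part: "(\<forall>v x. (v, x) \<in> y \<longrightarrow> \<not> part_hit t b x) \<or> (\<exists>w c. (w, c) \<in> y \<and> b \<asymp> c)"
  shows "\<exists>a. partial_conj t s (insert (a, b) y) Q"
proof -
  have y: "piso (y\<inverse>)" using partial_conj_piso[OF ok] by simp
  have "\<exists>a. piso (insert (a, b) y)"
  proof (cases "\<exists>w c. (w, c) \<in> y \<and> b \<asymp> c")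
    case True
    then obtain w c where w: "(c, w) \<in> y\<inverse>" "b \<asymp> c" by blast
    have "orbit_hit t b b" unfolding orbit_hit_def by (rule exI[of _ 0]) simp
    then have "b \<notin> Domain (y\<inverse>)" using free by auto
    then show ?thesis
      using piso_extend_part[OF y w(1,2) _ finite.emptyI] piso_insert_converse by blast
  next
    case False
    then show ?thesis
      using piso_extend_new_part[OF y _ finite.emptyI, of b] piso_insert_converse by blast
  qed
  then obtain a where "piso (insert (a, b) y)" by blast
  then have "partial_conj t s (insert (a, b) y) Q"
    using partial_conj_insert[OF ok t _ _ part] free by blast
  then show ?thesis by blast
qed

text \<open>
  A prescription \<open>A\<close> for \<open>e\<close> and \<open>B\<close> for \<open>t e\<close> is one for \<open>e\<close> over \<open>Range y\<close> and over its preimage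
  under \<open>t\<close>. By convexity these sets meet only in images of points of \<open>Q\<close>.
\<close>
lemma partial_conj_double_new:
  assumes ok: "partial_conj t s y Q" and t: "tame t"
    and AB: "\<And>a b. (a, b) \<in> Q \<Longrightarrow> a \<in> A \<longleftrightarrow> s b \<in> B"
  shows "\<exists>e. \<forall>(v, x)\<in>y. \<not> part_hit t e x \<and> \<not> t e \<asymp> x \<and> (E e x \<longleftrightarrow> v \<in> A) \<and> (E (t e) x \<longleftrightarrow> v \<in> B)"
proof -
  have y: "piso y" using ok by (rule partial_conj_piso)
  have tA: "t \<in> Aut" using t by (rule tame_Aut)
  let ?X = "Range y \<union> finv t ` Range y"
  let ?S = "{x. \<exists>v\<in>A. (v, x) \<in> y} \<union> {x. \<exists>v\<in>B. (v, t x) \<in> y}"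
  \<comment> \<open>The only overlap of the two prescriptions: if \<open>x\<close> and
    \<open>t x\<close> are both in the range, convexity with \<open>k = 0\<close> puts
    \<open>v\<close> into \<open>Domain Q\<close>, and its link identifies \<open>v'\<close> as
    \<open>s w\<close>.\<close>
  have link: "v \<in> A \<longleftrightarrow> v' \<in> B" if v: "(v, x) \<in> y" "(v', t x) \<in> y" for v v' x
  proof -
    have "v \<in> Domain Q" using partial_conj_orbit[OF ok v(1), of v' 0] v(2) by simp
    then obtain w where w: "(v, w) \<in> Q" by blast
    then have "(s w, t x) \<in> y" using partial_conj_link[OF ok _ v(1)] by blast
    then have "s w = v'" using piso_eq[OF y] v(2) by blast
    then show ?thesis using AB[OF w] by simp
  qed
  have "finite ?X" using piso_finite[OF y] by simp
  from tame_new_part[OF t this, of ?S] obtain e where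
    e: "\<forall>x\<in>?X. \<forall>k. \<not> (t ^^ k) e \<asymp> x \<and> \<not> (t ^^ k) x \<asymp> e"
      "\<forall>x\<in>?X. \<not> e \<asymp> x \<and> (E e x \<longleftrightarrow> x \<in> ?S)" by auto
  have "\<not> part_hit t e x \<and> \<not> t e \<asymp> x \<and> (E e x \<longleftrightarrow> v \<in> A) \<and> (E (t e) x \<longleftrightarrow> v \<in> B)"
    if v: "(v, x) \<in> y" for v x
  proof -
    have x: "x \<in> ?X" "finv t x \<in> ?X" using v by blast+
    have "\<not> part_hit t e x" using e(1) x(1) unfolding part_hit_def by blast
    moreover have "\<not> t e \<asymp> x"
    proof -
      have "\<not> (t ^^ 1) e \<asymp> x" using e(1) x(1) by blast
      then show ?thesis by simp
    qed
    moreover have "x \<in> ?S \<longleftrightarrow> v \<in> A"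
    proof -
      have "(\<exists>w\<in>A. (w, x) \<in> y) \<longleftrightarrow> v \<in> A" using v piso_eq[OF y] by blast
      then show ?thesis using link[OF v] by auto
    qed
    moreover have "finv t x \<in> ?S \<longleftrightarrow> v \<in> B"
    proof -
      have t_inv: "t (finv t x) = x" by (rule Aut_f_inv[OF tA])
      have "(\<exists>w\<in>B. (w, t (finv t x)) \<in> y) \<longleftrightarrow> v \<in> B" using v piso_eq[OF y] t_inv by metis
      then show ?thesis using link[of _ "finv t x" v] v t_inv by auto
    qed
    moreover have "E (t e) x \<longleftrightarrow> E e (finv t x)"
      using Aut_E[OF tA, of e "finv t x"] by (simp add: Aut_f_inv[OF tA])
    ultimately show ?thesis using e(2) x by blast
  qed
  then show ?thesis by blast
qed

text \<open>The old-part counterpart of \<open>partial_conj_double_new\<close>. Since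
  \<open>e\<close> must lie in the part of \<open>c\<close>, the combined prescription has to obey
  parity relative to \<open>c\<close>. Within either half this is inherited from \<open>d\<close> or
  \<open>d'\<close>; mixed pairs need convexity on parts.\<close>

lemma partial_conj_double_part:
  assumes ok: "partial_conj t s y Q" and t: "tame t"
    and a: "(a, a') \<in> Q" "(a, c) \<in> y" and d: "d \<asymp> a" "d \<notin> Domain y"
    and d': "d' \<asymp> s a'" "d' \<notin> Domain y"
    and compat: "\<And>p p'. (p, p') \<in> Q \<Longrightarrow> E d p \<longleftrightarrow> E d' (s p')"
  shows "\<exists>e. e \<asymp> c \<and> (\<forall>x\<in>Range y. \<not> orbit_hit t e x) \<and>
    piso (insert (d, e) y) \<and> piso (insert (d', t e) (insert (d, e) y))"
proof -
  have y: "piso y" using ok by (rule partial_conj_piso)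
  have tA: "t \<in> Aut" using t by (rule tame_Aut)
  have t_inv: "t (finv t x) = x" for x by (rule Aut_f_inv[OF tA])
  have ac: "(s a', t c) \<in> y" using partial_conj_link[OF ok a] .
  \<comment> \<open>These points are put into \<open>?X\<close> only to be avoided: they lie in the
    part of \<open>c\<close>, so they carry no prescription.\<close>
  let ?bad = "{e. e \<asymp> c \<and> (\<exists>x\<in>Range y. orbit_hit t e x)}"
  let ?X = "Range y \<union> finv t ` Range y \<union> ?bad"
  let ?S = "{x. \<exists>v. (v, x) \<in> y \<and> E d v} \<union> {x. \<exists>v. (v, t x) \<in> y \<and> E d' v}"
  have link: "\<exists>w. (v, w) \<in> Q \<and> s w = v'" if v: "(v, x) \<in> y" "(v', t x) \<in> y" for v v' x
  proof -
    have "v \<in> Domain Q" using partial_conj_orbit[OF ok v(1), of v' 0] v(2) by simp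
    then obtain w where w: "(v, w) \<in> Q" by blast
    then have "(s w, t x) \<in> y" using partial_conj_link[OF ok _ v(1)] by blast
    then have "s w = v'" using piso_eq[OF y] v(2) by blast
    then show ?thesis using w by blast
  qed
  have S1: "x \<in> ?S \<longleftrightarrow> E d v" if v: "(v, x) \<in> y" for v x
  proof -
    have "(\<exists>w. (w, x) \<in> y \<and> E d w) \<longleftrightarrow> E d v" using v piso_eq[OF y] by blast
    moreover have "E d' v' \<longrightarrow> E d v" if "(v', t x) \<in> y" for v'
      using link[OF v that] compat by blast
    ultimately show ?thesis by blast
  qed
  have S2: "x \<in> ?S \<longleftrightarrow> E d' v" if v: "(v, t x) \<in> y" for v x
  proof -
    have "(\<exists>w. (w, t x) \<in> y \<and> E d' w) \<longleftrightarrow> E d' v" using v piso_eq[OF y] by blast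
    moreover have "E d v' \<longrightarrow> E d' v" if "(v', x) \<in> y" for v'
      using link[OF that v] compat by blast
    ultimately show ?thesis by blast
  qed
  have par1: "(x \<in> ?S \<longleftrightarrow> x' \<in> ?S) = (E c x \<longleftrightarrow> E c x')"
    if v: "(v, x) \<in> y" "(v', x') \<in> y" and x: "x \<asymp> x'" "\<not> x \<asymp> c" for x x' v v'
  proof -
    have "v \<asymp> v'" "\<not> v \<asymp> a"
      using x piso_perp[OF y v] piso_perp[OF y v(1) a(2)] by auto
    then have "(E d v \<longleftrightarrow> E d v') = (E a v \<longleftrightarrow> E a v')"
      using parity[of d a v v'] d(1) by (simp add: perp_part)
    then show ?thesis
      using S1[OF v(1)] S1[OF v(2)] piso_E[OF y a(2) v(1)] piso_E[OF y a(2) v(2)] by simp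
  qed
  have par2: "(x \<in> ?S \<longleftrightarrow> x' \<in> ?S) = (E c x \<longleftrightarrow> E c x')"
    if v: "(v, t x) \<in> y" "(v', t x') \<in> y" and x: "x \<asymp> x'" "\<not> x \<asymp> c" for x x' v v'
  proof -
    have "t x \<asymp> t x'" "\<not> t x \<asymp> t c" using x by (simp_all add: Aut_perp[OF tA])
    then have "v \<asymp> v'" "\<not> v \<asymp> s a'"
      using piso_perp[OF y v] piso_perp[OF y v(1) ac] by auto
    then have "(E d' v \<longleftrightarrow> E d' v') = (E (s a') v \<longleftrightarrow> E (s a') v')"
      using parity[of d' "s a'" v v'] d'(1) by (simp add: perp_part)
    moreover have "E (s a') v \<longleftrightarrow> E c x" "E (s a') v' \<longleftrightarrow> E c x'"
      using piso_E[OF y ac v(1)] piso_E[OF y ac v(2)] by (simp_all add: Aut_E[OF tA])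
    ultimately show ?thesis using S2[OF v(1)] S2[OF v(2)] by simp
  qed
  \<comment> \<open>Convexity on parts supplies a linked \<open>p\<close> with image
    \<open>z\<close> in the common part of \<open>x\<close> and \<open>x'\<close>. Both
    \<open>z\<close> and \<open>t z\<close> are in the range, so \<open>z\<close> belongs to both
    halves and joins \<open>par1\<close> to \<open>par2\<close>.\<close>
  have par3: "(x \<in> ?S \<longleftrightarrow> x' \<in> ?S) = (E c x \<longleftrightarrow> E c x')"
    if v: "(v, x) \<in> y" "(v', t x') \<in> y" and x: "x \<asymp> x'" "\<not> x \<asymp> c" for x x' v v'
  proof -
    have "(t ^^ Suc 0) x \<asymp> t x'" using x(1) by (simp add: Aut_perp[OF tA])
    then obtain p p' where p: "(p, p') \<in> Q" "p \<asymp> v"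
      using partial_conj_part_orbit[OF ok v] by blast
    obtain z where z: "(p, z) \<in> y" "(s p', t z) \<in> y" using partial_conj_linkE[OF ok p(1)] .
    have "x \<asymp> z" using piso_perp[OF y z(1) v(1)] p(2) by (simp add: perp_part)
    moreover have "\<not> z \<asymp> c" "z \<asymp> x'" using x calculation by (simp_all add: perp_part)
    ultimately show ?thesis
      using par1[OF v(1) z(1)] par2[OF z(2) v(2)] x(2) by blast
  qed
  have par: "(x \<in> ?S \<longleftrightarrow> x' \<in> ?S) = (E c x \<longleftrightarrow> E c x')"
    if x: "x \<in> ?X" "x' \<in> ?X" "\<not> x \<asymp> c" "x \<asymp> x'" for x x'
  proof -
    have x': "\<not> x' \<asymp> c" "x' \<asymp> x" using x(3,4) by (simp_all add: perp_part)
    have cases: "(\<exists>v. (v, z) \<in> y) \<or> (\<exists>v. (v, t z) \<in> y)" if "z \<in> ?X" "\<not> z \<asymp> c" for z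
      using that t_inv by auto
    from cases[OF x(1,3)] cases[OF x(2) x'(1)] show ?thesis
    proof (elim disjE exE)
      fix v v' assume "(v, x) \<in> y" "(v', x') \<in> y"
      then show ?thesis by (rule par1[OF _ _ x(4,3)])
    next
      fix v v' assume "(v, x) \<in> y" "(v', t x') \<in> y"
      then show ?thesis by (rule par3[OF _ _ x(4,3)])
    next
      fix v v' assume "(v, t x) \<in> y" "(v', x') \<in> y"
      then have "(x' \<in> ?S \<longleftrightarrow> x \<in> ?S) = (E c x' \<longleftrightarrow> E c x)"
        by (intro par3[OF _ _ x'(2,1)])
      then show ?thesis by argo
    next
      fix v v' assume "(v, t x) \<in> y" "(v', t x') \<in> y"
      then show ?thesis by (rule par2[OF _ _ x(4,3)])
    qed
  qed
  have fin: "finite ?X" using piso_finite[OF y] tame_finite_orbit_hit[OF t, of "Range y" c] by simp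
  have "\<exists>e. e \<asymp> c \<and> e \<notin> ?X \<and> (\<forall>x\<in>?X. \<not> x \<asymp> c \<longrightarrow> (E e x \<longleftrightarrow> x \<in> ?S))"
    by (rule extend_part[OF fin par])
  then obtain e where e: "e \<asymp> c" "e \<notin> ?X" "\<forall>x\<in>?X. \<not> x \<asymp> c \<longrightarrow> (E e x \<longleftrightarrow> x \<in> ?S)"
    by (elim exE conjE) (rule that)
  have free: "\<not> orbit_hit t e x" if "x \<in> Range y" for x
    using e(1,2) that by blast
  have te: "t e \<asymp> t c" using e(1) by (simp add: Aut_perp[OF tA])
  have perp1: "d \<asymp> v \<longleftrightarrow> e \<asymp> x" if "(v, x) \<in> y" for v x
    using piso_perp[OF y a(2) that] d(1) e(1) by (simp add: perp_part)
  have perp2: "d' \<asymp> v \<longleftrightarrow> t e \<asymp> x" if "(v, x) \<in> y" for v x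
    using piso_perp[OF y ac that] d'(1) te by (simp add: perp_part)
  have E1: "E d v \<longleftrightarrow> E e x" if v: "(v, x) \<in> y" for v x
  proof (cases "e \<asymp> x")
    case True
    then show ?thesis using perp1[OF v] by (simp add: perp_def)
  next
    case False
    then have "\<not> x \<asymp> c" using e(1) by (simp add: perp_part)
    moreover have "x \<in> ?X" using v by blast
    ultimately have "E e x \<longleftrightarrow> x \<in> ?S" by (intro e(3)[rule_format])
    then show ?thesis using S1[OF v] by argo
  qed
  have E2: "E d' v \<longleftrightarrow> E (t e) x" if v: "(v, x) \<in> y" for v x
  proof (cases "t e \<asymp> x")
    case True
    then show ?thesis using perp2[OF v] by (simp add: perp_def)
  next
    case False
    then have "\<not> e \<asymp> finv t x" using Aut_perp[OF tA, of e "finv t x"] t_inv by simp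
    then have "\<not> finv t x \<asymp> c" using e(1) by (simp add: perp_part)
    moreover have "finv t x \<in> ?X" using v by blast
    ultimately have "E e (finv t x) \<longleftrightarrow> finv t x \<in> ?S" by (intro e(3)[rule_format])
    moreover have "finv t x \<in> ?S \<longleftrightarrow> E d' v" using v t_inv by (intro S2) simp
    ultimately have "E e (finv t x) \<longleftrightarrow> E d' v" by argo
    then show ?thesis using Aut_E[OF tA, of e "finv t x"] t_inv by simp
  qed
  have y1: "piso (insert (d, e) y)"
  proof (rule piso_insert[OF y])
    fix v x assume v: "(v, x) \<in> y"
    then show "d \<noteq> v \<and> e \<noteq> x \<and> (d \<asymp> v \<longleftrightarrow> e \<asymp> x) \<and> (E d v \<longleftrightarrow> E e x)"
      using d(2) e(2) perp1[OF v] E1[OF v] by auto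
  qed
  moreover have "piso (insert (d', t e) (insert (d, e) y))"
  proof (rule piso_insert[OF y1])
    fix v x assume v: "(v, x) \<in> insert (d, e) y"
    show "d' \<noteq> v \<and> t e \<noteq> x \<and> (d' \<asymp> v \<longleftrightarrow> t e \<asymp> x) \<and> (E d' v \<longleftrightarrow> E (t e) x)"
    proof (cases "(v, x) \<in> y")
      case True
      then have "\<not> orbit_hit t e x" using free by blast
      then have "(t ^^ 1) e \<noteq> x" unfolding orbit_hit_def by blast
      then show ?thesis using d'(2) True perp2[OF True] E2[OF True] by auto
    next
      case False
      then have v: "v = d" "x = e" using v by blast+
      have n1: "\<not> t e \<asymp> e" by (rule tame_not_perp[OF t])
      have n2: "\<not> s a' \<asymp> a"
        using piso_perp[OF y ac a(2)] tame_not_perp[OF t] by blast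
      have n3: "\<not> d' \<asymp> d" using n2 d(1) d'(1) by (simp add: perp_part)
      \<comment> \<open>The edge between \<open>d'\<close> and \<open>d\<close> was never
        prescribed. Parity expresses it by three edges involving \<open>a\<close> or
        \<open>s a'\<close>, and the edge between \<open>t e\<close> and \<open>e\<close> by their
        three images, so the two agree.\<close>
      have "(E d' d \<longleftrightarrow> E d' a) = (E (s a') d \<longleftrightarrow> E (s a') a)"
        using parity[OF d'(1) d(1) n3] .
      moreover have "(E (t e) e \<longleftrightarrow> E (t e) c) = (E (t c) e \<longleftrightarrow> E (t c) c)"
        using parity[OF te e(1) n1] .
      moreover have "E d' a \<longleftrightarrow> E (t e) c" using E2[OF a(2)] .
      moreover have "E (s a') d \<longleftrightarrow> E (t c) e"
      proof -
        have "\<not> d \<asymp> s a'" "\<not> e \<asymp> t c" using n3 d'(1) n1 te by (simp_all add: perp_part)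
        then show ?thesis using E1[OF ac] not_perp_rev by blast
      qed
      moreover have "E (s a') a \<longleftrightarrow> E (t c) c" using piso_E[OF y ac a(2)] .
      ultimately have "E d' d \<longleftrightarrow> E (t e) e" by argo
      then show ?thesis using v n1 n3 perp_refl by metis
    qed
  qed
  ultimately show ?thesis using e(1) free by blast
qed

section \<open>Cyclic triples and their rotation\<close>

definition pr01 :: "(nat \<times> nat \<times> nat) set \<Rightarrow> (nat \<times> nat) set" where
  "pr01 R = {(a, b). \<exists>c. (a, b, c) \<in> R}"

definition pr12 :: "(nat \<times> nat \<times> nat) set \<Rightarrow> (nat \<times> nat) set" where
  "pr12 R = {(b, c). \<exists>a. (a, b, c) \<in> R}"

text \<open>The pair is \<open>(c, a)\<close> because the third step leads back to the first entry;
  with this order \<open>rot\<close> permutes the three projections.\<close>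

definition pr20 :: "(nat \<times> nat \<times> nat) set \<Rightarrow> (nat \<times> nat) set" where
  "pr20 R = {(c, a). \<exists>b. (a, b, c) \<in> R}"

definition rot :: "(nat \<times> nat \<times> nat) set \<Rightarrow> (nat \<times> nat \<times> nat) set" where
  "rot R = {(b, c, a). (a, b, c) \<in> R}"

lemma pr_rot [simp]: "pr01 (rot R) = pr12 R" "pr12 (rot R) = pr20 R" "pr20 (rot R) = pr01 R"
  by (auto simp: pr01_def pr12_def pr20_def rot_def)

lemma pr_insert:
  "pr01 (insert (a, b, c) R) = insert (a, b) (pr01 R)"
  "pr12 (insert (a, b, c) R) = insert (b, c) (pr12 R)"
  "pr20 (insert (a, b, c) R) = insert (c, a) (pr20 R)"
  by (auto simp: pr01_def pr12_def pr20_def)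

lemma rot_rot_rot [simp]: "rot (rot (rot R)) = R"
  by (auto simp: rot_def)

lemma rot_mono: "rot R \<subseteq> rot R' \<longleftrightarrow> R \<subseteq> R'"
  unfolding rot_def by auto

text \<open>
  A triple \<open>(x, y, z)\<close> of \<open>R\<close> records a path through the three conjugated maps, which closes up to a cycle.
  Allowing arbitrary \<open>s0\<close>, \<open>s1\<close>, \<open>s2\<close> makes the situation invariant under rotation; the case of interest is
  \<open>s0 = s1 = id\<close> and \<open>s2 = h\<close>.
\<close>
definition partial_cycle where
  "partial_cycle t0 t1 t2 s0 s1 s2 R y0 y1 y2 \<longleftrightarrow>
     tame t0 \<and> tame t1 \<and> tame t2 \<and> s0 \<in> Aut \<and> s1 \<in> Aut \<and> s2 \<in> Aut \<and>
     partial_conj t0 s0 y0 (pr01 R) \<and> partial_conj t1 s1 y1 (pr12 R) \<and> partial_conj t2 s2 y2 (pr20 R)"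

lemma partial_cycle_rot: "partial_cycle t0 t1 t2 s0 s1 s2 R y0 y1 y2 \<Longrightarrow> partial_cycle t1 t2 t0 s1 s2 s0 (rot R) y1 y2 y0"
  by (simp add: partial_cycle_def)

text \<open>Each approximation gets the new link in its own way: \<open>y0\<close> forward from
  \<open>b\<close>, \<open>y2\<close> backward from \<open>t2 f\<close>, and \<open>y1\<close>,
  where neither end was present, by inserting \<open>e\<close> unlinked and then stepping
  forward.\<close>

lemma partial_cycle_add_triple:
  assumes good: "partial_cycle t0 t1 t2 s0 s1 s2 R y0 y1 y2"
    and u: "(u, b) \<in> y0" "(s2 u, t2 f) \<in> y2" "u \<notin> Domain (pr01 R)"
    and y0: "piso (insert (s0 d1, t0 b) y0)" and y2: "piso (insert (d2, f) y2)"
    and d1: "d1 \<notin> Domain y1" and y1: "piso (insert (d1, e) y1)" "piso (insert (s1 d2, t1 e) (insert (d1, e) y1))"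
    and free: "\<And>v x. (v, x) \<in> y1 \<Longrightarrow> \<not> orbit_hit t1 e x"
    and part: "(\<forall>v x. (v, x) \<in> y1 \<longrightarrow> \<not> part_hit t1 e x) \<or> (\<exists>w c. (w, c) \<in> y1 \<and> e \<asymp> c)"
  shows "partial_cycle t0 t1 t2 s0 s1 s2 (insert (u, d1, d2) R)
    (insert (s0 d1, t0 b) y0) (insert (s1 d2, t1 e) (insert (d1, e) y1)) (insert (d2, f) y2)"
proof -
  have t: "tame t0" "tame t1" "tame t2"
    and ok: "partial_conj t0 s0 y0 (pr01 R)" "partial_conj t1 s1 y1 (pr12 R)" "partial_conj t2 s2 y2 (pr20 R)"
    using good unfolding partial_cycle_def by blast+
  have "partial_conj t0 s0 (insert (s0 d1, t0 b) y0) (insert (u, d1) (pr01 R))"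
    by (rule partial_conj_forward[OF ok(1) t(1) u(1,3) y0])
  moreover have "partial_conj t1 s1 (insert (d1, e) y1) (pr12 R)"
    by (rule partial_conj_insert[OF ok(2) t(2) y1(1) free part])
  then have "partial_conj t1 s1 (insert (s1 d2, t1 e) (insert (d1, e) y1)) (insert (d1, d2) (pr12 R))"
  proof (rule partial_conj_forward[OF _ t(2)])
    show "d1 \<notin> Domain (pr12 R)"
      using d1 partial_conj_linkE[OF ok(2)] by blast
  qed (use y1(2) in simp_all)
  moreover have "partial_conj t2 s2 (insert (d2, f) y2) (insert (d2, u) (pr20 R))"
    by (rule partial_conj_backward[OF ok(3) tame_Aut[OF t(3)] u(2) y2])
  ultimately show ?thesis
    using good unfolding partial_cycle_def pr_insert by blast
qed

text \<open>The edges of \<open>u\<close> to first entries of old triples reappear as edges of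
  \<open>d\<close> to second entries. Together with \<open>transfer_backward\<close>, this makes the
  types of \<open>d1\<close> and \<open>d2\<close> over old triples agree, which is the
  compatibility needed for \<open>e\<close>.\<close>

lemma transfer_forward:
  assumes ok: "partial_conj t s y Q" and t: "t \<in> Aut" and s: "s \<in> Aut" and u: "(u, b) \<in> y"
    and y': "piso (insert (s d, t b) y)" and a: "(a, a') \<in> Q"
  shows "E d a' \<longleftrightarrow> E u a"
proof -
  obtain c where c: "(a, c) \<in> y" "(s a', t c) \<in> y" using partial_conj_linkE[OF ok a] .
  have "E (s d) (s a') \<longleftrightarrow> E (t b) (t c)" using piso_E[OF y'] c(2) by blast
  moreover have "E u a \<longleftrightarrow> E b c" using piso_E[OF partial_conj_piso[OF ok] u c(1)] .
  ultimately show ?thesis by (simp add: Aut_E[OF s] Aut_E[OF t])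
qed

lemma transfer_backward:
  assumes ok: "partial_conj t s y Q" and t: "t \<in> Aut" and s: "s \<in> Aut" and u: "(s u, t f) \<in> y"
    and a: "(a', a) \<in> Q" "(a', z) \<in> y"
  shows "E f z \<longleftrightarrow> E u a"
proof -
  have "(s a, t z) \<in> y" using partial_conj_link[OF ok a] .
  then have "E (s u) (s a) \<longleftrightarrow> E (t f) (t z)" using piso_E[OF partial_conj_piso[OF ok] u] by blast
  then show ?thesis by (simp add: Aut_E[OF s] Aut_E[OF t])
qed

text \<open>Convexity on parts puts \<open>t0 b\<close> and \<open>f\<close> into parts not met by
  the ranges, so all choices can be made in new parts. The order is \<open>d1\<close>,
  \<open>e\<close>, \<open>d2\<close>; as \<open>d2\<close> comes last, its edge to
  \<open>d1\<close> can copy the one between \<open>t1 e\<close> and \<open>e\<close>.\<close>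

lemma partial_cycle_core_new:
  assumes good: "partial_cycle t0 t1 t2 s0 s1 s2 R y0 y1 y2"
    and u: "(u, b) \<in> y0" "(s2 u, t2 f) \<in> y2" and new: "\<And>a. a \<in> Domain (pr01 R) \<Longrightarrow> \<not> a \<asymp> u"
  shows "\<exists>d1 d2 e. partial_cycle t0 t1 t2 s0 s1 s2 (insert (u, d1, d2) R)
    (insert (s0 d1, t0 b) y0) (insert (s1 d2, t1 e) (insert (d1, e) y1)) (insert (d2, f) y2)"
proof -
  have t: "tame t0" "tame t1" "tame t2" and s: "s0 \<in> Aut" "s1 \<in> Aut" "s2 \<in> Aut"
    and ok: "partial_conj t0 s0 y0 (pr01 R)" "partial_conj t1 s1 y1 (pr12 R)" "partial_conj t2 s2 y2 (pr20 R)"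
    using good unfolding partial_cycle_def by blast+
  note tA = t[THEN tame_Aut] and y = ok[THEN partial_conj_piso]
  have b_new: "\<forall>x\<in>Range y0. \<not> t0 b \<asymp> x"
  proof (intro ballI notI)
    fix x assume x: "x \<in> Range y0" and *: "t0 b \<asymp> x"
    obtain v where "(v, x) \<in> y0" using x by blast
    then show False using partial_conj_part_orbit[OF ok(1) u(1), of v x 0] * new by auto
  qed
  \<comment> \<open>A range point in the part of \<open>f\<close> would precede the part of
    \<open>t2 f\<close>, so that part would contain a linked point; its partner \<open>a'\<close>
    would then be the first entry of a triple in the part of \<open>u\<close>.\<close>
  have f_new: "\<not> f \<asymp> x" if x: "x \<in> Range y2" for x
  proof
    assume *: "f \<asymp> x"
    obtain v where v: "(v, x) \<in> y2" using x by blast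
    have tx: "t2 x \<asymp> t2 f" using * perp_sym by (simp add: Aut_perp[OF tA(3)])
    then obtain a a' where a: "(a, a') \<in> pr20 R" "a \<asymp> v"
      using partial_conj_part_orbit[OF ok(3) v u(2), of 0] by auto
    obtain z where z: "(a, z) \<in> y2" "(s2 a', t2 z) \<in> y2" using partial_conj_linkE[OF ok(3) a(1)] .
    have "z \<asymp> x" using piso_perp[OF y(3) z(1) v] a(2) by blast
    then have "t2 z \<asymp> t2 x" by (simp add: Aut_perp[OF tA(3)])
    then have "t2 z \<asymp> t2 f" using tx by (rule perp_trans)
    then have "s2 a' \<asymp> s2 u" using piso_perp[OF y(3) z(2) u(2)] by blast
    then have "a' \<asymp> u" by (simp add: Aut_perp[OF s(3)])
    moreover have "a' \<in> Domain (pr01 R)" using a(1) by (auto simp: pr01_def pr20_def)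
    ultimately show False using new by blast
  qed
  \<comment> \<open>Avoiding these images keeps \<open>d1\<close> out of the parts of
    \<open>Domain y1\<close> and \<open>finv s1 d1\<close> out of \<open>Domain y2\<close>.\<close>
  have fin: "finite (s0 ` Domain y1 \<union> s0 ` s1 ` Domain y2)" using piso_finite y by simp
  obtain m where m: "\<forall>x\<in>Domain y0 \<union> (s0 ` Domain y1 \<union> s0 ` s1 ` Domain y2). \<not> m \<asymp> x"
    "piso (insert (m, t0 b) y0)"
    using piso_extend_Range_new_part[OF y(1) b_new fin] by (elim exE conjE) (rule that)
  define d1 where "d1 = finv s0 m"
  have m_eq: "m = s0 d1" by (simp add: d1_def Aut_f_inv[OF s(1)])
  have d1_new: "\<not> d1 \<asymp> v" if "v \<in> Domain y1" for v
  proof -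
    have "\<not> s0 d1 \<asymp> s0 v" using m(1) that unfolding m_eq by blast
    then show ?thesis by (simp add: Aut_perp[OF s(1)])
  qed
  have d1_new2: "finv s1 d1 \<notin> Domain y2"
  proof
    assume "finv s1 d1 \<in> Domain y2"
    then have "s0 (s1 (finv s1 d1)) \<in> s0 ` s1 ` Domain y2" by blast
    then have "s0 d1 \<in> s0 ` s1 ` Domain y2" by (simp add: Aut_f_inv[OF s(2)])
    then show False using m(1) perp_refl unfolding m_eq by blast
  qed
  \<comment> \<open>The edges that \<open>s1 d2\<close> will need if \<open>d2\<close> is to
    correspond to \<open>f\<close>. Where \<open>f\<close> dictates nothing, the default is no edge
    from \<open>s1 d2\<close>; \<open>?S\<close> below repeats this choice for
    \<open>d2\<close>.\<close>
  let ?B = "{v. \<exists>x. (finv s1 v, x) \<in> y2 \<and> E f x}"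
  have compat: "a \<in> {v. E d1 v} \<longleftrightarrow> s1 a' \<in> ?B" if aa: "(a, a') \<in> pr12 R" for a a'
  proof -
    obtain a0 where a0: "(a0, a, a') \<in> R" using aa by (auto simp: pr12_def)
    then have q: "(a0, a) \<in> pr01 R" "(a', a0) \<in> pr20 R" by (auto simp: pr01_def pr20_def)
    obtain z where z: "(a', z) \<in> y2" using partial_conj_linkE[OF ok(3) q(2)] by blast
    have "E d1 a \<longleftrightarrow> E u a0"
      using transfer_forward[OF ok(1) tA(1) s(1) u(1) _ q(1)] m(2) unfolding m_eq by blast
    moreover have "E f z \<longleftrightarrow> E u a0"
      by (rule transfer_backward[OF ok(3) tA(3) s(3) u(2) q(2) z])
    moreover have "s1 a' \<in> ?B \<longleftrightarrow> E f z"
      using z piso_eq[OF y(3)] by (auto simp: Aut_inv_f[OF s(2)])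
    ultimately show ?thesis by simp
  qed
  have "\<exists>e. \<forall>(v, x)\<in>y1. \<not> part_hit t1 e x \<and> \<not> t1 e \<asymp> x \<and> (E e x \<longleftrightarrow> v \<in> {v. E d1 v}) \<and> (E (t1 e) x \<longleftrightarrow> v \<in> ?B)"
    by (rule partial_conj_double_new[OF ok(2) t(2)]) (rule compat)
  then obtain e where
    e': "\<forall>(v, x)\<in>y1. \<not> part_hit t1 e x \<and> \<not> t1 e \<asymp> x \<and> (E e x \<longleftrightarrow> v \<in> {v. E d1 v}) \<and> (E (t1 e) x \<longleftrightarrow> v \<in> ?B)"
    by (elim exE) (rule that)
  have e: "\<not> part_hit t1 e x \<and> \<not> t1 e \<asymp> x \<and> (E e x \<longleftrightarrow> E d1 v) \<and> (E (t1 e) x \<longleftrightarrow> v \<in> ?B)"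
    if "(v, x) \<in> y1" for v x
    using bspec[OF e' that] by simp
  let ?X = "Domain y2 \<union> finv s1 ` Domain y1 \<union> {finv s1 d1}"
  \<comment> \<open>The extra point makes \<open>E (s1 d2) d1\<close> equivalent to
    \<open>E (t1 e) e\<close>. It is free to choose, because \<open>finv s1 d1\<close> is not in
    \<open>Domain y2\<close>.\<close>
  let ?S = "{v. \<exists>x. (v, x) \<in> y2 \<and> E f x} \<union> (if E (t1 e) e then {finv s1 d1} else {})"
  have "finite ?X" using piso_finite y by simp
  from extend_new_part[OF this, of ?S] obtain d2 where
    d2: "\<forall>x\<in>?X. \<not> d2 \<asymp> x \<and> (E d2 x \<longleftrightarrow> x \<in> ?S)" by (elim exE conjE) (rule that)
  have y2': "piso (insert (d2, f) y2)"
  proof (rule piso_insert_new[OF y(3)])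
    fix v x assume v: "(v, x) \<in> y2"
    then have "v \<in> ?X" by blast
    then have "\<not> d2 \<asymp> v \<and> (E d2 v \<longleftrightarrow> v \<in> ?S)" using d2 by blast
    moreover have "v \<noteq> finv s1 d1" using d1_new2 v by blast
    then have "v \<in> ?S \<longleftrightarrow> E f x" using v piso_eq[OF y(3)] by auto
    moreover have "\<not> f \<asymp> x" using f_new v by blast
    ultimately show "\<not> d2 \<asymp> v \<and> \<not> f \<asymp> x \<and> (E d2 v \<longleftrightarrow> E f x)" by blast
  qed
  have y1': "piso (insert (d1, e) y1)"
  proof (rule piso_insert_new[OF y(2)])
    fix v x assume v: "(v, x) \<in> y1"
    show "\<not> d1 \<asymp> v \<and> \<not> e \<asymp> x \<and> (E d1 v \<longleftrightarrow> E e x)"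
      using d1_new[of v] e[OF v] part_hit_perp v by blast
  qed
  have y1'': "piso (insert (s1 d2, t1 e) (insert (d1, e) y1))"
  proof (rule piso_insert_new[OF y1'])
    fix v x assume v: "(v, x) \<in> insert (d1, e) y1"
    have inv: "s1 d2 \<asymp> v \<longleftrightarrow> d2 \<asymp> finv s1 v" "E (s1 d2) v \<longleftrightarrow> E d2 (finv s1 v)"
      using Aut_perp[OF s(2), of d2 "finv s1 v"] Aut_E[OF s(2), of d2 "finv s1 v"]
      by (simp_all add: Aut_f_inv[OF s(2)])
    show "\<not> s1 d2 \<asymp> v \<and> \<not> t1 e \<asymp> x \<and> (E (s1 d2) v \<longleftrightarrow> E (t1 e) x)"
    proof (cases "(v, x) \<in> y1")
      case True
      then have "finv s1 v \<in> ?X" by blast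
      then have 1: "\<not> d2 \<asymp> finv s1 v \<and> (E d2 (finv s1 v) \<longleftrightarrow> finv s1 v \<in> ?S)" using d2 by blast
      have "v \<noteq> d1" using d1_new[of v] True perp_refl by blast
      then have "finv s1 v \<noteq> finv s1 d1" using Aut_eq[OF Aut_inv[OF s(2)]] by blast
      then have "finv s1 v \<in> ?S \<longleftrightarrow> v \<in> ?B" by auto
      then show ?thesis using e[OF True] 1 inv by blast
    next
      case False
      then have v: "v = d1" "x = e" using v by blast+
      have "finv s1 d1 \<in> ?X" by blast
      then have 1: "\<not> d2 \<asymp> finv s1 d1 \<and> (E d2 (finv s1 d1) \<longleftrightarrow> finv s1 d1 \<in> ?S)" using d2 by blast
      have "finv s1 d1 \<in> ?S \<longleftrightarrow> E (t1 e) e" using d1_new2 by auto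
      then show ?thesis using 1 inv tame_not_perp[OF t(2)] unfolding v by blast
    qed
  qed
  have "u \<notin> Domain (pr01 R)" using new perp_refl by blast
  moreover have "d1 \<notin> Domain y1" using d1_new perp_refl by blast
  ultimately show ?thesis
    using partial_cycle_add_triple[OF good u _ _ y2' _ y1' y1''] m(2) e orbit_hit_part_hit
    unfolding m_eq by blast
qed

text \<open>All new points follow the triple of \<open>a\<close>: \<open>d1\<close>,
  \<open>d2\<close> and \<open>e\<close> are chosen in the parts of \<open>a1\<close>,
  \<open>a2\<close> and \<open>x1\<close>. Here \<open>d2\<close> precedes \<open>e\<close>, and
  \<open>partial_conj_double_part\<close> takes care of the edge between \<open>s1 d2\<close> and
  \<open>d1\<close> by parity.\<close>

lemma partial_cycle_core_part:
  assumes good: "partial_cycle t0 t1 t2 s0 s1 s2 R y0 y1 y2"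
    and u: "(u, b) \<in> y0" "(s2 u, t2 f) \<in> y2" "u \<notin> Domain (pr01 R)"
    and a: "(a, a1, a2) \<in> R" "a \<asymp> u"
  shows "\<exists>d1 d2 e. partial_cycle t0 t1 t2 s0 s1 s2 (insert (u, d1, d2) R)
    (insert (s0 d1, t0 b) y0) (insert (s1 d2, t1 e) (insert (d1, e) y1)) (insert (d2, f) y2)"
proof -
  have t: "tame t0" "tame t1" "tame t2" and s: "s0 \<in> Aut" "s1 \<in> Aut" "s2 \<in> Aut"
    and ok: "partial_conj t0 s0 y0 (pr01 R)" "partial_conj t1 s1 y1 (pr12 R)" "partial_conj t2 s2 y2 (pr20 R)"
    using good unfolding partial_cycle_def by blast+
  note tA = t[THEN tame_Aut] and y = ok[THEN partial_conj_piso]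
  have q: "(a, a1) \<in> pr01 R" "(a1, a2) \<in> pr12 R" "(a2, a) \<in> pr20 R"
    using a(1) by (auto simp: pr01_def pr12_def pr20_def)
  obtain x0 where x0: "(a, x0) \<in> y0" "(s0 a1, t0 x0) \<in> y0" using partial_conj_linkE[OF ok(1) q(1)] .
  obtain x1 where x1: "(a1, x1) \<in> y1" "(s1 a2, t1 x1) \<in> y1" using partial_conj_linkE[OF ok(2) q(2)] .
  obtain x2 where x2: "(a2, x2) \<in> y2" "(s2 a, t2 x2) \<in> y2" using partial_conj_linkE[OF ok(3) q(3)] .
  have "x0 \<asymp> b" using piso_perp[OF y(1) x0(1) u(1)] a(2) by blast
  then have b: "t0 b \<asymp> t0 x0" using perp_sym by (simp add: Aut_perp[OF tA(1)])
  \<comment> \<open>By convexity on vertices \<open>t0 b\<close> could be in the range only if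
    \<open>u\<close> were linked; \<open>f'\<close> below rests on the same reason, read
    backwards.\<close>
  have b': "t0 b \<notin> Range y0"
  proof
    assume "t0 b \<in> Range y0"
    then obtain v where "(v, t0 b) \<in> y0" by blast
    then show False using partial_conj_orbit[OF ok(1) u(1), of v 0] u(3) by simp
  qed
  have fin: "finite (s0 ` Domain y1)" using piso_finite y by simp
  obtain m where m: "m \<asymp> s0 a1" "m \<notin> s0 ` Domain y1" "piso (insert (m, t0 b) y0)"
    using piso_extend_Range_part[OF y(1) x0(2) b b' fin] by (elim exE conjE) (rule that)
  define d1 where "d1 = finv s0 m"
  have m_eq: "m = s0 d1" by (simp add: d1_def Aut_f_inv[OF s(1)])
  have d1: "d1 \<asymp> a1" "d1 \<notin> Domain y1"
    using m(1,2) unfolding m_eq by (auto simp: Aut_perp[OF s(1)])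
  have "s2 a \<asymp> s2 u" using a(2) by (simp add: Aut_perp[OF s(3)])
  then have "t2 x2 \<asymp> t2 f" using piso_perp[OF y(3) x2(2) u(2)] by blast
  then have f: "f \<asymp> x2" using perp_sym by (simp add: Aut_perp[OF tA(3)])
  have f': "f \<notin> Range y2"
  proof
    assume "f \<in> Range y2"
    then obtain v where v: "(v, f) \<in> y2" by blast
    then have "v \<in> Domain (pr20 R)" using partial_conj_orbit[OF ok(3) v, of "s2 u" 0] u(2) by simp
    then obtain v' where v': "(v, v') \<in> pr20 R" by blast
    then have "(s2 v', t2 f) \<in> y2" using partial_conj_link[OF ok(3) _ v] by blast
    then have "s2 v' = s2 u" using piso_eq[OF y(3) _ u(2)] by blast
    then have "v' = u" using Aut_eq[OF s(3)] by blast
    then show False using v' u(3) by (auto simp: pr01_def pr20_def)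
  qed
  have fin2: "finite (finv s1 ` Domain y1)" using piso_finite y by simp
  obtain d2 where d2: "d2 \<asymp> a2" "d2 \<notin> finv s1 ` Domain y1" "piso (insert (d2, f) y2)"
    using piso_extend_Range_part[OF y(3) x2(1) f f' fin2] by (elim exE conjE) (rule that)
  have d2': "s1 d2 \<asymp> s1 a2" "s1 d2 \<notin> Domain y1"
  proof -
    show "s1 d2 \<asymp> s1 a2" using d2(1) by (simp add: Aut_perp[OF s(2)])
    show "s1 d2 \<notin> Domain y1" using d2(2) Aut_inv_f[OF s(2), of d2] by (metis image_eqI)
  qed
  have compat: "E d1 p \<longleftrightarrow> E (s1 d2) (s1 p')" if pp: "(p, p') \<in> pr12 R" for p p'
  proof -
    obtain p0 where p0: "(p0, p, p') \<in> R" using pp by (auto simp: pr12_def)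
    then have q: "(p0, p) \<in> pr01 R" "(p', p0) \<in> pr20 R" by (auto simp: pr01_def pr20_def)
    obtain z where z: "(p', z) \<in> y2" using partial_conj_linkE[OF ok(3) q(2)] by blast
    have "E d1 p \<longleftrightarrow> E u p0"
      using transfer_forward[OF ok(1) tA(1) s(1) u(1) _ q(1)] m(3) unfolding m_eq by blast
    moreover have "E f z \<longleftrightarrow> E u p0"
      by (rule transfer_backward[OF ok(3) tA(3) s(3) u(2) q(2) z])
    moreover have "E d2 p' \<longleftrightarrow> E f z"
      using piso_E[OF d2(3)] z by blast
    ultimately show ?thesis by (simp add: Aut_E[OF s(2)])
  qed
  have "\<exists>e. e \<asymp> x1 \<and> (\<forall>x\<in>Range y1. \<not> orbit_hit t1 e x) \<and>
      piso (insert (d1, e) y1) \<and> piso (insert (s1 d2, t1 e) (insert (d1, e) y1))"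
    by (rule partial_conj_double_part[OF ok(2) t(2) q(2) x1(1) d1 d2']) (rule compat)
  then obtain e where
    e: "e \<asymp> x1" "\<forall>x\<in>Range y1. \<not> orbit_hit t1 e x"
      "piso (insert (d1, e) y1)" "piso (insert (s1 d2, t1 e) (insert (d1, e) y1))" by (elim exE conjE) (rule that)
  show ?thesis
    using partial_cycle_add_triple[OF good u _ d2(3) d1(2) e(3,4)] m(3) e(1,2) x1(1)
    unfolding m_eq by blast
qed

section \<open>Meeting the requirements of the back-and-forth construction\<close>

text \<open>Hides the extended state, so that extension steps compose by \<open>reach_trans\<close>
  and are moved to another approximation by \<open>reach_rot\<close>.\<close>

definition reach where
  "reach t0 t1 t2 s0 s1 s2 R y0 y1 y2 \<Phi> \<longleftrightarrow>
     (\<exists>R' y0' y1' y2'. partial_cycle t0 t1 t2 s0 s1 s2 R' y0' y1' y2' \<and>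
        R \<subseteq> R' \<and> y0 \<subseteq> y0' \<and> y1 \<subseteq> y1' \<and> y2 \<subseteq> y2' \<and> \<Phi> R' y0' y1' y2')"

lemma reachI:
  assumes "partial_cycle t0 t1 t2 s0 s1 s2 R' y0' y1' y2'"
    "R \<subseteq> R'" "y0 \<subseteq> y0'" "y1 \<subseteq> y1'" "y2 \<subseteq> y2'" "\<Phi> R' y0' y1' y2'"
  shows "reach t0 t1 t2 s0 s1 s2 R y0 y1 y2 \<Phi>"
  using assms unfolding reach_def by blast

lemma reachE:
  assumes "reach t0 t1 t2 s0 s1 s2 R y0 y1 y2 \<Phi>"
  obtains R' y0' y1' y2' where "partial_cycle t0 t1 t2 s0 s1 s2 R' y0' y1' y2'"
    "R \<subseteq> R'" "y0 \<subseteq> y0'" "y1 \<subseteq> y1'" "y2 \<subseteq> y2'" "\<Phi> R' y0' y1' y2'"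
  using assms unfolding reach_def by (elim exE conjE) (rule that)

lemma reach_trans:
  assumes "reach t0 t1 t2 s0 s1 s2 R y0 y1 y2 \<Phi>"
    and "\<And>R' y0' y1' y2'. partial_cycle t0 t1 t2 s0 s1 s2 R' y0' y1' y2' \<Longrightarrow>
      R \<subseteq> R' \<Longrightarrow> y0 \<subseteq> y0' \<Longrightarrow> y1 \<subseteq> y1' \<Longrightarrow> y2 \<subseteq> y2' \<Longrightarrow> \<Phi> R' y0' y1' y2' \<Longrightarrow>
      reach t0 t1 t2 s0 s1 s2 R' y0' y1' y2' \<Psi>"
  shows "reach t0 t1 t2 s0 s1 s2 R y0 y1 y2 \<Psi>"
proof -
  obtain R' y0' y1' y2' where 1: "partial_cycle t0 t1 t2 s0 s1 s2 R' y0' y1' y2'"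
    "R \<subseteq> R'" "y0 \<subseteq> y0'" "y1 \<subseteq> y1'" "y2 \<subseteq> y2'" "\<Phi> R' y0' y1' y2'"
    using assms(1) by (rule reachE)
  obtain R'' y0'' y1'' y2'' where 2: "partial_cycle t0 t1 t2 s0 s1 s2 R'' y0'' y1'' y2''"
    "R' \<subseteq> R''" "y0' \<subseteq> y0''" "y1' \<subseteq> y1''" "y2' \<subseteq> y2''" "\<Psi> R'' y0'' y1'' y2''"
    using assms(2)[OF 1] by (rule reachE)
  show ?thesis
    by (rule reachI[where \<Phi> = \<Psi>, OF 2(1) subset_trans[OF 1(2) 2(2)] subset_trans[OF 1(3) 2(3)]
      subset_trans[OF 1(4) 2(4)] subset_trans[OF 1(5) 2(5)] 2(6)])
qed

lemma reach_rot:
  assumes "reach t1 t2 t0 s1 s2 s0 (rot R) y1 y2 y0 \<Phi>"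
  shows "reach t0 t1 t2 s0 s1 s2 R y0 y1 y2 (\<lambda>R y0 y1 y2. \<Phi> (rot R) y1 y2 y0)"
proof -
  obtain R' y1' y2' y0' where 1: "partial_cycle t1 t2 t0 s1 s2 s0 R' y1' y2' y0'"
    "rot R \<subseteq> R'" "y1 \<subseteq> y1'" "y2 \<subseteq> y2'" "y0 \<subseteq> y0'" "\<Phi> R' y1' y2' y0'"
    using assms by (rule reachE)
  have "R \<subseteq> rot (rot R')" using 1(2) rot_mono[of "rot R" R'] rot_mono[of "rot (rot R)" "rot R'"] by simp
  then show ?thesis
    using 1 partial_cycle_rot[OF partial_cycle_rot[OF 1(1)]] unfolding reach_def by (metis rot_rot_rot)
qed

text \<open>Both ends of the path from \<open>u\<close> are fixed first, by giving images to
  \<open>u\<close> under \<open>y0\<close> and to \<open>s2 u\<close> under \<open>y2\<close>. The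
  core lemmas then fill in the middle.\<close>

lemma partial_cycle_add_first:
  assumes good: "partial_cycle t0 t1 t2 s0 s1 s2 R y0 y1 y2"
  shows "reach t0 t1 t2 s0 s1 s2 R y0 y1 y2 (\<lambda>R y0 y1 y2. u \<in> Domain (pr01 R))"
proof (cases "u \<in> Domain (pr01 R)")
  case True
  then show ?thesis using good by (intro reachI) auto
next
  case False
  have t: "tame t0" "tame t1" "tame t2" and s: "s0 \<in> Aut" "s1 \<in> Aut" "s2 \<in> Aut"
    and ok: "partial_conj t0 s0 y0 (pr01 R)" "partial_conj t1 s1 y1 (pr12 R)" "partial_conj t2 s2 y2 (pr20 R)"
    using good unfolding partial_cycle_def by blast+
  obtain z0 b where z0: "partial_conj t0 s0 z0 (pr01 R)" "y0 \<subseteq> z0" "(u, b) \<in> z0"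
    using partial_conj_add_Domain[OF ok(1) t(1), of u] by blast
  obtain z2 f where z2: "partial_conj t2 s2 z2 (pr20 R)" "y2 \<subseteq> z2" "(s2 u, f) \<in> z2"
    using partial_conj_add_Domain[OF ok(3) t(3), of "s2 u"] by blast
  have good': "partial_cycle t0 t1 t2 s0 s1 s2 R z0 y1 z2"
    using good z0(1) z2(1) unfolding partial_cycle_def by blast
  \<comment> \<open>The core lemmas want the last image as a value of \<open>t2\<close>, because the
    third step arrives at \<open>s2 u\<close> from its \<open>t2\<close>-preimage.\<close>
  have f: "(s2 u, t2 (finv t2 f)) \<in> z2"
    using z2(3) by (simp add: Aut_f_inv[OF tame_Aut[OF t(3)]])
  have "\<exists>d1 d2 e. partial_cycle t0 t1 t2 s0 s1 s2 (insert (u, d1, d2) R)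
    (insert (s0 d1, t0 b) z0) (insert (s1 d2, t1 e) (insert (d1, e) y1)) (insert (d2, finv t2 f) z2)"
  proof (cases "\<exists>a\<in>Domain (pr01 R). a \<asymp> u")
    case True
    then obtain a a1 a2 where "(a, a1, a2) \<in> R" "a \<asymp> u" by (auto simp: pr01_def)
    then show ?thesis by (rule partial_cycle_core_part[OF good' z0(3) f False])
  next
    case False
    then show ?thesis by (intro partial_cycle_core_new[OF good' z0(3) f]) blast
  qed
  then obtain d1 d2 e where g: "partial_cycle t0 t1 t2 s0 s1 s2 (insert (u, d1, d2) R)
    (insert (s0 d1, t0 b) z0) (insert (s1 d2, t1 e) (insert (d1, e) y1)) (insert (d2, finv t2 f) z2)"
    by blast
  have "u \<in> Domain (pr01 (insert (u, d1, d2) R))" by (simp add: pr_insert)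
  then show ?thesis
    using z0(2) z2(2) by (intro reachI[OF g]) auto
qed

lemma partial_cycle_add_second:
  assumes "partial_cycle t0 t1 t2 s0 s1 s2 R y0 y1 y2"
  shows "reach t0 t1 t2 s0 s1 s2 R y0 y1 y2 (\<lambda>R y0 y1 y2. u \<in> Domain (pr12 R))"
  using reach_rot[OF partial_cycle_add_first[OF partial_cycle_rot[OF assms]]] by simp

text \<open>Linking the preimage of a range point forces the \<open>t0\<close>-successor of that
  point into the range.\<close>

lemma partial_cycle_fill_forward:
  assumes "partial_cycle t0 t1 t2 s0 s1 s2 R y0 y1 y2" "(v, x) \<in> y0"
  shows "reach t0 t1 t2 s0 s1 s2 R y0 y1 y2 (\<lambda>R y0 y1 y2. (t0 ^^ k) x \<in> Range y0)"
proof (induction k)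
  case 0
  show ?case using assms by (intro reachI[OF assms(1)]) auto
next
  case (Suc k)
  show ?case
  proof (rule reach_trans[OF Suc])
    fix R y0 y1 y2
    assume g: "partial_cycle t0 t1 t2 s0 s1 s2 R y0 y1 y2" and "(t0 ^^ k) x \<in> Range y0"
    then obtain v where v: "(v, (t0 ^^ k) x) \<in> y0" by blast
    show "reach t0 t1 t2 s0 s1 s2 R y0 y1 y2 (\<lambda>R y0 y1 y2. (t0 ^^ Suc k) x \<in> Range y0)"
    proof (rule reach_trans[OF partial_cycle_add_first[OF g, of v]])
      fix R' y0' y1' y2'
      assume g': "partial_cycle t0 t1 t2 s0 s1 s2 R' y0' y1' y2'" and "v \<in> Domain (pr01 R')" "y0 \<subseteq> y0'"
      then obtain d where "(v, d) \<in> pr01 R'" "(v, (t0 ^^ k) x) \<in> y0'" using v by blast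
      then have "(s0 d, t0 ((t0 ^^ k) x)) \<in> y0'"
        using partial_conj_link g' unfolding partial_cycle_def by blast
      then show "reach t0 t1 t2 s0 s1 s2 R' y0' y1' y2' (\<lambda>R y0 y1 y2. (t0 ^^ Suc k) x \<in> Range y0)"
        by (intro reachI[OF g']) auto
    qed
  qed
qed

text \<open>Making \<open>finv s0 v\<close> the second entry of a triple gives that triple a first
  entry whose image is the \<open>t0\<close>-predecessor of the image of \<open>v\<close>.\<close>

lemma partial_cycle_fill_backward:
  assumes "partial_cycle t0 t1 t2 s0 s1 s2 R y0 y1 y2" "(v, (t0 ^^ k) b) \<in> y0"
  shows "reach t0 t1 t2 s0 s1 s2 R y0 y1 y2 (\<lambda>R y0 y1 y2. b \<in> Range y0)"
  using assms
proof (induction k arbitrary: R y0 y1 y2 v)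
  case 0
  then show ?case by (intro reachI[OF 0(1)]) auto
next
  case (Suc k)
  show ?case
  proof (rule reach_trans[OF partial_cycle_add_second[OF Suc(2), of "finv s0 v"]])
    fix R' y0' y1' y2'
    assume g': "partial_cycle t0 t1 t2 s0 s1 s2 R' y0' y1' y2'" and w: "finv s0 v \<in> Domain (pr12 R')"
      and sub: "y0 \<subseteq> y0'"
    have s0: "s0 \<in> Aut" and t0: "t0 \<in> Aut" and ok: "partial_conj t0 s0 y0' (pr01 R')"
      using g' tame_Aut unfolding partial_cycle_def by blast+
    obtain a where "(a, finv s0 v) \<in> pr01 R'" using w by (auto simp: pr01_def pr12_def)
    then obtain c where c: "(a, c) \<in> y0'" "(s0 (finv s0 v), t0 c) \<in> y0'" using partial_conj_linkE[OF ok] by blast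
    then have "t0 c = (t0 ^^ Suc k) b"
      using Suc(3) sub piso_eq[OF partial_conj_piso[OF ok]] by (metis Aut_f_inv[OF s0] subsetD)
    then have "c = (t0 ^^ k) b" using Aut_eq[OF t0] by simp
    then show "reach t0 t1 t2 s0 s1 s2 R' y0' y1' y2' (\<lambda>R y0 y1 y2. b \<in> Range y0)"
      using Suc(1)[OF g'] c(1) by blast
  qed
qed

text \<open>Inserting \<open>b\<close> freely would break convexity if its orbit met the range; in
  that case the orbit is followed step by step until \<open>b\<close> is reached.\<close>

lemma partial_cycle_add_Range_orbit:
  assumes good: "partial_cycle t0 t1 t2 s0 s1 s2 R y0 y1 y2"
    and part: "(\<forall>v x. (v, x) \<in> y0 \<longrightarrow> \<not> part_hit t0 b x) \<or> (\<exists>w c. (w, c) \<in> y0 \<and> b \<asymp> c)"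
  shows "reach t0 t1 t2 s0 s1 s2 R y0 y1 y2 (\<lambda>R y0 y1 y2. b \<in> Range y0)"
proof (cases "\<exists>v x. (v, x) \<in> y0 \<and> orbit_hit t0 b x")
  case True
  then obtain v x k where v: "(v, x) \<in> y0" and "(t0 ^^ k) b = x \<or> (t0 ^^ k) x = b"
    unfolding orbit_hit_def by blast
  then show ?thesis
    using partial_cycle_fill_forward[OF good v] partial_cycle_fill_backward[OF good] by blast
next
  case False
  have t: "tame t0" and ok: "partial_conj t0 s0 y0 (pr01 R)" using good unfolding partial_cycle_def by blast+
  obtain a where "partial_conj t0 s0 (insert (a, b) y0) (pr01 R)"
    using partial_conj_add_Range_free[OF ok t _ part] False by blast
  then have "partial_cycle t0 t1 t2 s0 s1 s2 R (insert (a, b) y0) y1 y2"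
    using good unfolding partial_cycle_def by blast
  then show ?thesis by (rule reachI) auto
qed

text \<open>If only the part orbit of \<open>b\<close> meets the range, the gap is first filled up
  to some point in the part of \<open>b\<close>; the previous lemma then applies.\<close>

lemma partial_cycle_add_Range:
  assumes good: "partial_cycle t0 t1 t2 s0 s1 s2 R y0 y1 y2"
  shows "reach t0 t1 t2 s0 s1 s2 R y0 y1 y2 (\<lambda>R y0 y1 y2. b \<in> Range y0)"
proof (cases "\<exists>v x. (v, x) \<in> y0 \<and> part_hit t0 b x")
  case True
  have tA: "t0 ^^ k \<in> Aut" for k using good Aut_funpow tame_Aut unfolding partial_cycle_def by blast
  obtain v x k where v: "(v, x) \<in> y0" and "(t0 ^^ k) b \<asymp> x \<or> (t0 ^^ k) x \<asymp> b"
    using True unfolding part_hit_def by blast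
  then have "reach t0 t1 t2 s0 s1 s2 R y0 y1 y2 (\<lambda>R y0 y1 y2. \<exists>c\<in>Range y0. b \<asymp> c)"
  proof (elim disjE)
    assume b: "(t0 ^^ k) b \<asymp> x"
    let ?c = "finv (t0 ^^ k) x"
    have c: "(t0 ^^ k) ?c = x" by (rule Aut_f_inv[OF tA])
    have "b \<asymp> ?c" using b Aut_perp[OF tA, of k b ?c] c by simp
    moreover have "reach t0 t1 t2 s0 s1 s2 R y0 y1 y2 (\<lambda>R y0 y1 y2. ?c \<in> Range y0)"
      using partial_cycle_fill_backward[OF good, of v k ?c] v c by simp
    ultimately show ?thesis unfolding reach_def by blast
  next
    assume b: "(t0 ^^ k) x \<asymp> b"
    then have "b \<asymp> (t0 ^^ k) x" by (rule perp_sym)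
    then show ?thesis
      using partial_cycle_fill_forward[OF good v, of k] unfolding reach_def by blast
  qed
  then show ?thesis
    by (rule reach_trans) (rule partial_cycle_add_Range_orbit, assumption, blast)
next
  case False
  then show ?thesis by (intro partial_cycle_add_Range_orbit[OF good]) blast
qed

lemma partial_cycle_step:
  assumes g: "partial_cycle t0 t1 t2 s0 s1 s2 R y0 y1 y2"
  shows "reach t0 t1 t2 s0 s1 s2 R y0 y1 y2 (\<lambda>R y0 y1 y2.
    u \<in> Domain (pr01 R) \<and> u \<in> Domain (pr12 R) \<and> u \<in> Domain (pr20 R) \<and>
    u \<in> Range y0 \<and> u \<in> Range y1 \<and> u \<in> Range y2)"
proof -
  obtain Ra ya yb yc where a: "partial_cycle t0 t1 t2 s0 s1 s2 Ra ya yb yc"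
    "R \<subseteq> Ra" "y0 \<subseteq> ya" "y1 \<subseteq> yb" "y2 \<subseteq> yc" "u \<in> Domain (pr01 Ra)"
    using partial_cycle_add_first[OF g, of u] by (rule reachE)
  obtain Rb za zb zc where b: "partial_cycle t0 t1 t2 s0 s1 s2 Rb za zb zc"
    "Ra \<subseteq> Rb" "ya \<subseteq> za" "yb \<subseteq> zb" "yc \<subseteq> zc" "u \<in> Domain (pr12 Rb)"
    using partial_cycle_add_second[OF a(1), of u] by (rule reachE)
  have "reach t0 t1 t2 s0 s1 s2 Rb za zb zc (\<lambda>R y0 y1 y2. u \<in> Domain (pr20 R))"
    using reach_rot[OF partial_cycle_add_second[OF partial_cycle_rot[OF b(1)]]] by simp
  then obtain Rc wa wb wc where c: "partial_cycle t0 t1 t2 s0 s1 s2 Rc wa wb wc"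
    "Rb \<subseteq> Rc" "za \<subseteq> wa" "zb \<subseteq> wb" "zc \<subseteq> wc" "u \<in> Domain (pr20 Rc)"
    by (rule reachE)
  obtain Rd pa pb pc where d: "partial_cycle t0 t1 t2 s0 s1 s2 Rd pa pb pc"
    "Rc \<subseteq> Rd" "wa \<subseteq> pa" "wb \<subseteq> pb" "wc \<subseteq> pc" "u \<in> Range pa"
    using partial_cycle_add_Range[OF c(1), of u] by (rule reachE)
  have "reach t0 t1 t2 s0 s1 s2 Rd pa pb pc (\<lambda>R y0 y1 y2. u \<in> Range y1)"
    using reach_rot[OF partial_cycle_add_Range[OF partial_cycle_rot[OF d(1)]]] .
  then obtain Re qa qb qc where e: "partial_cycle t0 t1 t2 s0 s1 s2 Re qa qb qc"
    "Rd \<subseteq> Re" "pa \<subseteq> qa" "pb \<subseteq> qb" "pc \<subseteq> qc" "u \<in> Range qb"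
    by (rule reachE)
  have "reach t0 t1 t2 s0 s1 s2 Re qa qb qc (\<lambda>R y0 y1 y2. u \<in> Range y2)"
    using reach_rot[OF reach_rot[OF partial_cycle_add_Range[OF partial_cycle_rot[OF partial_cycle_rot[OF e(1)]]]]] .
  then obtain Rf ra rb rc where f: "partial_cycle t0 t1 t2 s0 s1 s2 Rf ra rb rc"
    "Re \<subseteq> Rf" "qa \<subseteq> ra" "qb \<subseteq> rb" "qc \<subseteq> rc" "u \<in> Range rc"
    by (rule reachE)
  have "Ra \<subseteq> Rf" "Rb \<subseteq> Rf" "Rc \<subseteq> Rf" using b(2) c(2) d(2) e(2) f(2) by blast+
  then have "u \<in> Domain (pr01 Rf)" "u \<in> Domain (pr12 Rf)" "u \<in> Domain (pr20 Rf)"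
    using a(6) b(6) c(6) unfolding pr01_def pr12_def pr20_def by blast+
  moreover have "u \<in> Range ra" "u \<in> Range rb" "u \<in> Range rc"
    using d(6) e(3,6) f(3,4,6) by blast+
  moreover have "R \<subseteq> Rf" "y0 \<subseteq> ra" "y1 \<subseteq> rb" "y2 \<subseteq> rc"
    using a(2-5) b(2-5) c(2-5) d(2-5) e(2-5) f(2-5) by (meson subset_trans)+
  ultimately show ?thesis by (intro reachI[OF f(1)]) blast+
qed

text \<open>Eliminating \<open>y\<close> and \<open>z\<close> shows that \<open>s2\<close> is the
  product of the three conjugates with \<open>s0\<close> and \<open>s1\<close> undone after the
  first and second. This cyclic form is what the rotation preserves.\<close>

lemma tame_triple:
  assumes "tame t0" "tame t1" "tame t2" "s0 \<in> Aut" "s1 \<in> Aut" "s2 \<in> Aut"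
  shows "\<exists>f0\<in>Aut. \<exists>f1\<in>Aut. \<exists>f2\<in>Aut. \<forall>x. \<exists>y z.
    t0 (f0 x) = f0 (s0 y) \<and> t1 (f1 y) = f1 (s1 z) \<and> t2 (f2 z) = f2 (s2 x)"
proof -
  define P where "P = (\<lambda>(R, y0, y1, y2). partial_cycle t0 t1 t2 s0 s1 s2 R y0 y1 y2)"
  define ext where "ext = (\<lambda>(R, y0, y1, y2) (R', y0', y1', y2').
    R \<subseteq> (R' :: (nat \<times> nat \<times> nat) set) \<and> y0 \<subseteq> (y0' :: (nat \<times> nat) set) \<and>
    y1 \<subseteq> (y1' :: (nat \<times> nat) set) \<and> y2 \<subseteq> (y2' :: (nat \<times> nat) set))"
  define D where "D u = (\<lambda>(R, y0, y1, y2).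
    u \<in> Domain (pr01 R) \<and> u \<in> Domain (pr12 R) \<and> u \<in> Domain (pr20 R) \<and>
    u \<in> Range (y0 :: (nat \<times> nat) set) \<and> u \<in> Range (y1 :: (nat \<times> nat) set) \<and>
    u \<in> Range (y2 :: (nat \<times> nat) set))" for u :: nat
  have base: "P ({}, {}, {}, {})"
    using assms by (simp add: P_def partial_cycle_def partial_conj_def pr01_def pr12_def pr20_def)
  have refl: "ext s s" for s
    by (auto simp: ext_def split: prod.split)
  have trans: "ext s u" if "ext s t" "ext t u" for s t u
    using that unfolding ext_def by (cases s; cases t; cases u) auto
  have dense: "\<exists>s'. P s' \<and> ext s s' \<and> D u s'" if "P s" for u s
  proof -
    obtain R y0 y1 y2 where s: "s = (R, y0, y1, y2)" by (cases s)
    then have "partial_cycle t0 t1 t2 s0 s1 s2 R y0 y1 y2" using that by (simp add: P_def)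
    from partial_cycle_step[OF this, of u] obtain R' y0' y1' y2' where
      1: "partial_cycle t0 t1 t2 s0 s1 s2 R' y0' y1' y2'" "R \<subseteq> R'" "y0 \<subseteq> y0'" "y1 \<subseteq> y1'" "y2 \<subseteq> y2'"
        "u \<in> Domain (pr01 R') \<and> u \<in> Domain (pr12 R') \<and> u \<in> Domain (pr20 R') \<and>
         u \<in> Range y0' \<and> u \<in> Range y1' \<and> u \<in> Range y2'"
      by (rule reachE)
    then show ?thesis
      by (intro exI[of _ "(R', y0', y1', y2')"]) (simp add: P_def ext_def D_def s)
  qed
  obtain f :: "nat \<Rightarrow> (nat \<times> nat \<times> nat) set \<times> (nat \<times> nat) set \<times> (nat \<times> nat) set \<times> (nat \<times> nat) set"
    where f: "\<And>n. P (f n)" "\<And>m n. m \<le> n \<Longrightarrow> ext (f m) (f n)" "\<And>u. \<exists>n. D u (f n)"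
    by (rule generic_chain[where P = P and ext = ext and D = D, OF base refl trans dense]) blast+
  define R where "R n = fst (f n)" for n
  define y0 where "y0 n = fst (snd (f n))" for n
  define y1 where "y1 n = fst (snd (snd (f n)))" for n
  define y2 where "y2 n = snd (snd (snd (f n)))" for n
  have f_eq: "f n = (R n, y0 n, y1 n, y2 n)" for n
    by (simp add: R_def y0_def y1_def y2_def)
  have good: "partial_cycle t0 t1 t2 s0 s1 s2 (R n) (y0 n) (y1 n) (y2 n)" for n
    using f(1)[of n] by (simp add: P_def f_eq)
  have ok: "partial_conj t0 s0 (y0 n) (pr01 (R n))" "partial_conj t1 s1 (y1 n) (pr12 (R n))" "partial_conj t2 s2 (y2 n) (pr20 (R n))" for n
    using good[of n] unfolding partial_cycle_def by blast+
  have mono: "y0 m \<subseteq> y0 n" "y1 m \<subseteq> y1 n" "y2 m \<subseteq> y2 n" if "m \<le> n" for m n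
    using f(2)[OF that] by (simp_all add: ext_def f_eq)
  have D: "\<exists>n. u \<in> Domain (pr01 (R n)) \<and> u \<in> Domain (pr12 (R n)) \<and> u \<in> Domain (pr20 (R n)) \<and>
      u \<in> Range (y0 n) \<and> u \<in> Range (y1 n) \<and> u \<in> Range (y2 n)" for u
    using f(3)[of u] by (simp add: D_def f_eq)
  have dom: "\<exists>n b. (a, b) \<in> y0 n" "\<exists>n b. (a, b) \<in> y1 n" "\<exists>n b. (a, b) \<in> y2 n" for a
  proof -
    obtain n b0 b1 b2 where "(a, b0) \<in> pr01 (R n)" "(a, b1) \<in> pr12 (R n)" "(a, b2) \<in> pr20 (R n)"
      using D[of a] by blast
    then show "\<exists>n b. (a, b) \<in> y0 n" "\<exists>n b. (a, b) \<in> y1 n" "\<exists>n b. (a, b) \<in> y2 n"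
      using partial_conj_linkE[OF ok(1)] partial_conj_linkE[OF ok(2)] partial_conj_linkE[OF ok(3)] by metis+
  qed
  have ran: "\<exists>n a. (a, b) \<in> y0 n" "\<exists>n a. (a, b) \<in> y1 n" "\<exists>n a. (a, b) \<in> y2 n" for b
    using D[of b] by blast+
  obtain f0 where f0: "f0 \<in> Aut" "\<And>n a b. (a, b) \<in> y0 n \<Longrightarrow> b = f0 a"
    by (rule piso_chain_limit[of y0, OF mono(1) partial_conj_piso[OF ok(1)] dom(1) ran(1)]) blast+
  obtain f1 where f1: "f1 \<in> Aut" "\<And>n a b. (a, b) \<in> y1 n \<Longrightarrow> b = f1 a"
    by (rule piso_chain_limit[of y1, OF mono(2) partial_conj_piso[OF ok(2)] dom(2) ran(2)]) blast+
  obtain f2 where f2: "f2 \<in> Aut" "\<And>n a b. (a, b) \<in> y2 n \<Longrightarrow> b = f2 a"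
    by (rule piso_chain_limit[of y2, OF mono(3) partial_conj_piso[OF ok(3)] dom(3) ran(3)]) blast+
  have link: "t (g a) = g (s b)"
    if "partial_conj t s y Q" "\<And>a b. (a, b) \<in> y \<Longrightarrow> b = g a" "(a, b) \<in> Q" for t s y Q g a b
    using partial_conj_linkE[OF that(1,3)] that(2) by metis
  have "\<exists>y z. t0 (f0 x) = f0 (s0 y) \<and> t1 (f1 y) = f1 (s1 z) \<and> t2 (f2 z) = f2 (s2 x)" for x
  proof -
    obtain n y z where "(x, y, z) \<in> R n" using D[of x] by (auto simp: pr01_def)
    then have q: "(x, y) \<in> pr01 (R n)" "(y, z) \<in> pr12 (R n)" "(z, x) \<in> pr20 (R n)"
      by (auto simp: pr01_def pr12_def pr20_def)
    have "t0 (f0 x) = f0 (s0 y)" by (rule link[OF ok(1) _ q(1)]) (rule f0(2))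
    moreover have "t1 (f1 y) = f1 (s1 z)" by (rule link[OF ok(2) _ q(2)]) (rule f1(2))
    moreover have "t2 (f2 z) = f2 (s2 x)" by (rule link[OF ok(3) _ q(3)]) (rule f2(2))
    ultimately show ?thesis by blast
  qed
  then show ?thesis using f0(1) f1(1) f2(1) by blast
qed

lemma Aut_eq_tame_conjugates:
  assumes t: "tame t" and h: "h \<in> Aut"
  shows "\<exists>f0\<in>Aut. \<exists>f1\<in>Aut. \<exists>f2\<in>Aut.
    h = (finv f2 \<circ> t \<circ> f2) \<circ> (finv f1 \<circ> t \<circ> f1) \<circ> (finv f0 \<circ> t \<circ> f0)"
proof -
  obtain f0 f1 f2 where f: "f0 \<in> Aut" "f1 \<in> Aut" "f2 \<in> Aut"
    and eq: "\<And>x. \<exists>y z. t (f0 x) = f0 (id y) \<and> t (f1 y) = f1 (id z) \<and> t (f2 z) = f2 (h x)"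
    using tame_triple[OF t t t Aut_id Aut_id h] by blast
  have "h x = ((finv f2 \<circ> t \<circ> f2) \<circ> (finv f1 \<circ> t \<circ> f1) \<circ> (finv f0 \<circ> t \<circ> f0)) x" for x
  proof -
    obtain y z where "t (f0 x) = f0 y" "t (f1 y) = f1 z" "t (f2 z) = f2 (h x)" using eq[of x] by auto
    then show ?thesis by (simp add: Aut_inv_f[OF f(1)] Aut_inv_f[OF f(2)] Aut_inv_f[OF f(3)])
  qed
  then show ?thesis using f by blast
qed

theorem normal_closed_eq_Aut:
  assumes M: "M \<subseteq> Aut" and g: "g \<in> M" "g \<noteq> id"
    and comp: "\<And>f h. f \<in> M \<Longrightarrow> h \<in> M \<Longrightarrow> f \<circ> h \<in> M" and inv: "\<And>f. f \<in> M \<Longrightarrow> finv f \<in> M"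
    and conj: "\<And>f k. f \<in> M \<Longrightarrow> k \<in> Aut \<Longrightarrow> finv k \<circ> f \<circ> k \<in> M"
  shows "M = Aut"
proof
  obtain k where k: "k \<in> Aut" "tame (finv g \<circ> finv k \<circ> g \<circ> k)"
    using ex_tame_commutator[of g] M g by blast
  have "finv g \<circ> (finv k \<circ> g \<circ> k) \<in> M"
    using g k(1) by (intro comp inv conj)
  then have t: "finv g \<circ> finv k \<circ> g \<circ> k \<in> M"
    by (simp only: comp_assoc)
  show "Aut \<subseteq> M"
  proof
    fix h assume "h \<in> Aut"
    then obtain f0 f1 f2 where "f0 \<in> Aut" "f1 \<in> Aut" "f2 \<in> Aut"
      "h = (finv f2 \<circ> (finv g \<circ> finv k \<circ> g \<circ> k) \<circ> f2) \<circ> (finv f1 \<circ> (finv g \<circ> finv k \<circ> g \<circ> k) \<circ> f1)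
        \<circ> (finv f0 \<circ> (finv g \<circ> finv k \<circ> g \<circ> k) \<circ> f0)"
      using Aut_eq_tame_conjugates[OF k(2)] by blast
    then show "h \<in> M" using t by (simp only: comp conj)
  qed
qed (rule M)

end

section \<open>Extension properties from ultrahomogeneity\<close>

text \<open>Four bits have even sum exactly when their exclusive or vanishes.\<close>

lemma even_card_edges_iff:
  assumes "u \<noteq> u'" "v \<noteq> v'"
  shows "even (card {(x, y) \<in> {u, u'} \<times> {v, v'}. E x y}) \<longleftrightarrow>
    (E u v \<longleftrightarrow> E u v') = (E u' v \<longleftrightarrow> E u' v')"
proof -
  let ?A = "{(u, v), (u, v'), (u', v), (u', v')}"
  have "{(x, y) \<in> {u, u'} \<times> {v, v'}. E x y} = ?A \<inter> {p. case p of (x, y) \<Rightarrow> E x y}" by auto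
  then have "card {(x, y) \<in> {u, u'} \<times> {v, v'}. E x y} =
      (\<Sum>p\<in>?A. of_bool (case p of (x, y) \<Rightarrow> E x y))"
    by (subst sum_of_bool_eq) auto
  also have "\<dots> = of_bool (E u v) + of_bool (E u v') + of_bool (E u' v) + of_bool (E u' v')"
    using assms by simp
  finally show ?thesis by auto
qed

lemma class_S_iff:
  "class_S V E \<longleftrightarrow> finite V \<and> (\<forall>x\<in>V. \<not> E x x) \<and> (\<forall>x\<in>V. \<forall>y\<in>V. E x y \<longrightarrow> \<not> E y x) \<and>
     (\<forall>x\<in>V. \<forall>y\<in>V. \<forall>z\<in>V. perp E x y \<longrightarrow> perp E y z \<longrightarrow> perp E x z) \<and>
     (\<forall>u\<in>V. \<forall>u'\<in>V. \<forall>v\<in>V. \<forall>v'\<in>V. perp E u u' \<longrightarrow> perp E v v' \<longrightarrow> \<not> perp E u v \<longrightarrow>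
       (E u v \<longleftrightarrow> E u v') = (E u' v \<longleftrightarrow> E u' v'))"
proof -
  have og: "oriented_graph V E \<longleftrightarrow> (\<forall>x\<in>V. \<not> E x x) \<and> (\<forall>x\<in>V. \<forall>y\<in>V. E x y \<longrightarrow> \<not> E y x)"
    unfolding oriented_graph_def irreflp_on_def antisymp_on_def by blast
  have eqv: "equiv V {(u, v) \<in> V \<times> V. perp E u v} \<longleftrightarrow>
      (\<forall>x\<in>V. \<forall>y\<in>V. \<forall>z\<in>V. perp E x y \<longrightarrow> perp E y z \<longrightarrow> perp E x z)" if "\<forall>x\<in>V. \<not> E x x"
  proof
    assume "equiv V {(u, v) \<in> V \<times> V. perp E u v}"
    then have "trans {(u, v) \<in> V \<times> V. perp E u v}" by (simp add: equiv_def)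
    then show "\<forall>x\<in>V. \<forall>y\<in>V. \<forall>z\<in>V. perp E x y \<longrightarrow> perp E y z \<longrightarrow> perp E x z"
      unfolding trans_def by blast
  next
    assume *: "\<forall>x\<in>V. \<forall>y\<in>V. \<forall>z\<in>V. perp E x y \<longrightarrow> perp E y z \<longrightarrow> perp E x z"
    show "equiv V {(u, v) \<in> V \<times> V. perp E u v}"
    proof (rule equivI)
      show "refl_on V {(u, v) \<in> V \<times> V. perp E u v}"
        using that by (auto simp: refl_on_def perp_def)
      show "sym {(u, v) \<in> V \<times> V. perp E u v}"
        by (auto simp: sym_def perp_def)
      show "trans {(u, v) \<in> V \<times> V. perp E u v}"
        using * unfolding trans_def by blast
    qed auto
  qed
  have par: "parity_condition V E \<longleftrightarrow>
     (\<forall>u\<in>V. \<forall>u'\<in>V. \<forall>v\<in>V. \<forall>v'\<in>V. perp E u u' \<longrightarrow> perp E v v' \<longrightarrow> \<not> perp E u v \<longrightarrow>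
       (E u v \<longleftrightarrow> E u v') = (E u' v \<longleftrightarrow> E u' v'))"
    unfolding parity_condition_def
  proof (rule iffI; intro ballI impI)
    fix u u' v v'
    assume *: "\<forall>u\<in>V. \<forall>u'\<in>V. \<forall>v\<in>V. \<forall>v'\<in>V.
        u \<noteq> u' \<and> v \<noteq> v' \<and> perp E u u' \<and> perp E v v' \<and> \<not> perp E u v \<longrightarrow>
        even (card {(x, y) \<in> {u, u'} \<times> {v, v'}. E x y})"
      and V: "u \<in> V" "u' \<in> V" "v \<in> V" "v' \<in> V" and p: "perp E u u'" "perp E v v'" "\<not> perp E u v"
    show "(E u v \<longleftrightarrow> E u v') = (E u' v \<longleftrightarrow> E u' v')"
    proof (cases "u = u' \<or> v = v'")
      case False
      then have "even (card {(x, y) \<in> {u, u'} \<times> {v, v'}. E x y})" using * V p by blast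
      then show ?thesis using False even_card_edges_iff[of u u' v v' E] by blast
    qed auto
  next
    fix u u' v v'
    assume *: "\<forall>u\<in>V. \<forall>u'\<in>V. \<forall>v\<in>V. \<forall>v'\<in>V. perp E u u' \<longrightarrow> perp E v v' \<longrightarrow> \<not> perp E u v \<longrightarrow>
       (E u v \<longleftrightarrow> E u v') = (E u' v \<longleftrightarrow> E u' v')"
      and V: "u \<in> V" "u' \<in> V" "v \<in> V" "v' \<in> V"
      and p: "u \<noteq> u' \<and> v \<noteq> v' \<and> perp E u u' \<and> perp E v v' \<and> \<not> perp E u v"
    then have "(E u v \<longleftrightarrow> E u v') = (E u' v \<longleftrightarrow> E u' v')" by blast
    then show "even (card {(x, y) \<in> {u, u'} \<times> {v, v'}. E x y})"
      using p even_card_edges_iff[of u u' v v' E] by blast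
  qed
  show ?thesis
    unfolding class_S_def omega_partite_tournament_def og par
    by (simp only: conj_assoc eqv cong: conj_cong)
qed

lemma class_S_irrefl: "class_S V E \<Longrightarrow> x \<in> V \<Longrightarrow> \<not> E x x"
  unfolding class_S_iff by blast

lemma class_S_asym: "class_S V E \<Longrightarrow> x \<in> V \<Longrightarrow> y \<in> V \<Longrightarrow> E x y \<Longrightarrow> \<not> E y x"
  unfolding class_S_iff by blast

lemma class_S_perp_trans:
  "class_S V E \<Longrightarrow> x \<in> V \<Longrightarrow> y \<in> V \<Longrightarrow> z \<in> V \<Longrightarrow> perp E x y \<Longrightarrow> perp E y z \<Longrightarrow> perp E x z"
  unfolding class_S_iff by blast

lemma class_S_parity:
  assumes "class_S V E" "u \<in> V" "u' \<in> V" "v \<in> V" "v' \<in> V"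
    and "perp E u u'" "perp E v v'" "\<not> perp E u v"
  shows "(E u v \<longleftrightarrow> E u v') = (E u' v \<longleftrightarrow> E u' v')"
  using assms unfolding class_S_iff by blast

lemma perp_graph_iso:
  assumes "graph_iso V E W F f" "x \<in> V" "y \<in> V"
  shows "perp F (f x) (f y) \<longleftrightarrow> perp E x y"
  using assms unfolding graph_iso_def perp_def by blast

lemma class_S_graph_iso:
  assumes f: "graph_iso V E W F f" and V: "class_S V E"
  shows "class_S W F"
proof -
  have W: "W = f ` V" using f by (auto simp: graph_iso_def bij_betw_def)
  have FE: "F (f x) (f y) \<longleftrightarrow> E x y" if "x \<in> V" "y \<in> V" for x y
    using f that unfolding graph_iso_def by blast
  note FE = FE perp_graph_iso[OF f]
  note cV = V[unfolded class_S_iff]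
  show ?thesis
    unfolding class_S_iff W ball_simps
  proof (intro conjI ballI impI)
    fix x y z assume x: "x \<in> V" "y \<in> V" "z \<in> V" "perp F (f x) (f y)" "perp F (f y) (f z)"
    then have "perp E x y" "perp E y z" using FE(2) by blast+
    then have "perp E x z" using cV x(1-3) by blast
    then show "perp F (f x) (f z)" using FE(2) x(1-3) by blast
  next
    fix u u' v v' assume x: "u \<in> V" "u' \<in> V" "v \<in> V" "v' \<in> V"
      and "perp F (f u) (f u')" "perp F (f v) (f v')" "\<not> perp F (f u) (f v)"
    then have "perp E u u'" "perp E v v'" "\<not> perp E u v" using FE(2) by blast+
    then have "(E u v \<longleftrightarrow> E u v') = (E u' v \<longleftrightarrow> E u' v')" using cV x by blast
    then show "(F (f u) (f v) \<longleftrightarrow> F (f u) (f v')) = (F (f u') (f v) \<longleftrightarrow> F (f u') (f v'))"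
      unfolding FE(1)[OF x(1,3)] FE(1)[OF x(1,4)] FE(1)[OF x(2,3)] FE(1)[OF x(2,4)] .
  qed (use cV FE(1) in auto)
qed

text \<open>The usual Fraisse argument: embed the one-point extension, then pull the image of the
  new vertex \<open>None\<close> back along an automorphism extending the embedding of
  \<open>X\<close>. The detour over \<open>{0..<card ?W}\<close> brings the extension to the vertex
  type used by the universality clause.\<close>

lemma semigeneric_tournament_extend:
  assumes V: "semigeneric_tournament V E" and X: "X \<subseteq> V" "finite X"
    and F: "class_S (insert None (Some ` X)) F"
    and FE: "\<And>x y. x \<in> X \<Longrightarrow> y \<in> X \<Longrightarrow> F (Some x) (Some y) \<longleftrightarrow> E x y"
  shows "\<exists>u\<in>V. u \<notin> X \<and> (\<forall>x\<in>X. (E u x \<longleftrightarrow> F None (Some x)) \<and> (E x u \<longleftrightarrow> F (Some x) None))"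
proof -
  let ?W = "insert None (Some ` X)"
  obtain h where h: "bij_betw h ?W {0..<card ?W}"
    using ex_bij_betw_finite_nat[of ?W] X(2) by auto
  let ?F = "\<lambda>m n. F (inv_into ?W h m) (inv_into ?W h n)"
  have hi: "graph_iso ?W F {0..<card ?W} ?F h"
    using h bij_betw_inv_into_left[OF h] unfolding graph_iso_def by simp
  then have "class_S {0..<card ?W} ?F" using F by (rule class_S_graph_iso)
  moreover have "\<exists>U f. finite U \<and> U \<subseteq> V \<and> graph_iso W' F' U E f" if "class_S W' F'"
    for W' :: "nat set" and F'
    using V that unfolding semigeneric_tournament_def by blast
  ultimately have "\<exists>U f. finite U \<and> U \<subseteq> V \<and> graph_iso {0..<card ?W} ?F U E f" by blast
  then obtain U k where U: "U \<subseteq> V" and k: "graph_iso {0..<card ?W} ?F U E k"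
    by (elim exE conjE) (rule that)
  define f where "f = k \<circ> h"
  have f: "bij_betw f ?W U"
    using bij_betw_trans[OF h] k unfolding f_def graph_iso_def by blast
  have fE: "E (f a) (f b) \<longleftrightarrow> F a b" if "a \<in> ?W" "b \<in> ?W" for a b
  proof -
    have "h a \<in> {0..<card ?W}" "h b \<in> {0..<card ?W}" using h that bij_betwE by blast+
    then have "E (k (h a)) (k (h b)) \<longleftrightarrow> ?F (h a) (h b)" using k unfolding graph_iso_def by blast
    then show ?thesis using bij_betw_inv_into_left[OF h] that by (simp add: f_def)
  qed
  have inj: "inj_on f ?W" using f by (rule bij_betw_imp_inj_on)
  have fU: "f a \<in> V" if "a \<in> ?W" for a using f that U bij_betwE by blast
  have "graph_iso X E ((f \<circ> Some) ` X) E (f \<circ> Some)"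
    unfolding graph_iso_def
  proof
    show "bij_betw (f \<circ> Some) X ((f \<circ> Some) ` X)"
      using inj by (auto simp: bij_betw_def inj_on_def)
    show "\<forall>x\<in>X. \<forall>y\<in>X. E x y \<longleftrightarrow> E ((f \<circ> Some) x) ((f \<circ> Some) y)"
      using fE FE by simp
  qed
  moreover have "(f \<circ> Some) ` X \<subseteq> V" using fU by auto
  moreover have "ultrahomogeneous V E" using V by (simp add: semigeneric_tournament_def)
  ultimately have "\<exists>g. graph_iso V E V E g \<and> (\<forall>x\<in>X. g x = (f \<circ> Some) x)"
    using X unfolding ultrahomogeneous_def by (metis finite_imageI)
  then obtain g where g: "graph_iso V E V E g" "\<forall>x\<in>X. g x = (f \<circ> Some) x"
    by (elim exE conjE) (rule that)
  have bij: "bij_betw g V V" using g(1) by (simp add: graph_iso_def)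
  obtain u where u: "u \<in> V" "g u = f None"
    using bij_betw_imp_surj_on[OF bij] fU[of None] by (metis imageE insertI1)
  have "u \<notin> X"
  proof
    assume "u \<in> X"
    then have "f (Some u) = f None" using u(2) g(2) by simp
    then show False using inj \<open>u \<in> X\<close> by (auto simp: inj_on_def)
  qed
  moreover have "(E u x \<longleftrightarrow> F None (Some x)) \<and> (E x u \<longleftrightarrow> F (Some x) None)" if x: "x \<in> X" for x
  proof -
    have "E u x \<longleftrightarrow> E (g u) (g x)" "E x u \<longleftrightarrow> E (g x) (g u)"
      using g(1) u(1) x X(1) unfolding graph_iso_def by blast+
    then show ?thesis using fE x u(2) g(2) by simp
  qed
  ultimately show ?thesis using u(1) by blast
qed

text \<open>\<open>None\<close> is alone in its part, so a pair containing it is degenerate and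
  parity holds trivially.\<close>

lemma semigeneric_tournament_extend_new_part:
  assumes V: "semigeneric_tournament V E" and X: "X \<subseteq> V" "finite X"
  shows "\<exists>u\<in>V. \<forall>x\<in>X. \<not> perp E u x \<and> (E u x \<longleftrightarrow> x \<in> S)"
proof -
  define F where "F a b = (case (a, b) of (Some x, Some y) \<Rightarrow> E x y | (None, Some x) \<Rightarrow> x \<in> S
    | (Some x, None) \<Rightarrow> x \<notin> S | _ \<Rightarrow> False)" for a b
  have F [simp]: "F (Some x) (Some y) \<longleftrightarrow> E x y" "F None (Some x) \<longleftrightarrow> x \<in> S"
    "F (Some x) None \<longleftrightarrow> x \<notin> S" "\<not> F None None" for x y
    by (simp_all add: F_def)
  have cX: "class_S X E" using V X unfolding semigeneric_tournament_def by blast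
  have p [simp]: "perp F (Some x) (Some y) \<longleftrightarrow> perp E x y" "\<not> perp F (Some x) None"
    "\<not> perp F None (Some x)" "perp F None None" for x y
    by (auto simp: perp_def)
  have "class_S (insert None (Some ` X)) F"
    unfolding class_S_iff
  proof (intro conjI ballI impI)
    show "\<not> F a a" if "a \<in> insert None (Some ` X)" for a
      using class_S_irrefl[OF cX] that by auto
    show "\<not> F b a" if "a \<in> insert None (Some ` X)" "b \<in> insert None (Some ` X)" "F a b" for a b
      using class_S_asym[OF cX] that by auto
    show "perp F a c"
      if abc: "a \<in> insert None (Some ` X)" "b \<in> insert None (Some ` X)" "c \<in> insert None (Some ` X)"
        "perp F a b" "perp F b c" for a b c
    proof (cases a)
      case None
      then have "b = None" using abc(4) by (cases b) auto
      then have "c = None" using abc(5) by (cases c) auto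
      then show ?thesis using None by simp
    next
      case a: (Some x)
      then obtain y where b: "b = Some y" using abc(4) by (cases b) auto
      then obtain z where c: "c = Some z" using abc(5) by (cases c) auto
      have "x \<in> X" "y \<in> X" "z \<in> X" "perp E x y" "perp E y z"
        using abc a b c by auto
      then have "perp E x z" by (rule class_S_perp_trans[OF cX])
      then show ?thesis using a c by simp
    qed
    show "(F a b \<longleftrightarrow> F a b') = (F a' b \<longleftrightarrow> F a' b')"
      if W: "a \<in> insert None (Some ` X)" "a' \<in> insert None (Some ` X)"
        "b \<in> insert None (Some ` X)" "b' \<in> insert None (Some ` X)"
        and ab: "perp F a a'" "perp F b b'" "\<not> perp F a b" for a a' b b'
    proof (cases "a = None \<or> b = None")
      case True
      then have "a = a' \<or> b = b'" using ab(1,2) by (cases a'; cases b') auto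
      then show ?thesis by blast
    next
      case False
      then obtain x x' y y' where xy: "a = Some x" "b = Some y" "a' = Some x'" "b' = Some y'"
        using ab(1,2) by (cases a'; cases b') auto
      then have "perp E x x'" "perp E y y'" "\<not> perp E x y" "x \<in> X" "x' \<in> X" "y \<in> X" "y' \<in> X"
        using ab W by auto
      then have "(E x y \<longleftrightarrow> E x y') = (E x' y \<longleftrightarrow> E x' y')"
        by (intro class_S_parity[OF cX])
      then show ?thesis by (simp only: xy F)
    qed
  qed (use X(2) in simp)
  from semigeneric_tournament_extend[OF V X this] have
    "\<exists>u\<in>V. \<forall>x\<in>X. (E u x \<longleftrightarrow> x \<in> S) \<and> (E x u \<longleftrightarrow> x \<notin> S)" by auto
  then show ?thesis unfolding perp_def by blast
qed

lemma semigeneric_tournament_extend_part: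
  assumes V: "semigeneric_tournament V E" and X: "X \<subseteq> V" "finite X" and w: "w \<in> V"
    and S: "\<And>x x'. \<lbrakk>x \<in> X; x' \<in> X; \<not> perp E x w; perp E x x'\<rbrakk> \<Longrightarrow>
      (x \<in> S \<longleftrightarrow> x' \<in> S) = (E w x \<longleftrightarrow> E w x')"
  shows "\<exists>u\<in>V. perp E u w \<and> u \<notin> X \<and> (\<forall>x\<in>X. \<not> perp E x w \<longrightarrow> (E u x \<longleftrightarrow> x \<in> S))"
proof -
  let ?X = "insert w X"
  define F where "F a b = (case (a, b) of (Some x, Some y) \<Rightarrow> E x y
    | (None, Some x) \<Rightarrow> \<not> perp E x w \<and> x \<in> S
    | (Some x, None) \<Rightarrow> \<not> perp E x w \<and> x \<notin> S | _ \<Rightarrow> False)" for a b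
  have F [simp]: "F (Some x) (Some y) \<longleftrightarrow> E x y" "F None (Some x) \<longleftrightarrow> \<not> perp E x w \<and> x \<in> S"
    "F (Some x) None \<longleftrightarrow> \<not> perp E x w \<and> x \<notin> S" "\<not> F None None" for x y
    by (simp_all add: F_def)
  have cX: "class_S ?X E" using V X w unfolding semigeneric_tournament_def by simp
  have refl: "perp E x x" if "x \<in> ?X" for x
    using class_S_irrefl[OF cX that] by (simp add: perp_def)
  have sym: "perp E x y \<longleftrightarrow> perp E y x" for x y by (auto simp: perp_def)
  have trans: "perp E x z" if "perp E x y" "perp E y z" "x \<in> ?X" "y \<in> ?X" "z \<in> ?X" for x y z
    using class_S_perp_trans[OF cX] that by blast
  have par: "(E u v \<longleftrightarrow> E u v') = (E u' v \<longleftrightarrow> E u' v')"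
    if "perp E u u'" "perp E v v'" "\<not> perp E u v" "u \<in> ?X" "u' \<in> ?X" "v \<in> ?X" "v' \<in> ?X" for u u' v v'
    by (rule class_S_parity[OF cX that(4-7) that(1-3)])
  have anti: "E x y \<longleftrightarrow> \<not> E y x" if "\<not> perp E x y" "x \<in> ?X" "y \<in> ?X" for x y
    using class_S_asym[OF cX] that unfolding perp_def by blast
  have S': "(x \<in> S \<longleftrightarrow> x' \<in> S) = (E w x \<longleftrightarrow> E w x')"
    if "\<not> perp E x w" "perp E x x'" "x \<in> ?X" "x' \<in> ?X" for x x'
  proof -
    have "x \<noteq> w" "x' \<noteq> w" using that refl by blast+
    then show ?thesis using S that by blast
  qed
  \<comment> \<open>The new vertex \<open>None\<close> behaves like \<open>w\<close>, with the edges to the parts where \<open>c\<close> fails reversed.\<close>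
  define r where "r a = (case a of None \<Rightarrow> w | Some x \<Rightarrow> x)" for a
  let ?W = "insert None (Some ` ?X)"
  have rN: "r None = w" by (simp add: r_def)
  have rW: "r a \<in> ?X" if "a \<in> ?W" for a using that by (auto simp: r_def)
  have p: "perp F a b \<longleftrightarrow> perp E (r a) (r b)" if "a \<in> ?W" "b \<in> ?W" for a b
    using refl[of w] by (cases a; cases b) (auto simp: r_def perp_def)
  \<comment> \<open>The hypothesis on \<open>S\<close> says precisely that \<open>c\<close> is
    constant on each part other than that of \<open>w\<close>. Reversing the edges of
    \<open>w\<close> to entire parts preserves parity.\<close>
  define c where "c x \<longleftrightarrow> (x \<in> S) = E w x" for x
  have c: "c x \<longleftrightarrow> c x'" if "\<not> perp E x w" "perp E x x'" "x \<in> ?X" "x' \<in> ?X" for x x'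
    using S'[OF that] by (auto simp: c_def)
  have Fc: "F a b \<longleftrightarrow> (E (r a) (r b) \<longleftrightarrow> (a = None \<longrightarrow> c (r b)) \<and> (b = None \<longrightarrow> c (r a)))"
    if ab: "a \<in> ?W" "b \<in> ?W" "\<not> perp E (r a) (r b)" for a b
  proof (cases a)
    case a: None
    then obtain x where b: "b = Some x" using ab(3) refl[of w] by (cases b) (auto simp: r_def)
    then have "\<not> perp E x w" using ab(3) a sym by (simp add: r_def)
    then show ?thesis using a b by (auto simp: r_def c_def)
  next
    case a: (Some x)
    show ?thesis
    proof (cases b)
      case b: None
      then have "\<not> perp E x w" "E x w \<longleftrightarrow> \<not> E w x"
        using ab a anti by (auto simp: r_def)
      then show ?thesis using a b by (auto simp: r_def c_def)
    next
      case (Some y)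
      then show ?thesis using a by (simp add: r_def)
    qed
  qed
  have "class_S ?W F"
    unfolding class_S_iff
  proof (intro conjI ballI impI)
    fix a b assume ab: "a \<in> ?W" "b \<in> ?W" "F a b"
    show "\<not> F b a"
    proof (cases "a = None \<or> b = None")
      case True
      then show ?thesis using ab(3) by (cases a; cases b) auto
    next
      case False
      then obtain x y where xy: "a = Some x" "b = Some y" by auto
      then have "x \<in> ?X" "y \<in> ?X" "E x y" using ab by auto
      then have "\<not> E y x" by (rule class_S_asym[OF cX])
      then show ?thesis using xy by simp
    qed
  next
    fix a b d assume "a \<in> ?W" "b \<in> ?W" "d \<in> ?W" "perp F a b" "perp F b d"
    then show "perp F a d" using p trans rW by metis
  next
    fix a a' b b' assume W: "a \<in> ?W" "a' \<in> ?W" "b \<in> ?W" "b' \<in> ?W"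
      and "perp F a a'" "perp F b b'" "\<not> perp F a b"
    then have q: "perp E (r a) (r a')" "perp E (r b) (r b')" "\<not> perp E (r a) (r b)"
      using p by blast+
    note R = rW[OF W(1)] rW[OF W(2)] rW[OF W(3)] rW[OF W(4)]
    show "(F a b \<longleftrightarrow> F a b') = (F a' b \<longleftrightarrow> F a' b')"
    proof -
      have q': "\<not> perp E (r a) (r b')" "\<not> perp E (r a') (r b)" "\<not> perp E (r a') (r b')"
        using q R trans sym by metis+
      note F4 = Fc[OF W(1,3) q(3)] Fc[OF W(1,4) q'(1)] Fc[OF W(2,3) q'(2)] Fc[OF W(2,4) q'(3)]
      have E4: "(E (r a) (r b) \<longleftrightarrow> E (r a) (r b')) = (E (r a') (r b) \<longleftrightarrow> E (r a') (r b'))"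
        using par[OF q R] .
      have "\<not> (a = None \<and> b = None)" "\<not> (a = None \<and> b' = None)"
        "\<not> (a' = None \<and> b = None)" "\<not> (a' = None \<and> b' = None)"
        using q(3) q' refl[of w] rN by (metis insertI1)+
      then consider "a = None \<or> a' = None" "b \<noteq> None" "b' \<noteq> None"
        | "b = None \<or> b' = None" "a \<noteq> None" "a' \<noteq> None"
        | "a \<noteq> None" "a' \<noteq> None" "b \<noteq> None" "b' \<noteq> None"
        by metis
      then show ?thesis
      proof cases
        case 1
        then have "\<not> perp E (r b) w" using q(3) q' rN sym by metis
        then have "c (r b) \<longleftrightarrow> c (r b')" using c q(2) R by blast
        then show ?thesis unfolding F4 using 1 E4 by argo
      next
        case 2
        then have "\<not> perp E (r a) w" using q(3) q' rN by metis
        then have "c (r a) \<longleftrightarrow> c (r a')" using c q(1) R by blast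
        then show ?thesis unfolding F4 using 2 E4 by argo
      next
        case 3
        then show ?thesis unfolding F4 using E4 by argo
      qed
    qed
  qed (use X class_S_irrefl[OF cX] in auto)
  from semigeneric_tournament_extend[OF V _ _ this] X w obtain u where
    u: "u \<in> V" "u \<notin> ?X" "\<And>x. x \<in> ?X \<Longrightarrow> (E u x \<longleftrightarrow> \<not> perp E x w \<and> x \<in> S) \<and> (E x u \<longleftrightarrow> \<not> perp E x w \<and> x \<notin> S)"
    by auto
  then show ?thesis using refl[of w] unfolding perp_def by blast
qed

text \<open>For finite \<open>V\<close>, the extension property over \<open>V\<close> itself would
  yield a vertex not in its own part.\<close>

lemma semigeneric_tournament_infinite:
  assumes "semigeneric_tournament V E"
  shows "infinite V"
proof
  assume "finite V"
  then obtain u where "u \<in> V" "\<not> perp E u u"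
    using semigeneric_tournament_extend_new_part[OF assms subset_refl, of "{}"] by blast
  moreover have "class_S V E"
    using assms \<open>finite V\<close> unfolding semigeneric_tournament_def by blast
  ultimately show False using class_S_irrefl unfolding perp_def by metis
qed

lemma semigeneric_pullback:
  fixes E :: "'a \<Rightarrow> 'a \<Rightarrow> bool" and \<phi> :: "nat \<Rightarrow> 'a"
  assumes V: "semigeneric_tournament V E" and \<phi>: "bij_betw \<phi> UNIV V"
  shows "semigeneric (\<lambda>m n. E (\<phi> m) (\<phi> n))"
proof -
  let ?E = "\<lambda>m n. E (\<phi> m) (\<phi> n)"
  have p: "perp ?E m n \<longleftrightarrow> perp E (\<phi> m) (\<phi> n)" for m n
    by (simp add: perp_def)
  have \<phi>V: "\<phi> n \<in> V" for n using \<phi> by (auto simp: bij_betw_def)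
  have inj: "\<phi> m = \<phi> n \<longleftrightarrow> m = n" for m n
    using \<phi> by (auto simp: bij_betw_def inj_on_def)
  have surj: "\<exists>n. v = \<phi> n" if "v \<in> V" for v
    using \<phi> that by (auto simp: bij_betw_def)
  have fin: "class_S U E" if "finite U" "U \<subseteq> V" for U
    using V that unfolding semigeneric_tournament_def by blast
  show ?thesis
  proof
    fix x y assume "?E x y"
    then show "\<not> ?E y x"
      using class_S_asym[OF fin[of "{\<phi> x, \<phi> y}"]] \<phi>V by simp
  next
    fix x y z assume xyz: "perp ?E x y" "perp ?E y z"
    have "class_S {\<phi> x, \<phi> y, \<phi> z} E" using fin \<phi>V by simp
    then show "perp ?E x z"
      unfolding p by (rule class_S_perp_trans[OF _ _ _ _ xyz[unfolded p]]) simp_all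
  next
    fix x x' y y' assume xy: "perp ?E x x'" "perp ?E y y'" "\<not> perp ?E x y"
    have "class_S {\<phi> x, \<phi> x', \<phi> y, \<phi> y'} E" using fin \<phi>V by simp
    then show "(?E x y \<longleftrightarrow> ?E x y') = (?E x' y \<longleftrightarrow> ?E x' y')"
      by (rule class_S_parity[OF _ _ _ _ _ xy[unfolded p]]) simp_all
  next
    fix X S assume "finite (X :: nat set)"
    then obtain u where u: "u \<in> V"
      "\<forall>x\<in>\<phi> ` X. \<not> perp E u x \<and> (E u x \<longleftrightarrow> x \<in> \<phi> ` S)"
      using semigeneric_tournament_extend_new_part[OF V, of "\<phi> ` X" "\<phi> ` S"] \<phi>V by blast
    obtain n where "u = \<phi> n" using surj[OF u(1)] ..
    then have "\<forall>x\<in>X. \<not> perp ?E n x \<and> (?E n x \<longleftrightarrow> x \<in> S)"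
      using u(2) inj unfolding p by (auto simp: image_iff)
    then show "\<exists>u. \<forall>x\<in>X. \<not> perp ?E u x \<and> (?E u x \<longleftrightarrow> x \<in> S)" by blast
  next
    fix X S and w :: nat
    assume X: "finite (X :: nat set)"
      and S: "\<And>x x'. \<lbrakk>x \<in> X; x' \<in> X; \<not> perp ?E x w; perp ?E x x'\<rbrakk> \<Longrightarrow>
        (x \<in> S \<longleftrightarrow> x' \<in> S) = (?E w x \<longleftrightarrow> ?E w x')"
    have img: "\<phi> x \<in> \<phi> ` S \<longleftrightarrow> x \<in> S" for x S using inj by (auto simp: image_iff)
    have "\<exists>u\<in>V. perp E u (\<phi> w) \<and> u \<notin> \<phi> ` X \<and>
        (\<forall>x\<in>\<phi> ` X. \<not> perp E x (\<phi> w) \<longrightarrow> (E u x \<longleftrightarrow> x \<in> \<phi> ` S))"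
    proof (rule semigeneric_tournament_extend_part[OF V])
      fix x x' assume x: "x \<in> \<phi> ` X" "x' \<in> \<phi> ` X" "\<not> perp E x (\<phi> w)" "perp E x x'"
      then obtain m m' where m: "m \<in> X" "m' \<in> X" "x = \<phi> m" "x' = \<phi> m'" by blast
      then have "(m \<in> S \<longleftrightarrow> m' \<in> S) = (?E w m \<longleftrightarrow> ?E w m')"
        using x(3,4) by (intro S) (simp_all add: p)
      then show "(x \<in> \<phi> ` S \<longleftrightarrow> x' \<in> \<phi> ` S) = (E (\<phi> w) x \<longleftrightarrow> E (\<phi> w) x')"
        by (simp only: m img)
    qed (use X \<phi>V in auto)
    then obtain u where u: "u \<in> V" "perp E u (\<phi> w)" "u \<notin> \<phi> ` X"
      "\<forall>x\<in>\<phi> ` X. \<not> perp E x (\<phi> w) \<longrightarrow> (E u x \<longleftrightarrow> x \<in> \<phi> ` S)" by blast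
    obtain n where n: "u = \<phi> n" using surj[OF u(1)] ..
    show "\<exists>u. perp ?E u w \<and> u \<notin> X \<and> (\<forall>x\<in>X. \<not> perp ?E x w \<longrightarrow> (?E u x \<longleftrightarrow> x \<in> S))"
      unfolding p using u(2-4) by (intro exI[of _ n]) (simp add: n img)
  qed
qed

section \<open>Transfer from the natural numbers to \<open>graph_Aut\<close>\<close>

lemma carrier_graph_Aut: "carrier (graph_Aut V E) = {f \<in> Bij V. graph_iso V E V E f}"
  by (simp add: graph_Aut_def)

lemma mult_graph_Aut:
  assumes "f \<in> carrier (graph_Aut V E)" "g \<in> carrier (graph_Aut V E)"
  shows "f \<otimes>\<^bsub>graph_Aut V E\<^esub> g = compose V f g"
  using assms by (simp add: graph_Aut_def BijGroup_def)

lemma one_graph_Aut: "\<one>\<^bsub>graph_Aut V E\<^esub> = (\<lambda>x\<in>V. x)"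
  by (simp add: graph_Aut_def BijGroup_def)

text \<open>Ultrahomogeneity for one-point substructures makes the group transitive on
  vertices.\<close>

lemma graph_Aut_nontrivial:
  assumes V: "semigeneric_tournament V E"
  shows "carrier (graph_Aut V E) \<noteq> {\<one>\<^bsub>graph_Aut V E\<^esub>}"
proof -
  obtain u where u: "u \<in> V"
    using semigeneric_tournament_infinite[OF V] by fastforce
  obtain v where v: "v \<in> V" "v \<noteq> u"
    using semigeneric_tournament_infinite[OF V] by (metis finite.emptyI finite.insertI finite_subset insertI1 subsetI)
  have irrefl: "\<not> E x x" if "x \<in> V" for x
    using V that unfolding semigeneric_tournament_def oriented_graph_def irreflp_on_def by blast
  have "graph_iso {u} E {v} E (\<lambda>_. v)"
    using irrefl u v by (simp add: graph_iso_def bij_betw_def)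
  moreover have "ultrahomogeneous V E" using V by (simp add: semigeneric_tournament_def)
  ultimately obtain g where g: "graph_iso V E V E g" "g u = v"
    unfolding ultrahomogeneous_def using u v
    by (metis (no_types, lifting) empty_subsetI finite.emptyI finite.insertI insertI1 insert_subset)
  have "restrict g V \<in> carrier (graph_Aut V E)"
    using g(1) unfolding carrier_graph_Aut graph_iso_def Bij_def by simp
  moreover have "restrict g V \<noteq> (\<lambda>x\<in>V. x)"
    using g(2) u v(2) by (metis restrict_apply')
  ultimately show ?thesis unfolding one_graph_Aut by blast
qed

theorem theoremD:
  fixes V :: "'a set" and E :: "'a \<Rightarrow> 'a \<Rightarrow> bool"
  assumes "semigeneric_tournament V E"
  shows "is_simple_group (graph_Aut V E)"
proof -
  let ?G = "graph_Aut V E"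
  interpret G: group ?G by (rule group_graph_Aut)
  define \<phi> where "\<phi> = from_nat_into V"
  have \<phi>: "bij_betw \<phi> UNIV V"
    unfolding \<phi>_def using assms semigeneric_tournament_infinite[OF assms]
    by (intro bij_betw_from_nat_into) (simp_all add: semigeneric_tournament_def)
  define \<psi> where "\<psi> = inv_into UNIV \<phi>"
  have \<phi>V [simp]: "\<phi> n \<in> V" for n using \<phi> by (auto simp: bij_betw_def)
  have \<psi>\<phi> [simp]: "\<psi> (\<phi> n) = n" for n
    unfolding \<psi>_def using \<phi> by (simp add: bij_betw_def)
  have \<phi>\<psi> [simp]: "\<phi> (\<psi> v) = v" if "v \<in> V" for v
    unfolding \<psi>_def using \<phi> that by (simp add: bij_betw_inv_into_right)
  let ?E = "\<lambda>m n. E (\<phi> m) (\<phi> n)"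
  interpret S: semigeneric ?E
    using assms \<phi> by (rule semigeneric_pullback)
  \<comment> \<open>\<open>up\<close> is a homomorphism from \<open>S.Aut\<close> onto the carrier;
    the restriction to \<open>V\<close> is there because members of \<open>Bij V\<close> are
    extensional.\<close>
  define up where "up p = (\<lambda>v\<in>V. \<phi> (p (\<psi> v)))" for p
  have up: "up p \<in> carrier ?G" if p: "p \<in> S.Aut" for p
  proof -
    have "bij_betw (up p) V V"
    proof (rule bij_betw_byWitness[where f' = "up (S.finv p)"])
      show "\<forall>v\<in>V. up (S.finv p) (up p v) = v" "\<forall>v\<in>V. up p (up (S.finv p) v) = v"
        by (simp_all add: up_def S.Aut_inv_f[OF p] S.Aut_f_inv[OF p])
    qed (auto simp: up_def)
    moreover have "E (up p x) (up p y) \<longleftrightarrow> E x y" if "x \<in> V" "y \<in> V" for x y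
      using S.Aut_E[OF p, of "\<psi> x" "\<psi> y"] that by (simp add: up_def)
    ultimately show ?thesis
      by (simp add: carrier_graph_Aut graph_iso_def Bij_def up_def)
  qed
  have up_comp: "up (p \<circ> q) = up p \<otimes>\<^bsub>?G\<^esub> up q" if "p \<in> S.Aut" "q \<in> S.Aut" for p q
    unfolding mult_graph_Aut[OF up[OF that(1)] up[OF that(2)]]
    by (auto simp: up_def compose_def fun_eq_iff)
  have up_id: "up id = \<one>\<^bsub>?G\<^esub>"
    unfolding one_graph_Aut by (auto simp: up_def fun_eq_iff)
  have up_inv: "up (S.finv p) = inv\<^bsub>?G\<^esub> up p" if p: "p \<in> S.Aut" for p
  proof (rule G.inv_equality[symmetric])
    have "S.finv p \<circ> p = id" using S.Aut_inv_f[OF p] by (simp add: fun_eq_iff)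
    then show "up (S.finv p) \<otimes>\<^bsub>?G\<^esub> up p = \<one>\<^bsub>?G\<^esub>"
      using up_comp[OF S.Aut_inv[OF p] p] up_id by simp
  qed (use up p S.Aut_inv in auto)
  have up_onto: "\<exists>p\<in>S.Aut. up p = f" if f: "f \<in> carrier ?G" for f
  proof
    have bij: "bij_betw f V V" and fE: "\<And>x y. x \<in> V \<Longrightarrow> y \<in> V \<Longrightarrow> E (f x) (f y) \<longleftrightarrow> E x y"
      and ext: "f \<in> extensional V"
      using f by (auto simp: carrier_graph_Aut graph_iso_def Bij_def)
    have fV: "f x \<in> V" if "x \<in> V" for x using bij that bij_betwE by blast
    let ?p = "\<lambda>n. \<psi> (f (\<phi> n))"
    have "bij ?p"
    proof (rule o_bij[of "\<lambda>n. \<psi> (inv_into V f (\<phi> n))"])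
      have "inv_into V f x \<in> V" if "x \<in> V" for x
        using bij_betw_inv_into[OF bij] bij_betwE that by blast
      then show "?p \<circ> (\<lambda>n. \<psi> (inv_into V f (\<phi> n))) = id"
        by (simp add: fun_eq_iff bij_betw_inv_into_right[OF bij])
      show "(\<lambda>n. \<psi> (inv_into V f (\<phi> n))) \<circ> ?p = id"
        by (simp add: fun_eq_iff fV bij_betw_inv_into_left[OF bij])
    qed
    then show "?p \<in> S.Aut"
      using fE fV by (simp add: S.Aut_def)
    show "up ?p = f"
      using ext fV by (auto simp: up_def fun_eq_iff extensional_def)
  qed
  have "N = {\<one>\<^bsub>?G\<^esub>} \<or> N = carrier ?G" if N: "N \<lhd> ?G" for N
  proof (rule disjCI)
    assume "N \<noteq> carrier ?G"
    interpret N: normal N ?G by (rule N)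
    \<comment> \<open>The preimage of \<open>N\<close> under \<open>up\<close> has the closure
      properties required by \<open>normal_closed_eq_Aut\<close>, so it is everything or contains
      only \<open>id\<close>.\<close>
    define M where "M = {p \<in> S.Aut. up p \<in> N}"
    have "M \<noteq> S.Aut"
    proof
      assume "M = S.Aut"
      then have "carrier ?G \<subseteq> N" using up_onto unfolding M_def by blast
      then show False using \<open>N \<noteq> carrier ?G\<close> N.subset by blast
    qed
    have "p = id" if p: "p \<in> M" for p
    proof (rule ccontr)
      assume "p \<noteq> id"
      have "M = S.Aut"
      proof (rule S.normal_closed_eq_Aut[OF _ p \<open>p \<noteq> id\<close>])
        show "f \<circ> h \<in> M" if "f \<in> M" "h \<in> M" for f h
          using that up_comp[of f h] S.Aut_comp[of f h] N.m_closed unfolding M_def by auto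
        show "S.finv f \<in> M" if "f \<in> M" for f
          using that up_inv[of f] S.Aut_inv[of f] N.m_inv_closed unfolding M_def by auto
        show "S.finv k \<circ> f \<circ> k \<in> M" if "f \<in> M" "k \<in> S.Aut" for f k
          using that up_comp[of "S.finv k \<circ> f" k] up_comp[of "S.finv k" f] up_inv[of k]
            S.Aut_inv[of k] S.Aut_comp[of "S.finv k" f] S.Aut_comp[of "S.finv k \<circ> f" k]
            N.inv_op_closed1[OF up[of k], of "up f"]
          unfolding M_def by auto
      qed (auto simp: M_def)
      then show False using \<open>M \<noteq> S.Aut\<close> by blast
    qed
    then have "f = \<one>\<^bsub>?G\<^esub>" if "f \<in> N" for f
      using up_onto[of f] that N.subset up_id unfolding M_def by blast
    then show "N = {\<one>\<^bsub>?G\<^esub>}" using N.one_closed by blast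
  qed
  then show ?thesis
    using graph_Aut_nontrivial[OF assms] G.group_axioms unfolding is_simple_group_def by blast
qed

end
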